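(* Let $R$ be a commutative Noetherian ring, let $C$ be a semidualizing $R$-module, and let $M\in\mathcal B_C(R)$. Then $$C\text{-}\mathrm{qpd}_R M<\infty\iff\mathrm{qpd}_R\operatorname{Hom}_R(C,M)<\infty.$$ Moreover: (1) $C\text{-}\mathrm{qpd}_R M=\mathrm{qpd}_R\operatorname{Hom}_R(C,M)$. (2) $P_\bullet$ is a $C$-quasi-projective resolution of $M$ if and only if it is a quasi-projective resolution of $\operatorname{Hom}_R(C,M)$.
   Context: A finitely generated $R$-module $C$ is semidualizing if the homothety map $R\to\operatorname{Hom}_R(C,C)$ is an isomorphism and $\operatorname{Ext}^i_R(C,C)=0$ for all $i>0$. The Bass class $\mathcal B_C(R)$ consists of the $R$-modules $M$ such that the evaluation map $C\otimes_R\operatorname{Hom}_R(C,M)\to M$ is an isomorphism and $\operatorname{Ext}^i_R(C,M)=0=\operatorname{Tor}^R_i(C,\operatorname{Hom}_R(C,M))$ for all $i>0$. For a complex $X_\bullet$ of $R$-modules (homological indexing), $\sup X_\bullet=\sup\{i: X_i\neq0\}$, $\inf X_\bullet=\inf\{i: X_i\neq0\}$ and $\operatorname{hsup}X_\bullet=\sup\{i:\mathrm H_i(X_\bullet)\neq0\}$. A quasi-projective resolution of an $R$-module $L$ is a bounded below complex $P_\bullet$ of projective $R$-modules such that for all $i\ge\inf P_\bullet$ there are non-negative integers $a_i$, not all zero, with $\mathrm H_i(P_\bullet)\cong L^{\oplus a_i}$. The quasi-projective dimension $\mathrm{qpd}_R L$ is the infimum of $\sup P_\bullet-\operatorname{hsup}P_\bullet$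 over all bounded quasi-projective resolutions $P_\bullet$ of $L$ ($\infty$ if there are none), and it is $-\infty$ if $L=0$. A $C$-quasi-projective resolution of an $R$-module $L$ is a bounded complex $P_\bullet$ of projective $R$-modules such that $P_\bullet\otimes_R C$ is not acyclic and each $\mathrm H_i(P_\bullet\otimes_R C)$ is zero or a finite direct sum of copies of $L$. The $C$-quasi-projective dimension $C\text{-}\mathrm{qpd}_R L$ is the infimum of $\sup(P_\bullet\otimes_R C)-\operatorname{hsup}(P_\bullet\otimes_R C)$ over all $C$-quasi-projective resolutions $P_\bullet$ of $L$ ($\infty$ if there are none), and it is $-\infty$ if $L=0$.
   Formalization: Part (2) is stated for M nonzero and with "quasi-projective resolution" read as "bounded quasi-projective resolution"; as written it fails for M = 0 (0→R→R→0 with the identity) and for unbounded resolutions, since C-quasi-projective resolutions are bounded by definition. *)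

theory Defs
  imports
    "HOL-Library.Extended_Real"
    "HOL-Library.FSet"
    "HOL-Algebra.Ring_Divisibility"
    "HOL-Algebra.Module"
begin

text \<open>
  Modules are the records \<^typ>\<open>('r, 'a) module\<close> of \<open>HOL-Algebra\<close>.  Their ring components \<open>mult\<close>
  and \<open>one\<close> carry no meaning for a module and are left undefined in the constructions below.
\<close>

section \<open>Linear maps, submodules and quotients\<close>

definition zero_module :: "('r, 'a) module \<Rightarrow> bool" where
  "zero_module A \<longleftrightarrow> carrier A = {\<zero>\<^bsub>A\<^esub>}"

definition mod_hom :: "('r, 'k) ring_scheme \<Rightarrow> ('r, 'a) module \<Rightarrow> ('r, 'b) module \<Rightarrow> ('a \<Rightarrow> 'b) set" where
  "mod_hom R A B = {f \<in> carrier A \<rightarrow> carrier B.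
     (\<forall>x\<in>carrier A. \<forall>y\<in>carrier A. f (x \<oplus>\<^bsub>A\<^esub> y) = f x \<oplus>\<^bsub>B\<^esub> f y) \<and>
     (\<forall>r\<in>carrier R. \<forall>x\<in>carrier A. f (r \<odot>\<^bsub>A\<^esub> x) = r \<odot>\<^bsub>B\<^esub> f x)}"

definition mod_iso :: "('r, 'k) ring_scheme \<Rightarrow> ('r, 'a) module \<Rightarrow> ('r, 'b) module \<Rightarrow> ('a \<Rightarrow> 'b) set" where
  "mod_iso R A B = {f \<in> mod_hom R A B. bij_betw f (carrier A) (carrier B)}"

definition mod_isomorphic :: "('r, 'k) ring_scheme \<Rightarrow> ('r, 'a) module \<Rightarrow> ('r, 'b) module \<Rightarrow> bool" where
  "mod_isomorphic R A B \<longleftrightarrow> mod_iso R A B \<noteq> {}"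

definition ring_as_module :: "('r, 'k) ring_scheme \<Rightarrow> ('r, 'r) module" where
  "ring_as_module R = \<lparr>carrier = carrier R, mult = mult R, one = one R,
     zero = zero R, add = add R, smult = mult R\<rparr>"

definition hom_module ::
    "('r, 'k) ring_scheme \<Rightarrow> ('r, 'a) module \<Rightarrow> ('r, 'b) module \<Rightarrow> ('r, 'a \<Rightarrow> 'b) module" where
  "hom_module R A B = \<lparr>carrier = mod_hom R A B \<inter> extensional (carrier A),
     mult = undefined, one = undefined,
     zero = (\<lambda>x\<in>carrier A. \<zero>\<^bsub>B\<^esub>),
     add = (\<lambda>f g. \<lambda>x\<in>carrier A. f x \<oplus>\<^bsub>B\<^esub> g x),
     smult = (\<lambda>r f. \<lambda>x\<in>carrier A. r \<odot>\<^bsub>B\<^esub> f x)\<rparr>"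

definition power_module :: "('r, 'a) module \<Rightarrow> nat \<Rightarrow> ('r, nat \<Rightarrow> 'a) module" where
  "power_module A n = \<lparr>carrier = {..<n} \<rightarrow>\<^sub>E carrier A, mult = undefined, one = undefined,
     zero = (\<lambda>i\<in>{..<n}. \<zero>\<^bsub>A\<^esub>),
     add = (\<lambda>v w. \<lambda>i\<in>{..<n}. v i \<oplus>\<^bsub>A\<^esub> w i),
     smult = (\<lambda>r v. \<lambda>i\<in>{..<n}. r \<odot>\<^bsub>A\<^esub> v i)\<rparr>"

definition mod_span :: "('r, 'k) ring_scheme \<Rightarrow> ('r, 'a) module \<Rightarrow> 'a set \<Rightarrow> 'a set" where
  "mod_span R A S = \<Inter>{H. submodule H R A \<and> S \<subseteq> H}"

definition fin_gen :: "('r, 'k) ring_scheme \<Rightarrow> ('r, 'a) module \<Rightarrow> bool" where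
  "fin_gen R A \<longleftrightarrow> (\<exists>S. finite S \<and> S \<subseteq> carrier A \<and> mod_span R A S = carrier A)"

definition quot_module :: "('r, 'a) module \<Rightarrow> 'a set \<Rightarrow> ('r, 'a set) module" where
  "quot_module A N = \<lparr>carrier = a_rcosets\<^bsub>A\<^esub> N, mult = undefined, one = undefined,
     zero = N,
     add = (\<lambda>X Y. X <+>\<^bsub>A\<^esub> Y),
     smult = (\<lambda>r X. \<Union>x\<in>X. N +>\<^bsub>A\<^esub> (r \<odot>\<^bsub>A\<^esub> x))\<rparr>"

section \<open>Free and projective modules\<close>

text \<open>The free module on a set of basis elements: finitely supported coefficient functions.\<close>

definition free_module :: "('r, 'k) ring_scheme \<Rightarrow> 'b set \<Rightarrow> ('r, 'b \<Rightarrow> 'r) module" where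
  "free_module R X = \<lparr>carrier = {z. (\<forall>x\<in>X. z x \<in> carrier R) \<and> (\<forall>x. x \<notin> X \<longrightarrow> z x = \<zero>\<^bsub>R\<^esub>) \<and>
       finite {x. z x \<noteq> \<zero>\<^bsub>R\<^esub>}},
     mult = undefined, one = undefined,
     zero = (\<lambda>x. \<zero>\<^bsub>R\<^esub>),
     add = (\<lambda>z w x. z x \<oplus>\<^bsub>R\<^esub> w x),
     smult = (\<lambda>r z x. r \<otimes>\<^bsub>R\<^esub> z x)\<rparr>"

definition free_gen :: "('r, 'k) ring_scheme \<Rightarrow> 'b \<Rightarrow> 'b \<Rightarrow> 'r" where
  "free_gen R x = (\<lambda>y. if y = x then \<one>\<^bsub>R\<^esub> else \<zero>\<^bsub>R\<^esub>)"

text \<open>The linear map out of a free module that sends each basis element \<open>x\<close> to \<open>b x\<close>.\<close>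

definition lin_ext :: "('r, 'k) ring_scheme \<Rightarrow> ('r, 'a) module \<Rightarrow> ('b \<Rightarrow> 'a) \<Rightarrow> ('b \<Rightarrow> 'r) \<Rightarrow> 'a" where
  "lin_ext R A b z = (\<Oplus>\<^bsub>A\<^esub>x\<in>{x. z x \<noteq> \<zero>\<^bsub>R\<^esub>}. z x \<odot>\<^bsub>A\<^esub> b x)"

text \<open>
  A module is projective if it is a direct summand (equivalently, a retract) of a free module.
  Bases inside the carrier type of \<open>P\<close> suffice, because a retract of some free module is a retract
  of the free module on its own carrier.  Lemma \<open>projective_iff_lifting\<close> below identifies this
  with the lifting property.
\<close>

definition projective_module :: "('r, 'k) ring_scheme \<Rightarrow> ('r, 'p) module \<Rightarrow> bool" where
  "projective_module R P \<longleftrightarrow> Module.module R P \<and>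
     (\<exists>X :: 'p set. \<exists>s \<in> mod_hom R P (free_module R X). \<exists>q \<in> mod_hom R (free_module R X) P.
        \<forall>x\<in>carrier P. q (s x) = x)"

section \<open>Tensor products\<close>

definition tensor_relations ::
    "('r, 'k) ring_scheme \<Rightarrow> ('r, 'a) module \<Rightarrow> ('r, 'b) module \<Rightarrow> ('a \<times> 'b \<Rightarrow> 'r) set" where
  "tensor_relations R A B =
    (let F = free_module R (carrier A \<times> carrier B); e = (\<lambda>a b. free_gen R (a, b)) in
      {e (a \<oplus>\<^bsub>A\<^esub> a') b \<ominus>\<^bsub>F\<^esub> (e a b \<oplus>\<^bsub>F\<^esub> e a' b) | a a' b.
         a \<in> carrier A \<and> a' \<in> carrier A \<and> b \<in> carrier B} \<union>
      {e a (b \<oplus>\<^bsub>B\<^esub> b') \<ominus>\<^bsub>F\<^esub> (e a b \<oplus>\<^bsub>F\<^esub> e a b') | a b b'.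
         a \<in> carrier A \<and> b \<in> carrier B \<and> b' \<in> carrier B} \<union>
      {e (r \<odot>\<^bsub>A\<^esub> a) b \<ominus>\<^bsub>F\<^esub> (r \<odot>\<^bsub>F\<^esub> e a b) | r a b.
         r \<in> carrier R \<and> a \<in> carrier A \<and> b \<in> carrier B} \<union>
      {e a (r \<odot>\<^bsub>B\<^esub> b) \<ominus>\<^bsub>F\<^esub> (r \<odot>\<^bsub>F\<^esub> e a b) | r a b.
         r \<in> carrier R \<and> a \<in> carrier A \<and> b \<in> carrier B})"

definition tensor_null ::
    "('r, 'k) ring_scheme \<Rightarrow> ('r, 'a) module \<Rightarrow> ('r, 'b) module \<Rightarrow> ('a \<times> 'b \<Rightarrow> 'r) set" where
  "tensor_null R A B =
     mod_span R (free_module R (carrier A \<times> carrier B)) (tensor_relations R A B)"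

definition tensor_module ::
    "('r, 'k) ring_scheme \<Rightarrow> ('r, 'a) module \<Rightarrow> ('r, 'b) module \<Rightarrow> ('r, ('a \<times> 'b \<Rightarrow> 'r) set) module"
  where
  "tensor_module R A B =
     quot_module (free_module R (carrier A \<times> carrier B)) (tensor_null R A B)"

definition pure_tensor ::
    "('r, 'k) ring_scheme \<Rightarrow> ('r, 'a) module \<Rightarrow> ('r, 'b) module \<Rightarrow> 'a \<Rightarrow> 'b \<Rightarrow> ('a \<times> 'b \<Rightarrow> 'r) set" where
  "pure_tensor R A B a b =
     tensor_null R A B +>\<^bsub>free_module R (carrier A \<times> carrier B)\<^esub> free_gen R (a, b)"

text \<open>
  The map out of a tensor product induced by a bilinear map \<open>\<beta>\<close>; bilinearity makes the value
  independent of the representative chosen in the coset \<open>X\<close>.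
\<close>

definition tensor_lift ::
    "('r, 'k) ring_scheme \<Rightarrow> ('r, 'c) module \<Rightarrow> ('a \<Rightarrow> 'b \<Rightarrow> 'c) \<Rightarrow> ('a \<times> 'b \<Rightarrow> 'r) set \<Rightarrow> 'c" where
  "tensor_lift R D \<beta> X = lin_ext R D (\<lambda>(a, b). \<beta> a b) (SOME z. z \<in> X)"

section \<open>Complexes\<close>

text \<open>Homological indexing: \<open>cx_diff X i\<close> maps \<open>cx_mod X i\<close> to \<open>cx_mod X (i - 1)\<close>.\<close>

record ('r, 'a) mod_complex =
  cx_mod :: "int \<Rightarrow> ('r, 'a) module"
  cx_diff :: "int \<Rightarrow> 'a \<Rightarrow> 'a"

definition is_complex :: "('r, 'k) ring_scheme \<Rightarrow> ('r, 'a) mod_complex \<Rightarrow> bool" where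
  "is_complex R X \<longleftrightarrow> (\<forall>i. Module.module R (cx_mod X i) \<and>
     cx_diff X i \<in> mod_hom R (cx_mod X i) (cx_mod X (i - 1)) \<and>
     (\<forall>x\<in>carrier (cx_mod X i). cx_diff X (i - 1) (cx_diff X i x) = \<zero>\<^bsub>cx_mod X (i - 2)\<^esub>))"

definition homology :: "('r, 'a) mod_complex \<Rightarrow> int \<Rightarrow> ('r, 'a set) module" where
  "homology X i = quot_module
     ((cx_mod X i)\<lparr>carrier := {x \<in> carrier (cx_mod X i). cx_diff X i x = \<zero>\<^bsub>cx_mod X (i - 1)\<^esub>}\<rparr>)
     (cx_diff X (i + 1) ` carrier (cx_mod X (i + 1)))"

definition acyclic_complex :: "('r, 'a) mod_complex \<Rightarrow> bool" where
  "acyclic_complex X \<longleftrightarrow> (\<forall>i. zero_module (homology X i))"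

definition bounded_below_complex :: "('r, 'a) mod_complex \<Rightarrow> bool" where
  "bounded_below_complex X \<longleftrightarrow> (\<exists>m. \<forall>i<m. zero_module (cx_mod X i))"

definition bounded_complex :: "('r, 'a) mod_complex \<Rightarrow> bool" where
  "bounded_complex X \<longleftrightarrow> (\<exists>m n. \<forall>i. i < m \<or> n < i \<longrightarrow> zero_module (cx_mod X i))"

text \<open>
  The values lie in \<^typ>\<open>ereal\<close>, so that the supremum and infimum of the empty set are \<open>-\<infinity>\<close> and \<open>\<infinity>\<close>.
\<close>

definition cx_sup :: "('r, 'a) mod_complex \<Rightarrow> ereal" where
  "cx_sup X = (SUP i\<in>{i. \<not> zero_module (cx_mod X i)}. ereal (real_of_int i))"

definition cx_inf :: "('r, 'a) mod_complex \<Rightarrow> ereal" where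
  "cx_inf X = (INF i\<in>{i. \<not> zero_module (cx_mod X i)}. ereal (real_of_int i))"

definition cx_hsup :: "('r, 'a) mod_complex \<Rightarrow> ereal" where
  "cx_hsup X = (SUP i\<in>{i. \<not> zero_module (homology X i)}. ereal (real_of_int i))"

definition tensor_complex ::
    "('r, 'k) ring_scheme \<Rightarrow> ('r, 'a) mod_complex \<Rightarrow> ('r, 'b) module
      \<Rightarrow> ('r, ('a \<times> 'b \<Rightarrow> 'r) set) mod_complex" where
  "tensor_complex R X B = \<lparr>cx_mod = (\<lambda>i. tensor_module R (cx_mod X i) B),
     cx_diff = (\<lambda>i. tensor_lift R (tensor_module R (cx_mod X (i - 1)) B)
                      (\<lambda>x b. pure_tensor R (cx_mod X (i - 1)) B (cx_diff X i x) b))\<rparr>"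

text \<open>The cochain complex \<open>Hom(X, B)\<close>, with \<open>Hom(X\<^sub>n, B)\<close> placed in homological degree \<open>-n\<close>.\<close>

definition hom_complex ::
    "('r, 'k) ring_scheme \<Rightarrow> ('r, 'a) mod_complex \<Rightarrow> ('r, 'b) module \<Rightarrow> ('r, 'a \<Rightarrow> 'b) mod_complex"
  where
  "hom_complex R X B = \<lparr>cx_mod = (\<lambda>i. hom_module R (cx_mod X (- i)) B),
     cx_diff = (\<lambda>i f. \<lambda>x\<in>carrier (cx_mod X (1 - i)). f (cx_diff X (1 - i) x))\<rparr>"

section \<open>Ext and Tor\<close>

text \<open>
  Ext and Tor are computed from the canonical free resolution
  \<open>\<dots> \<rightarrow> F\<^sub>1 \<rightarrow> F\<^sub>0 \<rightarrow> A\<close>, where \<open>F\<^sub>0\<close> is free on the elements of \<open>A\<close>, \<open>F\<^sub>1\<close> is free on the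
  elements of \<open>ker (F\<^sub>0 \<rightarrow> A)\<close>, and \<open>F\<^bsub>n+2\<^esub>\<close> is free on the elements of \<open>ker (F\<^bsub>n+1\<^esub> \<rightarrow> F\<^sub>n)\<close>.
  Lemmas \<open>res_aug_surj\<close> and \<open>res_exact\<close> below confirm that this is a resolution.
  To let all \<open>F\<^sub>n\<close> live in one type, the basis elements are trees: a kernel element \<open>z\<close>, being finitely
  supported, is encoded as \<open>Rel\<close> applied to its finite graph \<open>{(x, z x) | z x \<noteq> 0}\<close>.
\<close>

datatype ('r, 'a) res_gen = Gen 'a | Rel "(('r, 'a) res_gen \<times> 'r) fset"

definition res_code ::
    "('r, 'k) ring_scheme \<Rightarrow> (('r, 'a) res_gen \<Rightarrow> 'r) \<Rightarrow> ('r, 'a) res_gen" where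
  "res_code R z = Rel (Abs_fset {(x, z x) | x. z x \<noteq> \<zero>\<^bsub>R\<^esub>})"

definition res_decode ::
    "('r, 'k) ring_scheme \<Rightarrow> ('r, 'a) res_gen \<Rightarrow> ('r, 'a) res_gen \<Rightarrow> 'r" where
  "res_decode R t = (case t of Gen a \<Rightarrow> (\<lambda>_. \<zero>\<^bsub>R\<^esub>)
     | Rel S \<Rightarrow> (\<lambda>x. if \<exists>r. (x, r) |\<in>| S then (THE r. (x, r) |\<in>| S) else \<zero>\<^bsub>R\<^esub>))"

definition res_aug ::
    "('r, 'k) ring_scheme \<Rightarrow> ('r, 'a) module \<Rightarrow> (('r, 'a) res_gen \<Rightarrow> 'r) \<Rightarrow> 'a" where
  "res_aug R A = lin_ext R A (\<lambda>t. case t of Gen a \<Rightarrow> a | Rel S \<Rightarrow> \<zero>\<^bsub>A\<^esub>)"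

definition res_diff ::
    "('r, 'k) ring_scheme \<Rightarrow> (('r, 'a) res_gen \<Rightarrow> 'r) \<Rightarrow> ('r, 'a) res_gen \<Rightarrow> 'r" where
  "res_diff R = lin_ext R (free_module R UNIV) (res_decode R)"

primrec res_basis ::
    "('r, 'k) ring_scheme \<Rightarrow> ('r, 'a) module \<Rightarrow> nat \<Rightarrow> ('r, 'a) res_gen set" where
  "res_basis R A 0 = Gen ` carrier A"
| "res_basis R A (Suc n) = res_code R ` {z \<in> carrier (free_module R (res_basis R A n)).
     (case n of 0 \<Rightarrow> res_aug R A z = \<zero>\<^bsub>A\<^esub> | Suc m \<Rightarrow> res_diff R z = (\<lambda>_. \<zero>\<^bsub>R\<^esub>))}"

definition free_resolution ::
    "('r, 'k) ring_scheme \<Rightarrow> ('r, 'a) module \<Rightarrow> ('r, ('r, 'a) res_gen \<Rightarrow> 'r) mod_complex" where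
  "free_resolution R A = \<lparr>
     cx_mod = (\<lambda>i. free_module R (if i < 0 then {} else res_basis R A (nat i))),
     cx_diff = (\<lambda>i. if i \<le> 0 then (\<lambda>_ _. \<zero>\<^bsub>R\<^esub>) else res_diff R)\<rparr>"

definition Ext ::
    "('r, 'k) ring_scheme \<Rightarrow> ('r, 'a) module \<Rightarrow> ('r, 'b) module \<Rightarrow> nat
      \<Rightarrow> ('r, ((('r, 'a) res_gen \<Rightarrow> 'r) \<Rightarrow> 'b) set) module" where
  "Ext R A B n = homology (hom_complex R (free_resolution R A) B) (- int n)"

definition Tor ::
    "('r, 'k) ring_scheme \<Rightarrow> ('r, 'a) module \<Rightarrow> ('r, 'b) module \<Rightarrow> nat
      \<Rightarrow> ('r, ((('r, 'a) res_gen \<Rightarrow> 'r) \<times> 'b \<Rightarrow> 'r) set set) module" where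
  "Tor R A B n = homology (tensor_complex R (free_resolution R A) B) (int n)"

section \<open>Semidualizing modules and the Bass class\<close>

definition homothety :: "('r, 'c) module \<Rightarrow> 'r \<Rightarrow> 'c \<Rightarrow> 'c" where
  "homothety C r = (\<lambda>x\<in>carrier C. r \<odot>\<^bsub>C\<^esub> x)"

definition semidualizing :: "('r, 'k) ring_scheme \<Rightarrow> ('r, 'c) module \<Rightarrow> bool" where
  "semidualizing R C \<longleftrightarrow> Module.module R C \<and> fin_gen R C \<and>
     homothety C \<in> mod_iso R (ring_as_module R) (hom_module R C C) \<and>
     (\<forall>i>0. zero_module (Ext R C C i))"

definition bass_class :: "('r, 'k) ring_scheme \<Rightarrow> ('r, 'c) module \<Rightarrow> ('r, 'm) module \<Rightarrow> bool" where
  "bass_class R C M \<longleftrightarrow> Module.module R M \<and>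
     tensor_lift R M (\<lambda>c f. f c) \<in> mod_iso R (tensor_module R C (hom_module R C M)) M \<and>
     (\<forall>i>0. zero_module (Ext R C M i) \<and> zero_module (Tor R C (hom_module R C M) i))"

section \<open>Quasi-projective resolutions and dimensions\<close>

definition qp_resolution ::
    "('r, 'k) ring_scheme \<Rightarrow> ('r, 'a) module \<Rightarrow> ('r, 'p) mod_complex \<Rightarrow> bool" where
  "qp_resolution R L P \<longleftrightarrow> is_complex R P \<and> bounded_below_complex P \<and>
     (\<forall>i. projective_module R (cx_mod P i)) \<and>
     (\<exists>a :: int \<Rightarrow> nat.
        (\<forall>i. cx_inf P \<le> ereal (real_of_int i) \<longrightarrow>
           mod_isomorphic R (homology P i) (power_module L (a i))) \<and>
        (\<exists>i. cx_inf P \<le> ereal (real_of_int i) \<and> a i \<noteq> 0))"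

definition C_qp_resolution ::
    "('r, 'k) ring_scheme \<Rightarrow> ('r, 'c) module \<Rightarrow> ('r, 'a) module \<Rightarrow> ('r, 'p) mod_complex \<Rightarrow> bool" where
  "C_qp_resolution R C L P \<longleftrightarrow> is_complex R P \<and> bounded_complex P \<and>
     (\<forall>i. projective_module R (cx_mod P i)) \<and>
     \<not> acyclic_complex (tensor_complex R P C) \<and>
     (\<forall>i. zero_module (homology (tensor_complex R P C) i) \<or>
        (\<exists>n. mod_isomorphic R (homology (tensor_complex R P C) i) (power_module L n)))"

text \<open>
  HOL cannot quantify over all types inside a definition, so the type \<open>'p\<close> that holds the elements of
  the modules in the resolutions is a parameter of both dimensions, given as \<open>TYPE('p)\<close>; it plays the
  role of a universe.
\<close>

definition qpd :: "'p itself \<Rightarrow> ('r, 'k) ring_scheme \<Rightarrow> ('r, 'a) module \<Rightarrow> ereal" where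
  "qpd _ R L = (if zero_module L then -\<infinity>
     else (INF P\<in>{P :: ('r, 'p) mod_complex. bounded_complex P \<and> qp_resolution R L P}.
             cx_sup P - cx_hsup P))"

definition C_qpd ::
    "'p itself \<Rightarrow> ('r, 'k) ring_scheme \<Rightarrow> ('r, 'c) module \<Rightarrow> ('r, 'a) module \<Rightarrow> ereal" where
  "C_qpd _ R C L = (if zero_module L then -\<infinity>
     else (INF P\<in>{P :: ('r, 'p) mod_complex. C_qp_resolution R C L P}.
             cx_sup (tensor_complex R P C) - cx_hsup (tensor_complex R P C)))"

section \<open>Adequacy of the encodings\<close>

text \<open>
  The canonical free resolution is exact and augmented onto \<open>A\<close> (\<open>res_aug_surj\<close>, \<open>res_exact\<close>), and
  projectivity is the lifting property (\<open>projective_lifting\<close> allows arbitrary types for \<open>A\<close> and \<open>B\<close>;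
  \<open>projective_iff_lifting\<close> shows that lifting against one pair of types already suffices).
\<close>

lemma free_module_mem: "z \<in> carrier (free_module R X) \<Longrightarrow> cring R \<Longrightarrow> z x \<in> carrier R"
proof -
  assume "z \<in> carrier (free_module R X)" "cring R"
  then interpret cring R by simp
  show "z x \<in> carrier R" using \<open>z \<in> _\<close> by (cases "x \<in> X") (auto simp: free_module_def)
qed

lemma free_module_is_module:
  assumes "cring R"
  shows "Module.module R (free_module R X)"
proof -
  interpret cring R by fact
  let ?F = "free_module R X"
  have supp: "finite {x. z x \<noteq> \<zero>\<^bsub>R\<^esub>}" if "z \<in> carrier ?F" for z
    using that by (simp add: free_module_def)
  have mem: "z x \<in> carrier R" if "z \<in> carrier ?F" for z x
    using free_module_mem[OF that assms] .
  have out: "z x = \<zero>\<^bsub>R\<^esub>" if "z \<in> carrier ?F" "x \<notin> X" for z x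
    using that by (simp add: free_module_def)
  have memI: "z \<in> carrier ?F"
    if "\<And>x. z x \<in> carrier R" "\<And>x. x \<notin> X \<Longrightarrow> z x = \<zero>\<^bsub>R\<^esub>"
      "finite S" "\<And>x. x \<notin> S \<Longrightarrow> z x = \<zero>\<^bsub>R\<^esub>" for z S
  proof -
    have "{x. z x \<noteq> \<zero>\<^bsub>R\<^esub>} \<subseteq> S" using that(4) by blast
    then have "finite {x. z x \<noteq> \<zero>\<^bsub>R\<^esub>}" using that(3) by (rule finite_subset)
    with that(1,2) show ?thesis by (simp add: free_module_def)
  qed
  have ops: "\<zero>\<^bsub>?F\<^esub> = (\<lambda>x. \<zero>\<^bsub>R\<^esub>)" "z \<oplus>\<^bsub>?F\<^esub> w = (\<lambda>x. z x \<oplus>\<^bsub>R\<^esub> w x)" "r \<odot>\<^bsub>?F\<^esub> z = (\<lambda>x. r \<otimes>\<^bsub>R\<^esub> z x)"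
    for z w r by (simp_all add: free_module_def)
  show ?thesis
  proof (rule Module.moduleI)
    show "abelian_group ?F"
    proof (rule abelian_groupI)
      fix z w assume z: "z \<in> carrier ?F" and w: "w \<in> carrier ?F"
      show "z \<oplus>\<^bsub>?F\<^esub> w \<in> carrier ?F" unfolding ops
        by (rule memI[OF _ _ finite_UnI[OF supp[OF z] supp[OF w]]])
          (simp_all add: mem[OF z] mem[OF w] out[OF z] out[OF w])
      show "z \<oplus>\<^bsub>?F\<^esub> w = w \<oplus>\<^bsub>?F\<^esub> z" unfolding ops
        by (rule ext) (rule a_comm[OF mem[OF z] mem[OF w]])
      fix v assume v: "v \<in> carrier ?F"
      show "z \<oplus>\<^bsub>?F\<^esub> w \<oplus>\<^bsub>?F\<^esub> v = z \<oplus>\<^bsub>?F\<^esub> (w \<oplus>\<^bsub>?F\<^esub> v)" unfolding ops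
        by (rule ext) (rule a_assoc[OF mem[OF z] mem[OF w] mem[OF v]])
    next
      show "\<zero>\<^bsub>?F\<^esub> \<in> carrier ?F" unfolding ops by (rule memI[of _ "{}"]) simp_all
    next
      fix z assume z: "z \<in> carrier ?F"
      show "\<zero>\<^bsub>?F\<^esub> \<oplus>\<^bsub>?F\<^esub> z = z" unfolding ops by (simp add: mem[OF z])
      show "\<exists>y\<in>carrier ?F. y \<oplus>\<^bsub>?F\<^esub> z = \<zero>\<^bsub>?F\<^esub>"
      proof (rule bexI[of _ "\<lambda>x. \<ominus>\<^bsub>R\<^esub> z x"])
        show "(\<lambda>x. \<ominus>\<^bsub>R\<^esub> z x) \<oplus>\<^bsub>?F\<^esub> z = \<zero>\<^bsub>?F\<^esub>" unfolding ops by (simp add: mem[OF z] l_neg)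
        show "(\<lambda>x. \<ominus>\<^bsub>R\<^esub> z x) \<in> carrier ?F"
          by (rule memI[OF _ _ supp[OF z]]) (simp_all add: mem[OF z] out[OF z])
      qed
    qed
  next
    fix a z assume a: "a \<in> carrier R" and z: "z \<in> carrier ?F"
    show "a \<odot>\<^bsub>?F\<^esub> z \<in> carrier ?F" unfolding ops
      by (rule memI[OF _ _ supp[OF z]]) (simp_all add: a mem[OF z] out[OF z])
    fix w assume w: "w \<in> carrier ?F"
    show "a \<odot>\<^bsub>?F\<^esub> (z \<oplus>\<^bsub>?F\<^esub> w) = a \<odot>\<^bsub>?F\<^esub> z \<oplus>\<^bsub>?F\<^esub> a \<odot>\<^bsub>?F\<^esub> w"
      unfolding ops by (rule ext) (rule r_distr[OF mem[OF z] mem[OF w] a])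
  next
    fix a b z assume a: "a \<in> carrier R" and b: "b \<in> carrier R" and z: "z \<in> carrier ?F"
    show "(a \<oplus>\<^bsub>R\<^esub> b) \<odot>\<^bsub>?F\<^esub> z = a \<odot>\<^bsub>?F\<^esub> z \<oplus>\<^bsub>?F\<^esub> b \<odot>\<^bsub>?F\<^esub> z"
      unfolding ops by (rule ext) (rule l_distr[OF a b mem[OF z]])
    show "(a \<otimes>\<^bsub>R\<^esub> b) \<odot>\<^bsub>?F\<^esub> z = a \<odot>\<^bsub>?F\<^esub> (b \<odot>\<^bsub>?F\<^esub> z)"
      unfolding ops by (rule ext) (rule m_assoc[OF a b mem[OF z]])
  next
    fix z assume z: "z \<in> carrier ?F"
    show "\<one>\<^bsub>R\<^esub> \<odot>\<^bsub>?F\<^esub> z = z" unfolding ops by (simp add: mem[OF z])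
  qed fact
qed

lemma lin_ext_superset:
  assumes "Module.module R A" and b: "b \<in> X \<rightarrow> carrier A"
    and z: "z \<in> carrier (free_module R X)"
    and S: "finite S" "{x. z x \<noteq> \<zero>\<^bsub>R\<^esub>} \<subseteq> S" "S \<subseteq> X"
  shows "lin_ext R A b z = (\<Oplus>\<^bsub>A\<^esub>x\<in>S. z x \<odot>\<^bsub>A\<^esub> b x)"
proof -
  interpret Module.module R A by fact
  have "z x \<odot>\<^bsub>A\<^esub> b x \<in> carrier A" if "x \<in> S" for x
    using b z S(3) that by (auto simp: free_module_def intro!: smult_closed)
  moreover have "b x \<in> carrier A" if "x \<in> S" for x using b S(3) that by auto
  ultimately show ?thesis
    unfolding lin_ext_def using S
    by (intro M.add.finprod_mono_neutral_cong_left) auto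
qed

lemma lin_ext_hom:
  assumes mod: "Module.module R A" and b: "b \<in> X \<rightarrow> carrier A"
  shows "lin_ext R A b \<in> mod_hom R (free_module R X) A"
proof -
  interpret Module.module R A by fact
  let ?F = "free_module R X"
  have cl: "(\<lambda>x. z x \<odot>\<^bsub>A\<^esub> b x) \<in> S \<rightarrow> carrier A" if "S \<subseteq> X" "z \<in> carrier ?F" for z S
    using b that by (auto simp: free_module_def intro!: smult_closed)
  have supp: "finite {x. z x \<noteq> \<zero>\<^bsub>R\<^esub>} \<and> {x. z x \<noteq> \<zero>\<^bsub>R\<^esub>} \<subseteq> X" if "z \<in> carrier ?F" for z
    using that by (auto simp: free_module_def)
  interpret F: Module.module R ?F by (rule free_module_is_module) (rule R.cring_axioms)
  show ?thesis unfolding mod_hom_def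
  proof (intro CollectI conjI ballI)
    show "lin_ext R A b \<in> carrier ?F \<rightarrow> carrier A"
      using cl supp unfolding lin_ext_def by (blast intro!: M.finsum_closed)
  next
    fix z w assume zw: "z \<in> carrier ?F" "w \<in> carrier ?F"
    let ?S = "{x. z x \<noteq> \<zero>\<^bsub>R\<^esub>} \<union> {x. w x \<noteq> \<zero>\<^bsub>R\<^esub>}"
    have S: "finite ?S" "?S \<subseteq> X" using supp zw by auto
    have s: "{x. (z \<oplus>\<^bsub>?F\<^esub> w) x \<noteq> \<zero>\<^bsub>R\<^esub>} \<subseteq> ?S" by (auto simp: free_module_def)
    have "lin_ext R A b (z \<oplus>\<^bsub>?F\<^esub> w) = (\<Oplus>\<^bsub>A\<^esub>x\<in>?S. (z \<oplus>\<^bsub>?F\<^esub> w) x \<odot>\<^bsub>A\<^esub> b x)"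
      using zw s S by (intro lin_ext_superset[OF mod b]) auto
    also have "\<dots> = (\<Oplus>\<^bsub>A\<^esub>x\<in>?S. z x \<odot>\<^bsub>A\<^esub> b x \<oplus>\<^bsub>A\<^esub> w x \<odot>\<^bsub>A\<^esub> b x)"
    proof (rule M.finsum_cong')
      fix x assume "x \<in> ?S"
      then have "x \<in> X" using S by auto
      then show "(z \<oplus>\<^bsub>?F\<^esub> w) x \<odot>\<^bsub>A\<^esub> b x = z x \<odot>\<^bsub>A\<^esub> b x \<oplus>\<^bsub>A\<^esub> w x \<odot>\<^bsub>A\<^esub> b x"
        using zw b by (auto simp: free_module_def intro!: smult_l_distr)
    qed (use cl[OF S(2)] zw in auto)
    also have "\<dots> = lin_ext R A b z \<oplus>\<^bsub>A\<^esub> lin_ext R A b w"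
      using cl[OF S(2)] zw
      by (simp only: M.finsum_addf lin_ext_superset[OF mod b zw(1) S(1) Un_upper1 S(2)]
        lin_ext_superset[OF mod b zw(2) S(1) Un_upper2 S(2)])
    finally show "lin_ext R A b (z \<oplus>\<^bsub>?F\<^esub> w) = lin_ext R A b z \<oplus>\<^bsub>A\<^esub> lin_ext R A b w" .
  next
    fix r z assume r: "r \<in> carrier R" and z: "z \<in> carrier ?F"
    let ?S = "{x. z x \<noteq> \<zero>\<^bsub>R\<^esub>}"
    have S: "finite ?S" "?S \<subseteq> X" using supp z by auto
    have s: "{x. (r \<odot>\<^bsub>?F\<^esub> z) x \<noteq> \<zero>\<^bsub>R\<^esub>} \<subseteq> ?S" using r by (auto simp: free_module_def)
    have "lin_ext R A b (r \<odot>\<^bsub>?F\<^esub> z) = (\<Oplus>\<^bsub>A\<^esub>x\<in>?S. (r \<odot>\<^bsub>?F\<^esub> z) x \<odot>\<^bsub>A\<^esub> b x)"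
      using r z s S by (intro lin_ext_superset[OF mod b]) auto
    also have "\<dots> = (\<Oplus>\<^bsub>A\<^esub>x\<in>?S. r \<odot>\<^bsub>A\<^esub> (z x \<odot>\<^bsub>A\<^esub> b x))"
    proof (rule M.finsum_cong')
      fix x assume "x \<in> ?S"
      then have "x \<in> X" using S by auto
      then show "(r \<odot>\<^bsub>?F\<^esub> z) x \<odot>\<^bsub>A\<^esub> b x = r \<odot>\<^bsub>A\<^esub> (z x \<odot>\<^bsub>A\<^esub> b x)"
        using r z b by (auto simp: free_module_def intro!: smult_assoc1)
    qed (use cl[OF S(2) z] r in auto)
    also have "\<dots> = r \<odot>\<^bsub>A\<^esub> lin_ext R A b z"
      unfolding lin_ext_def using finsum_smult_ldistr[OF S(1) r cl[OF S(2) z]] by simp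
    finally show "lin_ext R A b (r \<odot>\<^bsub>?F\<^esub> z) = r \<odot>\<^bsub>A\<^esub> lin_ext R A b z" .
  qed
qed

lemma lin_ext_free_gen:
  assumes mod: "Module.module R A" and b: "b \<in> X \<rightarrow> carrier A" and x: "x \<in> X"
  shows "free_gen R x \<in> carrier (free_module R X)"
    and "lin_ext R A b (free_gen R x) = b x"
proof -
  interpret Module.module R A by fact
  have "{y. (if y = x then \<one>\<^bsub>R\<^esub> else \<zero>\<^bsub>R\<^esub>) \<noteq> \<zero>\<^bsub>R\<^esub>} \<subseteq> {x}" by auto
  then have fin: "finite {y. (if y = x then \<one>\<^bsub>R\<^esub> else \<zero>\<^bsub>R\<^esub>) \<noteq> \<zero>\<^bsub>R\<^esub>}" by (rule finite_subset) simp
  show g: "free_gen R x \<in> carrier (free_module R X)"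
    using x fin by (auto simp: free_module_def free_gen_def)
  have "lin_ext R A b (free_gen R x) = (\<Oplus>\<^bsub>A\<^esub>y\<in>{x}. free_gen R x y \<odot>\<^bsub>A\<^esub> b y)"
    using x by (intro lin_ext_superset[OF mod b g]) (auto simp: free_gen_def)
  also have "\<dots> = b x"
  proof -
    have "b x \<in> carrier A" using b x by auto
    then show ?thesis by (simp add: free_gen_def)
  qed
  finally show "lin_ext R A b (free_gen R x) = b x" .
qed

lemma res_decode_code:
  assumes "finite {x. z x \<noteq> \<zero>\<^bsub>R\<^esub>}"
  shows "res_decode R (res_code R z) = z"
proof -
  have eq: "{(x, z x) | x. z x \<noteq> \<zero>\<^bsub>R\<^esub>} = (\<lambda>x. (x, z x)) ` {x. z x \<noteq> \<zero>\<^bsub>R\<^esub>}" by auto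
  have "finite {(x, z x) | x. z x \<noteq> \<zero>\<^bsub>R\<^esub>}" unfolding eq using assms by (rule finite_imageI)
  then have m: "(x, r) |\<in>| Abs_fset {(x, z x) | x. z x \<noteq> \<zero>\<^bsub>R\<^esub>} \<longleftrightarrow> r = z x \<and> z x \<noteq> \<zero>\<^bsub>R\<^esub>" for x r
    by (auto simp: Abs_fset_inverse)
  show ?thesis unfolding res_decode_def res_code_def res_gen.case m by (rule ext) auto
qed

lemma mod_hom_res_aug:
  assumes "Module.module R A"
  shows "res_aug R A \<in> mod_hom R (free_module R (res_basis R A 0)) A"
proof -
  interpret Module.module R A by fact
  show ?thesis unfolding res_aug_def by (rule lin_ext_hom[OF assms]) auto
qed

lemma res_aug_surj:
  fixes R :: "('r, 'k) ring_scheme" and A :: "('r, 'a) module"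
  assumes "Module.module R A"
  shows "res_aug R A ` carrier (free_module R (res_basis R A 0)) = carrier A"
proof -
  interpret Module.module R A by fact
  have b: "(\<lambda>t :: ('r, 'a) res_gen. case t of Gen a \<Rightarrow> a | Rel S \<Rightarrow> \<zero>\<^bsub>A\<^esub>) \<in> Gen ` carrier A \<rightarrow> carrier A" by auto
  show ?thesis
  proof
    show "res_aug R A ` carrier (free_module R (res_basis R A 0)) \<subseteq> carrier A"
      using mod_hom_res_aug[OF assms] by (auto simp: mod_hom_def)
    show "carrier A \<subseteq> res_aug R A ` carrier (free_module R (res_basis R A 0))"
    proof
      fix a assume a: "a \<in> carrier A"
      then have "Gen a \<in> Gen ` carrier A" by auto
      from lin_ext_free_gen[OF assms b this] show "a \<in> res_aug R A ` carrier (free_module R (res_basis R A 0))"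
        unfolding res_aug_def by (intro image_eqI[of _ _ "free_gen R (Gen a)"]) auto
    qed
  qed
qed


lemma lin_ext_in_submodule:
  assumes mod: "Module.module R A" and H: "submodule H R A" and b: "b \<in> X \<rightarrow> H"
    and z: "z \<in> carrier (free_module R X)"
  shows "lin_ext R A b z \<in> H"
proof -
  interpret Module.module R A by fact
  note E = submoduleE[OF H]
  have "(\<Oplus>\<^bsub>A\<^esub>x\<in>S. z x \<odot>\<^bsub>A\<^esub> b x) \<in> H" if "finite S" "S \<subseteq> X" for S
    using that
  proof (induction S rule: finite_induct)
    case empty
    show ?case using subgroup.one_closed[OF submodule.axioms(1)[OF H]] by simp
  next
    case (insert x S)
    have "z y \<odot>\<^bsub>A\<^esub> b y \<in> H" if "y \<in> X" for y
      using E(4) b z that by (auto simp: free_module_def)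
    with insert E(1) show ?case
      by (subst M.finsum_insert) (auto intro!: E(5))
  qed
  then show ?thesis using z by (auto simp: lin_ext_def free_module_def)
qed

lemma kernel_submodule:
  assumes R: "cring R" and B: "Module.module R B" and f: "f \<in> mod_hom R (free_module R X) B"
  shows "submodule {z \<in> carrier (free_module R X). f z = \<zero>\<^bsub>B\<^esub>} R (free_module R UNIV)"
proof -
  interpret F: Module.module R "free_module R X" by (rule free_module_is_module[OF R])
  interpret U: Module.module R "free_module R UNIV" by (rule free_module_is_module[OF R])
  interpret B: Module.module R B by fact
  have sub: "z x \<in> carrier R" if "z \<in> carrier (free_module R X)" for z x
    using that by (cases "x \<in> X") (auto simp: free_module_def)
  have eq: "zero (free_module R X) = zero (free_module R UNIV)" "add (free_module R X) = add (free_module R UNIV)"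
    "smult (free_module R X) = smult (free_module R UNIV)" by (auto simp: free_module_def)
  have add: "f (x \<oplus>\<^bsub>free_module R X\<^esub> y) = f x \<oplus>\<^bsub>B\<^esub> f y"
    if "x \<in> carrier (free_module R X)" "y \<in> carrier (free_module R X)" for x y
    using f that by (simp add: mod_hom_def)
  have sm: "f (r \<odot>\<^bsub>free_module R X\<^esub> x) = r \<odot>\<^bsub>B\<^esub> f x"
    if "x \<in> carrier (free_module R X)" "r \<in> carrier R" for x r
    using f that by (simp add: mod_hom_def)
  have subset: "carrier (free_module R X) \<subseteq> carrier (free_module R UNIV)"
    using sub by (auto simp: free_module_def)
  have f0: "f \<zero>\<^bsub>free_module R X\<^esub> = \<zero>\<^bsub>B\<^esub>"
    using sm[of "\<zero>\<^bsub>free_module R X\<^esub>" "\<zero>\<^bsub>R\<^esub>"] f by (auto simp: mod_hom_def Pi_iff)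
  have neg: "\<ominus>\<^bsub>free_module R UNIV\<^esub> z = (\<ominus>\<^bsub>R\<^esub> \<one>\<^bsub>R\<^esub>) \<odot>\<^bsub>free_module R X\<^esub> z" if "z \<in> carrier (free_module R X)" for z
    using subset that U.smult_l_minus[of "\<one>\<^bsub>R\<^esub>" z] eq by auto
  show ?thesis
  proof (rule U.submoduleI)
    show "{z \<in> carrier (free_module R X). f z = \<zero>\<^bsub>B\<^esub>} \<subseteq> carrier (free_module R UNIV)"
      using subset by auto
  qed (use f0 in \<open>auto simp: neg sm add eq(1)[symmetric] eq(2)[symmetric] eq(3)[symmetric]\<close>)
qed

lemma res_exact:
  assumes A: "Module.module R A"
  shows "(case n of 0 \<Rightarrow> True | Suc m \<Rightarrow>
        res_diff R \<in> mod_hom R (free_module R (res_basis R A n)) (free_module R (res_basis R A m))) \<and>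
    res_diff R ` carrier (free_module R (res_basis R A (Suc n))) =
      {z \<in> carrier (free_module R (res_basis R A n)).
        case n of 0 \<Rightarrow> res_aug R A z = \<zero>\<^bsub>A\<^esub> | Suc m \<Rightarrow> res_diff R z = (\<lambda>_. \<zero>\<^bsub>R\<^esub>)}"
    (is "?P n \<and> ?Q n")
proof -
  interpret Module.module R A by fact
  have R: "cring R" by (rule R.cring_axioms)
  note FM = free_module_is_module[OF R]
  let ?U = "free_module R (UNIV :: ('a, 'c) res_gen set)"
  define K where "K n = {z \<in> carrier (free_module R (res_basis R A n)).
      case n of 0 \<Rightarrow> res_aug R A z = \<zero>\<^bsub>A\<^esub> | Suc m \<Rightarrow> res_diff R z = (\<lambda>_. \<zero>\<^bsub>R\<^esub>)}" for n
  have basis: "res_basis R A (Suc n) = res_code R ` K n" for n by (simp add: K_def)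
  have dec: "res_decode R (res_code R z) = z" if "z \<in> K n" for n z
    using that by (intro res_decode_code) (auto simp: K_def free_module_def)
  have b: "res_decode R \<in> res_basis R A (Suc n) \<rightarrow> K n" for n
    by (auto simp: basis dec simp del: res_basis.simps)
  have KU: "K n \<subseteq> carrier ?U" for n
    unfolding K_def free_module_def by auto
  have hom: "res_diff R \<in> mod_hom R (free_module R (res_basis R A (Suc n))) ?U" for n
    unfolding res_diff_def by (rule lin_ext_hom[OF FM]) (use b KU in blast)
  have Ksub: "submodule (K n) R ?U" for n
  proof (cases n)
    case 0
    show ?thesis using kernel_submodule[OF R A mod_hom_res_aug[OF A]]
      by (simp add: 0 K_def del: res_basis.simps)
  next
    case (Suc m)
    show ?thesis using kernel_submodule[OF R FM hom, of m]
      by (simp add: Suc K_def free_module_def del: res_basis.simps)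
  qed
  have im: "res_diff R ` carrier (free_module R (res_basis R A (Suc n))) = K n" for n
  proof
    show "res_diff R ` carrier (free_module R (res_basis R A (Suc n))) \<subseteq> K n"
      unfolding res_diff_def using lin_ext_in_submodule[OF FM Ksub b] by blast
    show "K n \<subseteq> res_diff R ` carrier (free_module R (res_basis R A (Suc n)))"
    proof
      fix z assume z: "z \<in> K n"
      have x: "res_code R z \<in> res_basis R A (Suc n)" using z by (simp add: basis del: res_basis.simps)
      have b': "res_decode R \<in> res_basis R A (Suc n) \<rightarrow> carrier ?U" using b KU by blast
      show "z \<in> res_diff R ` carrier (free_module R (res_basis R A (Suc n)))"
        using lin_ext_free_gen[OF FM b' x] dec[OF z]
        unfolding res_diff_def by (intro image_eqI[of _ _ "free_gen R (res_code R z)"]) simp_all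
    qed
  qed
  have "?P n"
  proof (cases n)
    case (Suc m)
    have "res_diff R \<in> carrier (free_module R (res_basis R A (Suc m))) \<rightarrow> carrier (free_module R (res_basis R A m))"
      using im[of m] by (auto simp: K_def simp del: res_basis.simps)
    with hom[of m] show ?thesis by (auto simp: Suc mod_hom_def free_module_def simp del: res_basis.simps)
  qed simp
  with im show ?thesis by (simp add: K_def del: res_basis.simps)
qed

lemma mod_hom_D:
  assumes "f \<in> mod_hom R A B"
  shows "x \<in> carrier A \<Longrightarrow> f x \<in> carrier B"
    and "x \<in> carrier A \<Longrightarrow> y \<in> carrier A \<Longrightarrow> f (x \<oplus>\<^bsub>A\<^esub> y) = f x \<oplus>\<^bsub>B\<^esub> f y"
    and "r \<in> carrier R \<Longrightarrow> x \<in> carrier A \<Longrightarrow> f (r \<odot>\<^bsub>A\<^esub> x) = r \<odot>\<^bsub>B\<^esub> f x"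
  using assms by (auto simp: mod_hom_def)

lemma mod_hom_comp:
  assumes "Module.module R A" "f \<in> mod_hom R A B" "g \<in> mod_hom R B D"
  shows "(\<lambda>x. g (f x)) \<in> mod_hom R A D"
  unfolding mod_hom_def
  by (intro CollectI conjI funcsetI ballI)
    (simp_all add: mod_hom_D[OF assms(2)] mod_hom_D[OF assms(3)])

lemma mod_hom_free_eq:
  assumes B: "Module.module R B"
    and G: "G \<in> mod_hom R (free_module R X) B" and K: "K \<in> mod_hom R (free_module R X) B"
    and eq: "\<And>x. x \<in> X \<Longrightarrow> G (free_gen R x) = K (free_gen R x)"
    and z: "z \<in> carrier (free_module R X)"
  shows "G z = K z"
proof -
  interpret B: Module.module R B by fact
  have R: "cring R" by (rule B.R.cring_axioms)
  let ?F = "free_module R X"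
  interpret F: Module.module R ?F by (rule free_module_is_module[OF R])
  have zero: "f \<zero>\<^bsub>?F\<^esub> = \<zero>\<^bsub>B\<^esub>" if f: "f \<in> mod_hom R ?F B" for f
    using mod_hom_D(3)[OF f B.R.zero_closed F.zero_closed]
    unfolding F.smult_l_null[OF F.zero_closed]
      B.smult_l_null[OF mod_hom_D(1)[OF f F.zero_closed]] .
  have "\<forall>z\<in>carrier ?F. {x. z x \<noteq> \<zero>\<^bsub>R\<^esub>} \<subseteq> S \<longrightarrow> G z = K z" if "finite S" "S \<subseteq> X" for S
    using that
  proof (induction S rule: finite_induct)
    case empty
    have "z = \<zero>\<^bsub>?F\<^esub>" if "{x. z x \<noteq> \<zero>\<^bsub>R\<^esub>} \<subseteq> {}" for z
      using that by (simp add: free_module_def fun_eq_iff)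
    then show ?case using zero[OF G] zero[OF K] by auto
  next
    case (insert x S)
    show ?case
    proof (intro ballI impI)
      fix z assume z: "z \<in> carrier ?F" and s: "{y. z y \<noteq> \<zero>\<^bsub>R\<^esub>} \<subseteq> insert x S"
      let ?w = "z(x := \<zero>\<^bsub>R\<^esub>)"
      have x: "x \<in> X" using insert by simp
      have zc: "z y \<in> carrier R" for y by (rule free_module_mem[OF z R])
      have e: "free_gen R x \<in> carrier ?F"
        by (rule lin_ext_free_gen(1)[OF B _ x, of "\<lambda>_. \<zero>\<^bsub>B\<^esub>"]) simp
      have c: "z x \<odot>\<^bsub>?F\<^esub> free_gen R x \<in> carrier ?F" by (rule F.smult_closed[OF zc e])
      have "{y. ?w y \<noteq> \<zero>\<^bsub>R\<^esub>} \<subseteq> {y. z y \<noteq> \<zero>\<^bsub>R\<^esub>}" by auto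
      moreover have "finite {y. z y \<noteq> \<zero>\<^bsub>R\<^esub>}" using z by (simp add: free_module_def)
      ultimately have fin: "finite {y. ?w y \<noteq> \<zero>\<^bsub>R\<^esub>}" by (rule finite_subset)
      then have w: "?w \<in> carrier ?F" using z by (simp add: free_module_def)
      have "{y. ?w y \<noteq> \<zero>\<^bsub>R\<^esub>} \<subseteq> S" using s by auto
      then have IH: "G ?w = K ?w" using insert w by blast
      have dec: "?w \<oplus>\<^bsub>?F\<^esub> (z x \<odot>\<^bsub>?F\<^esub> free_gen R x) = z"
        by (rule ext) (simp add: free_module_def free_gen_def zc)
      have "f z = f ?w \<oplus>\<^bsub>B\<^esub> (z x \<odot>\<^bsub>B\<^esub> f (free_gen R x))" if f: "f \<in> mod_hom R ?F B" for f
        using mod_hom_D(2)[OF f w c] unfolding dec mod_hom_D(3)[OF f zc e] .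
      from this[OF G] this[OF K] show "G z = K z" by (simp only: IH eq[OF x])
    qed
  qed
  from this[of "{x. z x \<noteq> \<zero>\<^bsub>R\<^esub>}"] z show ?thesis by (auto simp: free_module_def)
qed

lemma projective_lifting:
  fixes P :: "('r, 'p) module"
  assumes P: "projective_module R P" and A: "Module.module R A" and B: "Module.module R B"
    and g: "g \<in> mod_hom R A B" "g ` carrier A = carrier B" and f: "f \<in> mod_hom R P B"
  shows "\<exists>h\<in>mod_hom R P A. \<forall>x\<in>carrier P. g (h x) = f x"
proof -
  interpret A: Module.module R A by fact
  have R: "cring R" by (rule A.R.cring_axioms)
  from P obtain X :: "'p set" and s q where s: "s \<in> mod_hom R P (free_module R X)"
    and q: "q \<in> mod_hom R (free_module R X) P" and qs: "\<And>x. x \<in> carrier P \<Longrightarrow> q (s x) = x"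
    and PM: "Module.module R P"
    unfolding projective_module_def by (elim conjE exE bexE) simp
  let ?F = "free_module R X"
  have F: "Module.module R ?F" by (rule free_module_is_module[OF R])
  define b where "b x = (SOME a. a \<in> carrier A \<and> g a = f (q (free_gen R x)))" for x
  have ex: "b x \<in> carrier A \<and> g (b x) = f (q (free_gen R x))" if "x \<in> X" for x
  proof -
    have "free_gen R x \<in> carrier ?F"
      by (rule lin_ext_free_gen(1)[OF A _ that, of "\<lambda>_. \<zero>\<^bsub>A\<^esub>"]) simp
    then have "f (q (free_gen R x)) \<in> g ` carrier A"
      unfolding g(2) by (intro mod_hom_D(1)[OF f] mod_hom_D(1)[OF q])
    then have "\<exists>a. a \<in> carrier A \<and> g a = f (q (free_gen R x))"
      by (elim imageE) (intro exI conjI, assumption, rule sym)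
    then show ?thesis unfolding b_def by (rule someI_ex)
  qed
  then have b: "b \<in> X \<rightarrow> carrier A" by simp
  let ?h = "lin_ext R A b"
  have h: "?h \<in> mod_hom R ?F A" by (rule lin_ext_hom[OF A b])
  have "g (?h (free_gen R x)) = f (q (free_gen R x))" if "x \<in> X" for x
    using ex[OF that] lin_ext_free_gen(2)[OF A b that] by simp
  note eq = mod_hom_free_eq[OF B mod_hom_comp[OF F h g(1)] mod_hom_comp[OF F q f] this]
  have "g (?h (s x)) = f x" if "x \<in> carrier P" for x
    using eq[OF _ mod_hom_D(1)[OF s that]] unfolding qs[OF that] by simp
  then show ?thesis by (intro bexI[OF _ mod_hom_comp[OF PM s h]] ballI)
qed

lemma projective_iff_lifting:
  fixes P :: "('r, 'p) module"
  assumes P: "Module.module R P"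
  shows "projective_module R P \<longleftrightarrow>
    (\<forall>(A :: ('r, 'p \<Rightarrow> 'r) module) (B :: ('r, 'p) module) g f.
       Module.module R A \<longrightarrow> Module.module R B \<longrightarrow> g \<in> mod_hom R A B \<longrightarrow> g ` carrier A = carrier B \<longrightarrow>
       f \<in> mod_hom R P B \<longrightarrow> (\<exists>h\<in>mod_hom R P A. \<forall>x\<in>carrier P. g (h x) = f x))"
    (is "_ \<longleftrightarrow> ?L")
proof
  assume "projective_module R P"
  then show ?L by (intro allI impI) (rule projective_lifting)
next
  assume L: ?L
  interpret P: Module.module R P by fact
  let ?F = "free_module R (carrier P)"
  have F: "Module.module R ?F" by (rule free_module_is_module) (rule P.R.cring_axioms)
  have b: "(\<lambda>x. x) \<in> carrier P \<rightarrow> carrier P" by auto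
  let ?g = "lin_ext R P (\<lambda>x. x)"
  have g: "?g \<in> mod_hom R ?F P" by (rule lin_ext_hom[OF P b])
  have surj: "?g ` carrier ?F = carrier P"
  proof
    show "?g ` carrier ?F \<subseteq> carrier P" using g by (auto simp: mod_hom_def)
    show "carrier P \<subseteq> ?g ` carrier ?F"
    proof
      fix x assume "x \<in> carrier P"
      from lin_ext_free_gen[OF P b this] show "x \<in> ?g ` carrier ?F"
        by (intro image_eqI[of _ _ "free_gen R x"]) simp_all
    qed
  qed
  have id: "(\<lambda>x. x) \<in> mod_hom R P P" by (auto simp: mod_hom_def)
  from L[rule_format, OF F P g surj id]
  obtain h where "h \<in> mod_hom R P ?F" "\<forall>x\<in>carrier P. ?g (h x) = x" by blast
  with P g show "projective_module R P" unfolding projective_module_def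
    by (intro conjI exI[of _ "carrier P"]) (auto intro: bexI[of _ h] bexI[of _ ?g])
qed

end

(*
  Write L = Hom(C, M).  Fix a resolution G of C by finite free modules.  Vanishing of Ext(C, A) in
  positive degrees is exactness of Hom(G, A), and vanishing of Tor(C, A) is exactness of
  Hom(G*, A) for the dual complex G*, so that both obey the same dimension shifting.

  If all homology modules of the bounded complex X = P (x) C are powers of M, descending induction
  along 0 -> Z -> X -> B -> 0 and 0 -> B -> Z -> H -> 0 shows that cycles and boundaries of X are
  Ext-acyclic.  Hence Hom(C, -) commutes with the homology of X, and Hom(C, P (x) C) = P because C
  is semidualizing and P is projective; so H(P) consists of powers of L.  Conversely, if H(P)
  consists of powers of L, ascending induction shows that the cycles and boundaries of P are
  Tor-acyclic, so that - (x) C commutes with the homology of P, and L (x) C = M.  Both complexes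
  are nonzero, and have nonzero homology, in the same degrees, so the dimensions agree.
*)

theory Submission
  imports Defs
begin

section \<open>Linear maps, submodules and quotients\<close>

text \<open>The given Ext and Tor come from the canonical resolution, whose bases are as large as
  the modules they cover. The finite resolution is therefore carved out of it, with the same
  augmentation and differential, and a chain retraction carries vanishing from one to the other.
  Finiteness makes duality harmless: the dot product identifies each finite free module with its
  dual, so both complexes live on the same modules, and an element of A \<otimes> C is represented
  by a homomorphism from \<open>G 0\<close> to A.

  No long exact sequences are formed. Every dimension shift is a diagram chase with explicit
  homomorphisms, valid for modules of any element type, as is needed for cycles, boundaries and
  homology. Since the comparison maps are given on representatives, homology modules are compared
  through a module that maps onto both with the same kernel: cycles of P in one direction,
  homomorphisms from \<open>G 0\<close> into these cycles in the other.

  The projective modules may have infinite rank. There finite generation of C is decisive, because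
  it confines a homomorphism from C to P \<otimes> C to finitely many coordinates.\<close>

lemma module_cring: "Module.module R A \<Longrightarrow> cring R"
  by (simp add: Module.module_def)

lemma module_diff_eq_zero_iff:
  assumes "Module.module R A" "x \<in> carrier A" "y \<in> carrier A"
  shows "x \<ominus>\<^bsub>A\<^esub> y = \<zero>\<^bsub>A\<^esub> \<longleftrightarrow> x = y"
proof -
  interpret A: Module.module R A by fact
  show ?thesis using assms(2,3) A.M.minus_equality[of x "\<ominus>\<^bsub>A\<^esub> y"]
    by (auto simp: A.M.minus_eq A.M.r_neg)
qed

lemma mod_homI:
  assumes "\<And>x. x \<in> carrier A \<Longrightarrow> f x \<in> carrier B"
    and "\<And>x y. x \<in> carrier A \<Longrightarrow> y \<in> carrier A \<Longrightarrow> f (x \<oplus>\<^bsub>A\<^esub> y) = f x \<oplus>\<^bsub>B\<^esub> f y"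
    and "\<And>r x. r \<in> carrier R \<Longrightarrow> x \<in> carrier A \<Longrightarrow> f (r \<odot>\<^bsub>A\<^esub> x) = r \<odot>\<^bsub>B\<^esub> f x"
  shows "f \<in> mod_hom R A B"
  using assms by (auto simp: mod_hom_def)

lemma mod_hom_cong:
  assumes "Module.module R A" "f \<in> mod_hom R A B" "\<And>x. x \<in> carrier A \<Longrightarrow> g x = f x"
  shows "g \<in> mod_hom R A B"
proof -
  interpret A: Module.module R A by fact
  show ?thesis using mod_hom_D[OF assms(2)] by (intro mod_homI) (simp_all add: assms(3))
qed

lemma mod_hom_0:
  assumes "Module.module R A" "Module.module R B" "f \<in> mod_hom R A B"
  shows "f \<zero>\<^bsub>A\<^esub> = \<zero>\<^bsub>B\<^esub>"
proof -
  interpret A: Module.module R A by fact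
  interpret B: Module.module R B by fact
  have "f (\<zero>\<^bsub>R\<^esub> \<odot>\<^bsub>A\<^esub> \<zero>\<^bsub>A\<^esub>) = \<zero>\<^bsub>R\<^esub> \<odot>\<^bsub>B\<^esub> f \<zero>\<^bsub>A\<^esub>"
    by (rule mod_hom_D(3)[OF assms(3)]) auto
  then show ?thesis using mod_hom_D(1)[OF assms(3), of "\<zero>\<^bsub>A\<^esub>"] by simp
qed

lemma mod_hom_uminus:
  assumes "Module.module R A" "Module.module R B" "f \<in> mod_hom R A B" "x \<in> carrier A"
  shows "f (\<ominus>\<^bsub>A\<^esub> x) = \<ominus>\<^bsub>B\<^esub> f x"
proof -
  interpret A: Module.module R A by fact
  interpret B: Module.module R B by fact
  have "f (\<ominus>\<^bsub>A\<^esub> x) \<oplus>\<^bsub>B\<^esub> f x = \<zero>\<^bsub>B\<^esub>"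
    using mod_hom_D(2)[OF assms(3), of "\<ominus>\<^bsub>A\<^esub> x" x] assms mod_hom_0[OF assms(1-3)] by (simp add: A.M.l_neg)
  then show ?thesis using mod_hom_D(1)[OF assms(3)] assms(4)
    by (intro B.M.minus_equality[symmetric]) auto
qed

lemma mod_hom_diff:
  assumes "Module.module R A" "Module.module R B" "f \<in> mod_hom R A B" "x \<in> carrier A" "y \<in> carrier A"
  shows "f (x \<ominus>\<^bsub>A\<^esub> y) = f x \<ominus>\<^bsub>B\<^esub> f y"
proof -
  interpret A: Module.module R A by fact
  show ?thesis using assms mod_hom_D(2)[OF assms(3), of x "\<ominus>\<^bsub>A\<^esub> y"] mod_hom_uminus[OF assms(1-3,5)]
    by (simp add: a_minus_def)
qed

lemma mod_hom_sum:
  assumes "Module.module R A" "Module.module R B" "f \<in> mod_hom R A B" "finite S" "g \<in> S \<rightarrow> carrier A"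
  shows "f (\<Oplus>\<^bsub>A\<^esub>x\<in>S. g x) = (\<Oplus>\<^bsub>B\<^esub>x\<in>S. f (g x))"
proof -
  interpret A: Module.module R A by fact
  interpret B: Module.module R B by fact
  show ?thesis using assms(4,5)
  proof (induction S rule: finite_induct)
    case empty
    then show ?case using mod_hom_0[OF assms(1-3)] by simp
  next
    case (insert x S)
    then have "g x \<in> carrier A" "g \<in> S \<rightarrow> carrier A" by auto
    moreover have "(\<lambda>x. f (g x)) \<in> S \<rightarrow> carrier B" "f (g x) \<in> carrier B"
      using calculation mod_hom_D(1)[OF assms(3)] by auto
    ultimately show ?case using insert mod_hom_D(2)[OF assms(3), of "g x" "\<Oplus>\<^bsub>A\<^esub>x\<in>S. g x"] by simp
  qed
qed

lemma mod_hom_zero_map: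
  assumes "Module.module R A" "Module.module R B"
  shows "(\<lambda>x. \<zero>\<^bsub>B\<^esub>) \<in> mod_hom R A B"
proof -
  interpret B: Module.module R B by fact
  show ?thesis by (intro mod_homI) auto
qed

lemma mod_hom_add:
  assumes "Module.module R A" "Module.module R B" "f \<in> mod_hom R A B" "g \<in> mod_hom R A B"
  shows "(\<lambda>x. f x \<oplus>\<^bsub>B\<^esub> g x) \<in> mod_hom R A B"
proof -
  interpret B: Module.module R B by fact
  note f = mod_hom_D[OF assms(3)] and g = mod_hom_D[OF assms(4)]
  show ?thesis
    by (intro mod_homI) (simp_all add: f g B.M.a_ac B.smult_r_distr)
qed

lemma mod_hom_smult:
  assumes "Module.module R A" "Module.module R B" "f \<in> mod_hom R A B" "r \<in> carrier R"
  shows "(\<lambda>x. r \<odot>\<^bsub>B\<^esub> f x) \<in> mod_hom R A B"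
proof -
  interpret B: Module.module R B by fact
  note f = mod_hom_D[OF assms(3)]
  show ?thesis
    by (intro mod_homI)
      (simp_all add: f B.smult_r_distr assms(4) B.smult_assoc1[symmetric] B.R.m_comm)
qed

lemma mod_hom_minus:
  assumes "Module.module R A" "Module.module R B" "f \<in> mod_hom R A B" "g \<in> mod_hom R A B"
  shows "(\<lambda>x. f x \<ominus>\<^bsub>B\<^esub> g x) \<in> mod_hom R A B"
proof -
  interpret B: Module.module R B by fact
  note f = mod_hom_D[OF assms(3)] and g = mod_hom_D[OF assms(4)]
  show ?thesis
    by (intro mod_homI) (simp_all add: f g a_minus_def B.M.a_ac B.smult_r_distr B.M.minus_add B.smult_r_minus)
qed

lemma mod_hom_finsum:
  assumes "Module.module R A" "Module.module R B" "finite S" "\<And>s. s \<in> S \<Longrightarrow> f s \<in> mod_hom R A B"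
  shows "(\<lambda>x. \<Oplus>\<^bsub>B\<^esub>s\<in>S. f s x) \<in> mod_hom R A B"
  using assms(3,4)
proof (induction S rule: finite_induct)
  case empty
  interpret B: Module.module R B by fact
  show ?case using mod_hom_zero_map[OF assms(1,2)] by simp
next
  case (insert s S)
  interpret B: Module.module R B by fact
  have c: "f t x \<in> carrier B" if "t \<in> insert s S" "x \<in> carrier A" for t x
    using mod_hom_D(1)[OF insert.prems[OF that(1)] that(2)] .
  have "(\<lambda>x. f s x \<oplus>\<^bsub>B\<^esub> (\<Oplus>\<^bsub>B\<^esub>s\<in>S. f s x)) \<in> mod_hom R A B"
    by (intro mod_hom_add[OF assms(1,2)] insert) auto
  then show ?case using insert.hyps c
    by (rule_tac mod_hom_cong[OF assms(1)]) (auto intro!: B.M.finsum_insert)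
qed

lemma mod_hom_id: "(\<lambda>x. x) \<in> mod_hom R A A"
  by (auto simp: mod_hom_def)

lemma mod_hom_codomain_sub:
  assumes "f \<in> mod_hom R E B" "\<And>x. x \<in> carrier E \<Longrightarrow> f x \<in> K"
  shows "f \<in> mod_hom R E (B\<lparr>carrier := K\<rparr>)"
  using assms by (auto simp: mod_hom_def)

lemma mod_hom_sub_D:
  assumes "f \<in> mod_hom R E (B\<lparr>carrier := K\<rparr>)" "K \<subseteq> carrier B"
  shows "f \<in> mod_hom R E B" "\<And>x. x \<in> carrier E \<Longrightarrow> f x \<in> K"
  using assms by (auto simp: mod_hom_def)

lemma mod_hom_domain_sub:
  assumes "f \<in> mod_hom R A B" "K \<subseteq> carrier A"
  shows "f \<in> mod_hom R (A\<lparr>carrier := K\<rparr>) B"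
  using assms(2) by (intro mod_homI) (auto simp: mod_hom_D[OF assms(1)] subset_iff)

section \<open>Submodules, kernels, images and spans\<close>

lemma submodule_module:
  assumes "Module.module R A" "submodule K R A"
  shows "Module.module R (A\<lparr>carrier := K\<rparr>)"
  using submodule.submodule_is_module[OF assms(2,1)] .

lemma submodule_ker:
  assumes "Module.module R A" "Module.module R B" "f \<in> mod_hom R A B"
  shows "submodule {x \<in> carrier A. f x = \<zero>\<^bsub>B\<^esub>} R A"
proof -
  interpret A: Module.module R A by fact
  interpret B: Module.module R B by fact
  show ?thesis
    by (rule A.submoduleI)
      (auto simp: mod_hom_0[OF assms] mod_hom_uminus[OF assms] mod_hom_D[OF assms(3)])
qed

lemma submodule_im:
  assumes "Module.module R A" "Module.module R B" "f \<in> mod_hom R A B"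
  shows "submodule (f ` carrier A) R B"
proof -
  interpret A: Module.module R A by fact
  interpret B: Module.module R B by fact
  note f = mod_hom_D[OF assms(3)]
  show ?thesis
  proof (rule B.submoduleI)
    show "\<zero>\<^bsub>B\<^esub> \<in> f ` carrier A" using mod_hom_0[OF assms] A.M.zero_closed by (metis imageI)
    show "\<ominus>\<^bsub>B\<^esub> a \<in> f ` carrier A" if "a \<in> f ` carrier A" for a
      using that mod_hom_uminus[OF assms, symmetric] by (auto intro!: imageI)
    show "a \<oplus>\<^bsub>B\<^esub> b \<in> f ` carrier A" if "a \<in> f ` carrier A" "b \<in> f ` carrier A" for a b
      using that by (auto simp: f(2)[symmetric])
    show "r \<odot>\<^bsub>B\<^esub> b \<in> f ` carrier A" if "r \<in> carrier R" "b \<in> f ` carrier A" for r b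
      using that by (auto simp: f(3)[symmetric])
  qed (auto simp: f)
qed

lemma submodule_subset:
  assumes "submodule H R A"
  shows "H \<subseteq> carrier A"
  using subgroup.subset[OF submodule.axioms(1)[OF assms]] by simp

lemma submodule_zero:
  assumes "submodule H R A"
  shows "\<zero>\<^bsub>A\<^esub> \<in> H"
  using subgroup.one_closed[OF submodule.axioms(1)[OF assms]] by simp

lemma submodule_sub:
  assumes "Module.module R A" "submodule K R A" "submodule H R A" "H \<subseteq> K"
  shows "submodule H R (A\<lparr>carrier := K\<rparr>)"
proof -
  interpret K: Module.module R "A\<lparr>carrier := K\<rparr>" by (rule submodule_module[OF assms(1,2)])
  have "Module.module R (A\<lparr>carrier := K\<rparr>\<lparr>carrier := H\<rparr>)" using submodule_module[OF assms(1,3)] by simp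
  then show ?thesis using assms(4) by (intro K.module_incl_imp_submodule) auto
qed

lemma mod_span_superset: "S \<subseteq> mod_span R A S"
  by (auto simp: mod_span_def)

lemma mod_span_minimal: "submodule H R A \<Longrightarrow> S \<subseteq> H \<Longrightarrow> mod_span R A S \<subseteq> H"
  by (auto simp: mod_span_def)

lemma mod_span_submodule:
  assumes "Module.module R A" "S \<subseteq> carrier A"
  shows "submodule (mod_span R A S) R A"
proof -
  interpret A: Module.module R A by fact
  have c: "submodule (carrier A) R A" by (rule A.carrier_is_submodule)
  note E = A.submoduleE
  show ?thesis
  proof (rule A.submoduleI)
    show "mod_span R A S \<subseteq> carrier A" using mod_span_minimal[OF c assms(2)] .
  qed (auto simp: mod_span_def submodule_zero E)
qed

text \<open>The kernel of the difference of \<open>f\<close> and \<open>g\<close> is a submodule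
  that contains \<open>S\<close>.\<close>

lemma mod_hom_eq_on_span:
  assumes "Module.module R A" "Module.module R B" "f \<in> mod_hom R A B" "g \<in> mod_hom R A B"
    and "S \<subseteq> carrier A" "\<And>x. x \<in> S \<Longrightarrow> f x = g x" "x \<in> mod_span R A S"
  shows "f x = g x"
proof -
  interpret A: Module.module R A by fact
  interpret B: Module.module R B by fact
  let ?H = "{x \<in> carrier A. f x \<ominus>\<^bsub>B\<^esub> g x = \<zero>\<^bsub>B\<^esub>}"
  have H: "submodule ?H R A"
    by (rule submodule_ker[OF assms(1,2) mod_hom_minus[OF assms(1-4)]])
  have "S \<subseteq> ?H" using assms(5,6) mod_hom_D(1)[OF assms(4)] by (auto simp: B.M.minus_eq B.M.r_neg)
  from mod_span_minimal[OF H this] assms(7)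
  have "x \<in> carrier A" "f x \<ominus>\<^bsub>B\<^esub> g x = \<zero>\<^bsub>B\<^esub>" by auto
  then show ?thesis using mod_hom_D(1)[OF assms(3)] mod_hom_D(1)[OF assms(4)]
    by (simp add: module_diff_eq_zero_iff[OF assms(2)])
qed

lemma mod_isomorphism_zero_iff:
  assumes A: "Module.module R A" and B: "Module.module R B" and f: "f \<in> mod_hom R A B"
    and inj: "inj_on f (carrier A)" and x: "x \<in> carrier A"
  shows "f x = \<zero>\<^bsub>B\<^esub> \<longleftrightarrow> x = \<zero>\<^bsub>A\<^esub>"
proof -
  interpret A: Module.module R A by fact
  show ?thesis using inj_on_eq_iff[OF inj x A.M.zero_closed] mod_hom_0[OF A B f] by simp
qed

lemma module_eq_add_self:
  assumes "Module.module R A" "x \<in> carrier A" "y \<in> carrier A" "y = x \<oplus>\<^bsub>A\<^esub> y"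
  shows "x = \<zero>\<^bsub>A\<^esub>"
proof -
  interpret A: Module.module R A by fact
  have "x \<oplus>\<^bsub>A\<^esub> y = \<zero>\<^bsub>A\<^esub> \<oplus>\<^bsub>A\<^esub> y" using assms(3,4) by simp
  then show ?thesis using assms(2,3) by (simp only: A.M.add.right_cancel A.M.zero_closed)
qed

section \<open>Isomorphisms and zero modules\<close>

lemma mod_isomorphicI:
  "f \<in> mod_hom R A B \<Longrightarrow> bij_betw f (carrier A) (carrier B) \<Longrightarrow> mod_isomorphic R A B"
  by (auto simp: mod_isomorphic_def mod_iso_def)

lemma mod_isomorphicE:
  assumes "mod_isomorphic R A B"
  obtains f where "f \<in> mod_hom R A B" "bij_betw f (carrier A) (carrier B)"
  using assms by (auto simp: mod_isomorphic_def mod_iso_def)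

lemma mod_hom_inv_into:
  assumes "Module.module R A" "Module.module R B" "f \<in> mod_hom R A B" "bij_betw f (carrier A) (carrier B)"
  shows "inv_into (carrier A) f \<in> mod_hom R B A"
proof -
  interpret A: Module.module R A by fact
  interpret B: Module.module R B by fact
  let ?g = "inv_into (carrier A) f"
  note f = mod_hom_D[OF assms(3)]
  have gc: "?g y \<in> carrier A" and fg: "f (?g y) = y" if "y \<in> carrier B" for y
    using that assms(4) bij_betw_inv_into_right[OF assms(4)] bij_betw_apply[OF bij_betw_inv_into[OF assms(4)]] by auto
  have gf: "?g (f x) = x" if "x \<in> carrier A" for x
    using that bij_betw_inv_into_left[OF assms(4)] by auto
  show ?thesis
  proof (rule mod_homI)
    show "?g (x \<oplus>\<^bsub>B\<^esub> y) = ?g x \<oplus>\<^bsub>A\<^esub> ?g y" if "x \<in> carrier B" "y \<in> carrier B" for x y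
      using gf[of "?g x \<oplus>\<^bsub>A\<^esub> ?g y"] that gc by (simp add: f fg)
    show "?g (r \<odot>\<^bsub>B\<^esub> y) = r \<odot>\<^bsub>A\<^esub> ?g y" if "r \<in> carrier R" "y \<in> carrier B" for r y
      using gf[of "r \<odot>\<^bsub>A\<^esub> ?g y"] that gc by (simp add: f fg)
  qed (use gc in auto)
qed

text \<open>Both targets are quotients of \<open>W\<close> by the same kernel, so sending
  \<open>f w\<close> to \<open>g w\<close> is well defined and bijective. The homology comparisons
  take this form because their maps are given by formulas on representatives.\<close>

lemma mod_isomorphic_common_cover:
  assumes W: "Module.module R W" and A: "Module.module R A" and B: "Module.module R B"
    and f: "f \<in> mod_hom R W A" "f ` carrier W = carrier A"
    and g: "g \<in> mod_hom R W B" "g ` carrier W = carrier B"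
    and ker: "\<And>w. w \<in> carrier W \<Longrightarrow> f w = \<zero>\<^bsub>A\<^esub> \<longleftrightarrow> g w = \<zero>\<^bsub>B\<^esub>"
  shows "mod_isomorphic R A B"
proof -
  interpret W: Module.module R W by fact
  interpret A: Module.module R A by fact
  interpret B: Module.module R B by fact
  note fh = mod_hom_D[OF f(1)] and gh = mod_hom_D[OF g(1)]
  have eq: "f v = f w \<longleftrightarrow> g v = g w" if "v \<in> carrier W" "w \<in> carrier W" for v w
    using ker[of "v \<ominus>\<^bsub>W\<^esub> w"] that fh(1) gh(1)
    by (simp add: mod_hom_diff[OF W A f(1)] mod_hom_diff[OF W B g(1)]
      module_diff_eq_zero_iff[OF A] module_diff_eq_zero_iff[OF B])
  define h where "h a = g (inv_into (carrier W) f a)" for a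
  have inv: "inv_into (carrier W) f a \<in> carrier W" "f (inv_into (carrier W) f a) = a" if "a \<in> carrier A" for a
    using that f(2) by (auto intro: inv_into_into f_inv_into_f)
  have hf: "h (f w) = g w" if "w \<in> carrier W" for w
    unfolding h_def using eq[of "inv_into (carrier W) f (f w)" w] inv[OF fh(1)[OF that]] that by simp
  have "h \<in> mod_hom R A B"
  proof (rule mod_homI)
    fix a assume "a \<in> carrier A"
    then show "h a \<in> carrier B" using inv gh(1) by (simp add: h_def)
  next
    fix a b assume "a \<in> carrier A" "b \<in> carrier A"
    then obtain v w where "a = f v" "b = f w" "v \<in> carrier W" "w \<in> carrier W" using f(2) by blast
    then show "h (a \<oplus>\<^bsub>A\<^esub> b) = h a \<oplus>\<^bsub>B\<^esub> h b" by (simp add: hf gh fh(2)[symmetric])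
  next
    fix r a assume "a \<in> carrier A" "r \<in> carrier R"
    then obtain v where "a = f v" "v \<in> carrier W" using f(2) by blast
    then show "h (r \<odot>\<^bsub>A\<^esub> a) = r \<odot>\<^bsub>B\<^esub> h a" using \<open>r \<in> _\<close> by (simp add: hf gh fh(3)[symmetric])
  qed
  moreover have "bij_betw h (carrier A) (carrier B)"
  proof (rule bij_betw_imageI)
    show "inj_on h (carrier A)"
    proof (rule inj_onI)
      fix a b assume "a \<in> carrier A" "b \<in> carrier A" "h a = h b"
      moreover obtain v w where "a = f v" "b = f w" "v \<in> carrier W" "w \<in> carrier W"
        using f(2) calculation by blast
      ultimately show "a = b" using eq by (simp add: hf)
    qed
    have "h ` carrier A = (\<lambda>w. h (f w)) ` carrier W" unfolding f(2)[symmetric] by (rule image_image)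
    then show "h ` carrier A = carrier B" using g(2) hf by auto
  qed
  ultimately show ?thesis by (rule mod_isomorphicI)
qed

lemma mod_isomorphic_zero_module:
  assumes "Module.module R A" "Module.module R B" "mod_isomorphic R A B"
  shows "zero_module A \<longleftrightarrow> zero_module B"
proof -
  obtain f where f: "f \<in> mod_hom R A B" "bij_betw f (carrier A) (carrier B)"
    using assms(3) by (rule mod_isomorphicE)
  interpret A: Module.module R A by fact
  interpret B: Module.module R B by fact
  note im = bij_betw_imp_surj_on[OF f(2)]
  show ?thesis unfolding zero_module_def
  proof
    assume "carrier A = {\<zero>\<^bsub>A\<^esub>}"
    then show "carrier B = {\<zero>\<^bsub>B\<^esub>}" using im mod_hom_0[OF assms(1,2) f(1)] by auto
  next
    assume B: "carrier B = {\<zero>\<^bsub>B\<^esub>}"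
    have "x = \<zero>\<^bsub>A\<^esub>" if "x \<in> carrier A" for x
      using bij_betw_imp_inj_on[OF f(2)] that mod_hom_D(1)[OF f(1)] B A.M.zero_closed
      by (metis inj_onD singletonD)
    then show "carrier A = {\<zero>\<^bsub>A\<^esub>}" by auto
  qed
qed

lemma zero_module_iff:
  assumes "Module.module R A"
  shows "zero_module A \<longleftrightarrow> (\<forall>x\<in>carrier A. x = \<zero>\<^bsub>A\<^esub>)"
proof -
  interpret A: Module.module R A by fact
  show ?thesis by (auto simp: zero_module_def)
qed

lemma zero_module_mod_isomorphic:
  assumes "Module.module R A" "Module.module R B" "zero_module A" "zero_module B"
  shows "mod_isomorphic R A B"
  using assms(3,4) mod_hom_zero_map[OF assms(1,2)]
  by (intro mod_isomorphicI[of "\<lambda>x. \<zero>\<^bsub>B\<^esub>"]) (auto simp: zero_module_def bij_betw_def)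

section \<open>Quotient modules\<close>

lemma
  assumes A: "Module.module R A" and N: "submodule N R A"
  shows quot_module_module: "Module.module R (quot_module A N)"
    and quot_proj_hom: "(\<lambda>x. N +>\<^bsub>A\<^esub> x) \<in> mod_hom R A (quot_module A N)"
    and quot_proj_surj: "(\<lambda>x. N +>\<^bsub>A\<^esub> x) ` carrier A = carrier (quot_module A N)"
    and quot_proj_mem_iff: "\<And>x y. x \<in> carrier A \<Longrightarrow> y \<in> N +>\<^bsub>A\<^esub> x \<longleftrightarrow> y \<in> carrier A \<and> y \<ominus>\<^bsub>A\<^esub> x \<in> N"
    and quot_proj_zero_iff: "\<And>x. x \<in> carrier A \<Longrightarrow> N +>\<^bsub>A\<^esub> x = \<zero>\<^bsub>quot_module A N\<^esub> \<longleftrightarrow> x \<in> N"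
proof -
  interpret A: Module.module R A by fact
  interpret N: submodule N R A by fact
  interpret N: abelian_subgroup N A
    by (rule abelian_subgroupI3) (auto intro: additive_subgroupI N.subgroup_axioms A.M.abelian_group_axioms)
  let ?Q = "quot_module A N"
  have carr: "carrier ?Q = (\<lambda>x. N +>\<^bsub>A\<^esub> x) ` carrier A"
    by (auto simp: quot_module_def A_RCOSETS_def')
  have mem: "y \<in> N +>\<^bsub>A\<^esub> x \<longleftrightarrow> y \<in> carrier A \<and> y \<ominus>\<^bsub>A\<^esub> x \<in> N" if "x \<in> carrier A" for x y
    using N.a_rcos_module[OF that] N.a_elemrcos_carrier[OF that] by (auto simp: A.M.minus_eq)
  then show "\<And>x y. x \<in> carrier A \<Longrightarrow> y \<in> N +>\<^bsub>A\<^esub> x \<longleftrightarrow> y \<in> carrier A \<and> y \<ominus>\<^bsub>A\<^esub> x \<in> N" .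
  have add: "(N +>\<^bsub>A\<^esub> x) \<oplus>\<^bsub>?Q\<^esub> (N +>\<^bsub>A\<^esub> y) = N +>\<^bsub>A\<^esub> (x \<oplus>\<^bsub>A\<^esub> y)"
    if "x \<in> carrier A" "y \<in> carrier A" for x y
    using N.a_rcos_sum[OF that] by (simp add: quot_module_def)
  have eq: "N +>\<^bsub>A\<^esub> x = N +>\<^bsub>A\<^esub> y" if "x \<in> N +>\<^bsub>A\<^esub> y" "y \<in> carrier A" for x y
    using N.a_repr_independence'[OF that] by simp
  have self: "x \<in> N +>\<^bsub>A\<^esub> x" if "x \<in> carrier A" for x
    using that by (rule N.a_rcos_self)
  \<comment> \<open>Scalar multiplication is defined as a union of cosets over all representatives.
    These cosets coincide, so the union is a single one.\<close>
  have sm: "r \<odot>\<^bsub>?Q\<^esub> (N +>\<^bsub>A\<^esub> x) = N +>\<^bsub>A\<^esub> (r \<odot>\<^bsub>A\<^esub> x)"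
    if r: "r \<in> carrier R" and x: "x \<in> carrier A" for r x
  proof -
    have "N +>\<^bsub>A\<^esub> (r \<odot>\<^bsub>A\<^esub> y) = N +>\<^bsub>A\<^esub> (r \<odot>\<^bsub>A\<^esub> x)" if "y \<in> N +>\<^bsub>A\<^esub> x" for y
    proof (rule eq)
      have y: "y \<in> carrier A" "y \<ominus>\<^bsub>A\<^esub> x \<in> N" using that mem[OF x] by auto
      have "r \<odot>\<^bsub>A\<^esub> y \<ominus>\<^bsub>A\<^esub> r \<odot>\<^bsub>A\<^esub> x = r \<odot>\<^bsub>A\<^esub> (y \<ominus>\<^bsub>A\<^esub> x)"
        using r x y by (simp add: a_minus_def A.smult_r_distr A.smult_r_minus)
      then show "r \<odot>\<^bsub>A\<^esub> y \<in> N +>\<^bsub>A\<^esub> (r \<odot>\<^bsub>A\<^esub> x)" using r x y by (simp add: mem)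
    qed (use r x in simp)
    then have "(\<Union>y\<in>N +>\<^bsub>A\<^esub> x. N +>\<^bsub>A\<^esub> (r \<odot>\<^bsub>A\<^esub> y)) = N +>\<^bsub>A\<^esub> (r \<odot>\<^bsub>A\<^esub> x)"
      using self[OF x] by blast
    then show ?thesis by (simp add: quot_module_def)
  qed
  have zero: "\<zero>\<^bsub>?Q\<^esub> = N +>\<^bsub>A\<^esub> \<zero>\<^bsub>A\<^esub>"
    using N.a_subset by (simp add: quot_module_def)
  show M: "Module.module R ?Q"
  proof (rule Module.moduleI)
    show "abelian_group ?Q"
    proof (rule abelian_groupI)
      fix x y z assume "x \<in> carrier ?Q" "y \<in> carrier ?Q" "z \<in> carrier ?Q"
      then obtain a b c where "x = N +>\<^bsub>A\<^esub> a" "y = N +>\<^bsub>A\<^esub> b" "z = N +>\<^bsub>A\<^esub> c"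
        "a \<in> carrier A" "b \<in> carrier A" "c \<in> carrier A"
        unfolding carr by blast
      then show "x \<oplus>\<^bsub>?Q\<^esub> y \<oplus>\<^bsub>?Q\<^esub> z = x \<oplus>\<^bsub>?Q\<^esub> (y \<oplus>\<^bsub>?Q\<^esub> z)"
        by (simp add: add A.M.a_assoc)
    next
      fix x y assume "x \<in> carrier ?Q" "y \<in> carrier ?Q"
      then obtain a b where ab: "x = N +>\<^bsub>A\<^esub> a" "y = N +>\<^bsub>A\<^esub> b" "a \<in> carrier A" "b \<in> carrier A"
        unfolding carr by blast
      then show "x \<oplus>\<^bsub>?Q\<^esub> y = y \<oplus>\<^bsub>?Q\<^esub> x" by (simp add: add A.M.a_comm)
      show "x \<oplus>\<^bsub>?Q\<^esub> y \<in> carrier ?Q" using ab by (simp add: add carr)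
    next
      show "\<zero>\<^bsub>?Q\<^esub> \<in> carrier ?Q" by (simp add: zero carr)
    next
      fix x assume "x \<in> carrier ?Q"
      then obtain a where a: "a \<in> carrier A" "x = N +>\<^bsub>A\<^esub> a" unfolding carr by blast
      then show "\<zero>\<^bsub>?Q\<^esub> \<oplus>\<^bsub>?Q\<^esub> x = x" by (simp add: zero add)
      have "(N +>\<^bsub>A\<^esub> (\<ominus>\<^bsub>A\<^esub> a)) \<oplus>\<^bsub>?Q\<^esub> x = \<zero>\<^bsub>?Q\<^esub>" using a by (simp add: add zero A.M.l_neg)
      then show "\<exists>y\<in>carrier ?Q. y \<oplus>\<^bsub>?Q\<^esub> x = \<zero>\<^bsub>?Q\<^esub>" using a unfolding carr by blast
    qed
  next
    show "cring R" by (rule A.R.cring_axioms)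
  next
    fix r x assume r: "r \<in> carrier R" and "x \<in> carrier ?Q"
    then obtain a where a: "a \<in> carrier A" "x = N +>\<^bsub>A\<^esub> a" unfolding carr by blast
    then show "r \<odot>\<^bsub>?Q\<^esub> x \<in> carrier ?Q" using r by (simp add: sm carr)
    fix y assume "y \<in> carrier ?Q"
    then obtain b where "b \<in> carrier A" "y = N +>\<^bsub>A\<^esub> b" unfolding carr by blast
    then show "r \<odot>\<^bsub>?Q\<^esub> (x \<oplus>\<^bsub>?Q\<^esub> y) = r \<odot>\<^bsub>?Q\<^esub> x \<oplus>\<^bsub>?Q\<^esub> r \<odot>\<^bsub>?Q\<^esub> y"
      using a r by (simp add: add sm A.smult_r_distr)
  next
    fix r s x assume rs: "r \<in> carrier R" "s \<in> carrier R" and "x \<in> carrier ?Q"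
    then obtain a where a: "a \<in> carrier A" "x = N +>\<^bsub>A\<^esub> a" unfolding carr by blast
    show "(r \<oplus>\<^bsub>R\<^esub> s) \<odot>\<^bsub>?Q\<^esub> x = r \<odot>\<^bsub>?Q\<^esub> x \<oplus>\<^bsub>?Q\<^esub> s \<odot>\<^bsub>?Q\<^esub> x"
      using a rs by (simp add: add sm A.smult_l_distr)
    show "(r \<otimes>\<^bsub>R\<^esub> s) \<odot>\<^bsub>?Q\<^esub> x = r \<odot>\<^bsub>?Q\<^esub> (s \<odot>\<^bsub>?Q\<^esub> x)"
      using a rs by (simp add: sm A.smult_assoc1)
  next
    fix x assume "x \<in> carrier ?Q"
    then obtain a where "a \<in> carrier A" "x = N +>\<^bsub>A\<^esub> a" unfolding carr by blast
    then show "\<one>\<^bsub>R\<^esub> \<odot>\<^bsub>?Q\<^esub> x = x" by (simp add: sm)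
  qed
  show "(\<lambda>x. N +>\<^bsub>A\<^esub> x) \<in> mod_hom R A ?Q"
    by (rule mod_homI) (auto simp: carr add sm)
  show "(\<lambda>x. N +>\<^bsub>A\<^esub> x) ` carrier A = carrier ?Q" by (simp add: carr)
  fix x assume x: "x \<in> carrier A"
  show "N +>\<^bsub>A\<^esub> x = \<zero>\<^bsub>?Q\<^esub> \<longleftrightarrow> x \<in> N"
    using self[OF x] A.M.a_coset_join2[OF x N.subgroup_axioms] by (auto simp: quot_module_def)
qed

section \<open>Modules of homomorphisms, powers and tensor products\<close>

lemma hom_module_simps:
  "carrier (hom_module R A B) = mod_hom R A B \<inter> extensional (carrier A)"
  "\<zero>\<^bsub>hom_module R A B\<^esub> = (\<lambda>x\<in>carrier A. \<zero>\<^bsub>B\<^esub>)"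
  "f \<oplus>\<^bsub>hom_module R A B\<^esub> g = (\<lambda>x\<in>carrier A. f x \<oplus>\<^bsub>B\<^esub> g x)"
  "r \<odot>\<^bsub>hom_module R A B\<^esub> f = (\<lambda>x\<in>carrier A. r \<odot>\<^bsub>B\<^esub> f x)"
  by (simp_all add: hom_module_def)

lemma restrict_mod_hom:
  assumes "Module.module R A" "f \<in> mod_hom R A B"
  shows "restrict f (carrier A) \<in> carrier (hom_module R A B)"
  using mod_hom_cong[OF assms, of "restrict f (carrier A)"] by (simp add: hom_module_simps)

lemma hom_module_mod_hom: "f \<in> carrier (hom_module R A B) \<Longrightarrow> f \<in> mod_hom R A B"
  by (simp add: hom_module_simps)

lemma hom_module_eqI:
  assumes "f \<in> carrier (hom_module R A B)" "g \<in> carrier (hom_module R A B)"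
    "\<And>x. x \<in> carrier A \<Longrightarrow> f x = g x"
  shows "f = g"
  using assms by (intro extensionalityI[of f "carrier A"]) (auto simp: hom_module_simps)

text \<open>Covers Hom modules and finite powers at once, since both have pointwise operations.
  Extensionality enters only through \<open>eqI\<close>, and additive inverses arise as multiples by
  -1.\<close>

lemma function_module:
  fixes A :: "('r, 'a) module" and N :: "('r, 'i \<Rightarrow> 'a) module"
  assumes A: "Module.module R A"
    and c: "\<And>f i. f \<in> carrier N \<Longrightarrow> i \<in> I \<Longrightarrow> f i \<in> carrier A"
    and eqI: "\<And>f g. f \<in> carrier N \<Longrightarrow> g \<in> carrier N \<Longrightarrow> (\<And>i. i \<in> I \<Longrightarrow> f i = g i) \<Longrightarrow> f = g"
    and zero: "\<zero>\<^bsub>N\<^esub> \<in> carrier N"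
    and add: "\<And>f g. f \<in> carrier N \<Longrightarrow> g \<in> carrier N \<Longrightarrow> f \<oplus>\<^bsub>N\<^esub> g \<in> carrier N"
    and sm: "\<And>r f. r \<in> carrier R \<Longrightarrow> f \<in> carrier N \<Longrightarrow> r \<odot>\<^bsub>N\<^esub> f \<in> carrier N"
    and simps: "\<And>i. i \<in> I \<Longrightarrow> \<zero>\<^bsub>N\<^esub> i = \<zero>\<^bsub>A\<^esub>"
      "\<And>f g i. i \<in> I \<Longrightarrow> (f \<oplus>\<^bsub>N\<^esub> g) i = f i \<oplus>\<^bsub>A\<^esub> g i"
      "\<And>r f i. i \<in> I \<Longrightarrow> (r \<odot>\<^bsub>N\<^esub> f) i = r \<odot>\<^bsub>A\<^esub> f i"
  shows "Module.module R N"
proof -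
  interpret A: Module.module R A by fact
  show ?thesis
  proof (rule Module.moduleI)
    show "cring R" by (rule A.R.cring_axioms)
    show "abelian_group N"
    proof (rule abelian_groupI)
      fix f assume f: "f \<in> carrier N"
      let ?g = "(\<ominus>\<^bsub>R\<^esub> \<one>\<^bsub>R\<^esub>) \<odot>\<^bsub>N\<^esub> f"
      have g: "?g \<in> carrier N" using f by (intro sm) auto
      have "?g \<oplus>\<^bsub>N\<^esub> f = \<zero>\<^bsub>N\<^esub>"
        by (rule eqI[OF add[OF g f] zero]) (simp add: simps c f A.smult_l_minus A.M.l_neg)
      then show "\<exists>g\<in>carrier N. g \<oplus>\<^bsub>N\<^esub> f = \<zero>\<^bsub>N\<^esub>" using g by blast
    qed (auto intro!: eqI add zero simp: simps c A.M.a_ac)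
  qed (auto intro!: eqI add sm simp: simps c A.smult_l_distr A.smult_r_distr A.smult_assoc1)
qed

lemma hom_module_module:
  assumes A: "Module.module R A" and B: "Module.module R B"
  shows "Module.module R (hom_module R A B)"
proof (rule function_module[OF B, where I = "carrier A"])
  let ?H = "hom_module R A B"
  show "f x \<in> carrier B" if "f \<in> carrier ?H" "x \<in> carrier A" for f x
    by (rule mod_hom_D(1)[OF hom_module_mod_hom[OF that(1)] that(2)])
  show "f = g" if "f \<in> carrier ?H" "g \<in> carrier ?H" "\<And>x. x \<in> carrier A \<Longrightarrow> f x = g x" for f g
    by (rule hom_module_eqI[OF that])
  show "\<zero>\<^bsub>?H\<^esub> \<in> carrier ?H"
    unfolding hom_module_simps(2) by (rule restrict_mod_hom[OF A mod_hom_zero_map[OF A B]])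
  show "f \<oplus>\<^bsub>?H\<^esub> g \<in> carrier ?H" if "f \<in> carrier ?H" "g \<in> carrier ?H" for f g
    unfolding hom_module_simps(3)
    by (rule restrict_mod_hom[OF A mod_hom_add[OF A B that[THEN hom_module_mod_hom]]])
  show "r \<odot>\<^bsub>?H\<^esub> f \<in> carrier ?H" if "r \<in> carrier R" "f \<in> carrier ?H" for r f
    unfolding hom_module_simps(4)
    by (rule restrict_mod_hom[OF A mod_hom_smult[OF A B hom_module_mod_hom[OF that(2)] that(1)]])
qed (simp_all add: hom_module_simps(2-4))

lemma power_module_simps:
  "carrier (power_module A n) = {..<n} \<rightarrow>\<^sub>E carrier A"
  "\<zero>\<^bsub>power_module A n\<^esub> = (\<lambda>i\<in>{..<n}. \<zero>\<^bsub>A\<^esub>)"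
  "v \<oplus>\<^bsub>power_module A n\<^esub> w = (\<lambda>i\<in>{..<n}. v i \<oplus>\<^bsub>A\<^esub> w i)"
  "r \<odot>\<^bsub>power_module A n\<^esub> v = (\<lambda>i\<in>{..<n}. r \<odot>\<^bsub>A\<^esub> v i)"
  by (simp_all add: power_module_def)

lemma power_module_eqI:
  assumes "v \<in> carrier (power_module A n)" "w \<in> carrier (power_module A n)"
    "\<And>i. i < n \<Longrightarrow> v i = w i"
  shows "v = w"
  using assms unfolding power_module_simps by (intro PiE_ext[of v _ _ w]) auto

lemma power_module_module:
  assumes A: "Module.module R A"
  shows "Module.module R (power_module A n)"
proof (rule function_module[OF A, where I = "{..<n}"])
  interpret A: Module.module R A by fact
  let ?H = "power_module A n"
  show c: "f i \<in> carrier A" if "f \<in> carrier ?H" "i \<in> {..<n}" for f i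
    using that by (auto simp: power_module_simps)
  show "f = g" if "f \<in> carrier ?H" "g \<in> carrier ?H" "\<And>i. i \<in> {..<n} \<Longrightarrow> f i = g i" for f g
    by (rule power_module_eqI[OF that(1,2)]) (simp add: that(3))
  have I: "(\<lambda>i\<in>{..<n}. f i) \<in> carrier ?H" if "\<And>i. i \<in> {..<n} \<Longrightarrow> f i \<in> carrier A" for f
    using that by (simp add: power_module_simps)
  show "\<zero>\<^bsub>?H\<^esub> \<in> carrier ?H" unfolding power_module_simps(2) by (rule I) simp
  show "f \<oplus>\<^bsub>?H\<^esub> g \<in> carrier ?H" if "f \<in> carrier ?H" "g \<in> carrier ?H" for f g
    unfolding power_module_simps(3) by (intro I A.M.a_closed c that)
  show "r \<odot>\<^bsub>?H\<^esub> f \<in> carrier ?H" if "r \<in> carrier R" "f \<in> carrier ?H" for r f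
    unfolding power_module_simps(4) by (intro I A.smult_closed c that)
qed (simp_all add: power_module_simps(2-4))

lemma power_module_proj: "i < n \<Longrightarrow> (\<lambda>v. v i) \<in> mod_hom R (power_module A n) A"
  by (rule mod_homI) (auto simp: power_module_simps)

lemma mod_hom_into_power:
  assumes "Module.module R E" "\<And>i. i < n \<Longrightarrow> f i \<in> mod_hom R E A"
  shows "(\<lambda>x. \<lambda>i\<in>{..<n}. f i x) \<in> mod_hom R E (power_module A n)"
  by (rule mod_homI) (auto simp: power_module_simps mod_hom_D[OF assms(2)] intro!: restrict_ext)

lemma zero_module_power:
  assumes "Module.module R A"
  shows "zero_module (power_module A n) \<longleftrightarrow> n = 0 \<or> zero_module A"
proof -
  interpret A: Module.module R A by fact
  have "\<forall>x\<in>carrier A. x = \<zero>\<^bsub>A\<^esub>"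
    if "\<forall>v\<in>carrier (power_module A n). v = \<zero>\<^bsub>power_module A n\<^esub>" "n \<noteq> 0"
  proof
    fix x assume x: "x \<in> carrier A"
    have "(\<lambda>i\<in>{..<n}. x) = \<zero>\<^bsub>power_module A n\<^esub>"
      using that(1) x by (auto simp: power_module_simps)
    from fun_cong[OF this, of 0] \<open>n \<noteq> 0\<close> show "x = \<zero>\<^bsub>A\<^esub>" by (simp add: power_module_simps)
  qed
  moreover have "\<forall>v\<in>carrier (power_module A n). v = \<zero>\<^bsub>power_module A n\<^esub>"
    if "n = 0 \<or> (\<forall>x\<in>carrier A. x = \<zero>\<^bsub>A\<^esub>)"
    by (intro ballI power_module_eqI[of _ A n]) (use that in \<open>auto simp: power_module_simps\<close>)
  ultimately show ?thesis
    unfolding zero_module_iff[OF power_module_module[OF assms]] zero_module_iff[OF assms] by blast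
qed

section \<open>Bilinear maps and the universal property of the tensor product\<close>

definition bilinear_map ::
    "('r, 'k) ring_scheme \<Rightarrow> ('r, 'a) module \<Rightarrow> ('r, 'b) module \<Rightarrow> ('r, 'd) module \<Rightarrow> ('a \<Rightarrow> 'b \<Rightarrow> 'd) \<Rightarrow> bool"
  where
  "bilinear_map R A B D \<beta> \<longleftrightarrow> (\<forall>b\<in>carrier B. (\<lambda>a. \<beta> a b) \<in> mod_hom R A D) \<and>
     (\<forall>a\<in>carrier A. \<beta> a \<in> mod_hom R B D)"

lemma bilinear_mapI:
  assumes "\<And>b. b \<in> carrier B \<Longrightarrow> (\<lambda>a. \<beta> a b) \<in> mod_hom R A D"
    and "\<And>a. a \<in> carrier A \<Longrightarrow> \<beta> a \<in> mod_hom R B D"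
  shows "bilinear_map R A B D \<beta>"
  using assms by (simp add: bilinear_map_def)

lemma bilinear_mapD:
  assumes "bilinear_map R A B D \<beta>"
  shows "b \<in> carrier B \<Longrightarrow> (\<lambda>a. \<beta> a b) \<in> mod_hom R A D" "a \<in> carrier A \<Longrightarrow> \<beta> a \<in> mod_hom R B D"
  using assms by (auto simp: bilinear_map_def)

lemma bilinear_map_flip: "bilinear_map R A B D \<beta> \<Longrightarrow> bilinear_map R B A D (\<lambda>b a. \<beta> a b)"
  by (simp add: bilinear_map_def)

lemma bilinear_map_comp:
  assumes "Module.module R A" "Module.module R B" "bilinear_map R A B D \<beta>" "g \<in> mod_hom R D D'"
  shows "bilinear_map R A B D' (\<lambda>a b. g (\<beta> a b))"
  by (intro bilinear_mapI mod_hom_comp[OF _ _ assms(4)]) (use assms bilinear_mapD[OF assms(3)] in auto)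

lemma free_gen_closed:
  assumes "cring R" "x \<in> X"
  shows "free_gen R x \<in> carrier (free_module R X)"
proof -
  interpret F: Module.module R "free_module R X" by (rule free_module_is_module[OF assms(1)])
  show ?thesis
    by (rule lin_ext_free_gen(1)[OF F.module_axioms, of "\<lambda>_. \<zero>\<^bsub>free_module R X\<^esub>"]) (use assms in auto)
qed

lemma tensor_relations_closed:
  assumes A: "Module.module R A" and B: "Module.module R B"
  shows "tensor_relations R A B \<subseteq> carrier (free_module R (carrier A \<times> carrier B))"
proof -
  interpret A: Module.module R A by fact
  interpret B: Module.module R B by fact
  let ?F = "free_module R (carrier A \<times> carrier B)"
  interpret F: Module.module R ?F by (rule free_module_is_module) (rule A.R.cring_axioms)
  have e: "free_gen R (a, b) \<in> carrier ?F" if "a \<in> carrier A" "b \<in> carrier B" for a b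
    using that by (intro free_gen_closed A.R.cring_axioms) auto
  show ?thesis unfolding tensor_relations_def Let_def
    by (safe; intro F.M.minus_closed F.M.a_closed F.smult_closed e; simp)
qed

lemma
  assumes A: "Module.module R A" and B: "Module.module R B"
  defines "F \<equiv> free_module R (carrier A \<times> carrier B)"
  shows tensor_null_submodule: "submodule (tensor_null R A B) R F"
    and tensor_module_module: "Module.module R (tensor_module R A B)"
    and tensor_proj_hom: "(\<lambda>z. tensor_null R A B +>\<^bsub>F\<^esub> z) \<in> mod_hom R F (tensor_module R A B)"
    and tensor_proj_surj: "(\<lambda>z. tensor_null R A B +>\<^bsub>F\<^esub> z) ` carrier F = carrier (tensor_module R A B)"
    and tensor_proj_mem_iff: "\<And>z w. z \<in> carrier F \<Longrightarrow>
      w \<in> tensor_null R A B +>\<^bsub>F\<^esub> z \<longleftrightarrow> w \<in> carrier F \<and> w \<ominus>\<^bsub>F\<^esub> z \<in> tensor_null R A B"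
    and tensor_proj_zero_iff: "\<And>z. z \<in> carrier F \<Longrightarrow>
      tensor_null R A B +>\<^bsub>F\<^esub> z = \<zero>\<^bsub>tensor_module R A B\<^esub> \<longleftrightarrow> z \<in> tensor_null R A B"
proof -
  have F: "Module.module R F" unfolding F_def by (rule free_module_is_module[OF module_cring[OF A]])
  show N: "submodule (tensor_null R A B) R F"
    unfolding tensor_null_def F_def
    by (rule mod_span_submodule[OF F[unfolded F_def] tensor_relations_closed[OF A B]])
  note Q = quot_module_module[OF F N] quot_proj_hom[OF F N] quot_proj_surj[OF F N]
    quot_proj_mem_iff[OF F N] quot_proj_zero_iff[OF F N]
  note Q = Q[unfolded F_def, folded tensor_module_def, folded F_def]
  from Q(1-3) show "Module.module R (tensor_module R A B)"
    "(\<lambda>z. tensor_null R A B +>\<^bsub>F\<^esub> z) \<in> mod_hom R F (tensor_module R A B)"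
    "(\<lambda>z. tensor_null R A B +>\<^bsub>F\<^esub> z) ` carrier F = carrier (tensor_module R A B)" .
  from Q(4) show "w \<in> tensor_null R A B +>\<^bsub>F\<^esub> z \<longleftrightarrow> w \<in> carrier F \<and> w \<ominus>\<^bsub>F\<^esub> z \<in> tensor_null R A B"
    if "z \<in> carrier F" for z w using that by blast
  from Q(5) show "tensor_null R A B +>\<^bsub>F\<^esub> z = \<zero>\<^bsub>tensor_module R A B\<^esub> \<longleftrightarrow> z \<in> tensor_null R A B"
    if "z \<in> carrier F" for z using that by blast
qed

lemma pure_tensor_bilinear:
  assumes A: "Module.module R A" and B: "Module.module R B"
  shows "bilinear_map R A B (tensor_module R A B) (pure_tensor R A B)"
proof -
  interpret A: Module.module R A by fact
  interpret B: Module.module R B by fact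
  let ?F = "free_module R (carrier A \<times> carrier B)"
  have F: "Module.module R ?F" by (rule free_module_is_module) (rule A.R.cring_axioms)
  interpret F: Module.module R ?F by (rule F)
  let ?T = "tensor_module R A B"
  let ?\<pi> = "\<lambda>z. tensor_null R A B +>\<^bsub>?F\<^esub> z"
  have e: "free_gen R (a, b) \<in> carrier ?F" if "a \<in> carrier A" "b \<in> carrier B" for a b
    using that by (intro free_gen_closed A.R.cring_axioms) auto
  have T: "Module.module R ?T" by (rule tensor_module_module[OF A B])
  note \<pi> = mod_hom_D[OF tensor_proj_hom[OF A B]]
  have pure: "pure_tensor R A B a b = ?\<pi> (free_gen R (a, b))" for a b
    by (simp add: pure_tensor_def)
  have rel: "?\<pi> x = ?\<pi> y" if "x \<ominus>\<^bsub>?F\<^esub> y \<in> tensor_relations R A B" "x \<in> carrier ?F" "y \<in> carrier ?F" for x y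
  proof -
    have "x \<ominus>\<^bsub>?F\<^esub> y \<in> tensor_null R A B" unfolding tensor_null_def by (rule subsetD[OF mod_span_superset that(1)])
    then have "?\<pi> (x \<ominus>\<^bsub>?F\<^esub> y) = \<zero>\<^bsub>?T\<^esub>" using that(2,3) by (simp add: tensor_proj_zero_iff[OF A B])
    then show ?thesis
      using that \<pi>(1) by (simp add: mod_hom_diff[OF F T tensor_proj_hom[OF A B]] module_diff_eq_zero_iff[OF T])
  qed
  show ?thesis
  proof (rule bilinear_mapI; rule mod_homI)
    fix b a a' assume b: "b \<in> carrier B" and a: "a \<in> carrier A" "a' \<in> carrier A"
    show "pure_tensor R A B (a \<oplus>\<^bsub>A\<^esub> a') b = pure_tensor R A B a b \<oplus>\<^bsub>?T\<^esub> pure_tensor R A B a' b"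
      unfolding pure \<pi>(2)[OF e[OF a(1) b] e[OF a(2) b], symmetric]
    proof (rule rel)
      show "free_gen R (a \<oplus>\<^bsub>A\<^esub> a', b) \<ominus>\<^bsub>?F\<^esub> (free_gen R (a, b) \<oplus>\<^bsub>?F\<^esub> free_gen R (a', b)) \<in> tensor_relations R A B"
        unfolding tensor_relations_def Let_def
        by (rule UnI1, rule UnI1, rule UnI1, rule CollectI, intro exI conjI, rule refl) (use a b in simp_all)
    qed (use a b e in simp_all)
  next
    fix b b' a assume a: "a \<in> carrier A" and b: "b \<in> carrier B" "b' \<in> carrier B"
    show "pure_tensor R A B a (b \<oplus>\<^bsub>B\<^esub> b') = pure_tensor R A B a b \<oplus>\<^bsub>?T\<^esub> pure_tensor R A B a b'"
      unfolding pure \<pi>(2)[OF e[OF a b(1)] e[OF a b(2)], symmetric]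
    proof (rule rel)
      show "free_gen R (a, b \<oplus>\<^bsub>B\<^esub> b') \<ominus>\<^bsub>?F\<^esub> (free_gen R (a, b) \<oplus>\<^bsub>?F\<^esub> free_gen R (a, b')) \<in> tensor_relations R A B"
        unfolding tensor_relations_def Let_def
        by (rule UnI1, rule UnI1, rule UnI2, rule CollectI, intro exI conjI, rule refl) (use a b in simp_all)
    qed (use a b e in simp_all)
  next
    fix b r a assume b: "b \<in> carrier B" and r: "r \<in> carrier R" and a: "a \<in> carrier A"
    show "pure_tensor R A B (r \<odot>\<^bsub>A\<^esub> a) b = r \<odot>\<^bsub>?T\<^esub> pure_tensor R A B a b"
      unfolding pure \<pi>(3)[OF r e[OF a b], symmetric]
    proof (rule rel)
      show "free_gen R (r \<odot>\<^bsub>A\<^esub> a, b) \<ominus>\<^bsub>?F\<^esub> (r \<odot>\<^bsub>?F\<^esub> free_gen R (a, b)) \<in> tensor_relations R A B"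
        unfolding tensor_relations_def Let_def
        by (rule UnI1, rule UnI2, rule CollectI, intro exI conjI, rule refl) (use a b r in simp_all)
    qed (use a b e r in simp_all)
  next
    fix b r a assume b: "b \<in> carrier B" and r: "r \<in> carrier R" and a: "a \<in> carrier A"
    show "pure_tensor R A B a (r \<odot>\<^bsub>B\<^esub> b) = r \<odot>\<^bsub>?T\<^esub> pure_tensor R A B a b"
      unfolding pure \<pi>(3)[OF r e[OF a b], symmetric]
    proof (rule rel)
      show "free_gen R (a, r \<odot>\<^bsub>B\<^esub> b) \<ominus>\<^bsub>?F\<^esub> (r \<odot>\<^bsub>?F\<^esub> free_gen R (a, b)) \<in> tensor_relations R A B"
        unfolding tensor_relations_def Let_def
        by (rule UnI2, rule CollectI, intro exI conjI, rule refl) (use a b r in simp_all)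
    qed (use a b e r in simp_all)
  qed (simp_all add: pure \<pi>(1) e)
qed

text \<open>The uniqueness half of the universal property: composed with the projection from the
  free module on pairs, both maps are determined by the basis elements, and these go to pure
  tensors.\<close>

lemma tensor_hom_eq:
  assumes A: "Module.module R A" and B: "Module.module R B" and D: "Module.module R D"
    and f: "f \<in> mod_hom R (tensor_module R A B) D" and g: "g \<in> mod_hom R (tensor_module R A B) D"
    and eq: "\<And>a b. a \<in> carrier A \<Longrightarrow> b \<in> carrier B \<Longrightarrow>
      f (pure_tensor R A B a b) = g (pure_tensor R A B a b)"
    and w: "w \<in> carrier (tensor_module R A B)"
  shows "f w = g w"
proof -
  let ?F = "free_module R (carrier A \<times> carrier B)"
  have F: "Module.module R ?F" by (rule free_module_is_module[OF module_cring[OF A]])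
  note \<pi> = tensor_proj_hom[OF A B]
  from w obtain z where z: "z \<in> carrier ?F" "w = tensor_null R A B +>\<^bsub>?F\<^esub> z"
    using tensor_proj_surj[OF A B] by blast
  show ?thesis unfolding z(2)
    by (rule mod_hom_free_eq[OF D mod_hom_comp[OF F \<pi> f] mod_hom_comp[OF F \<pi> g] _ z(1)])
      (use eq in \<open>auto simp: pure_tensor_def\<close>)
qed

text \<open>Bilinearity makes the linear extension of \<open>\<beta>\<close> vanish on the four
  families of relations, hence on their span. Whichever representative \<open>SOME\<close> selects,
  the value is the same.\<close>

lemma
  assumes A: "Module.module R A" and B: "Module.module R B" and D: "Module.module R D"
    and \<beta>: "bilinear_map R A B D \<beta>"
  shows tensor_lift_hom: "tensor_lift R D \<beta> \<in> mod_hom R (tensor_module R A B) D"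
    and tensor_lift_pure: "\<And>a b. a \<in> carrier A \<Longrightarrow> b \<in> carrier B \<Longrightarrow>
      tensor_lift R D \<beta> (pure_tensor R A B a b) = \<beta> a b"
proof -
  interpret A: Module.module R A by fact
  interpret B: Module.module R B by fact
  interpret D: Module.module R D by fact
  let ?F = "free_module R (carrier A \<times> carrier B)"
  have F: "Module.module R ?F" by (rule free_module_is_module) (rule A.R.cring_axioms)
  interpret F: Module.module R ?F by (rule F)
  let ?T = "tensor_module R A B"
  let ?\<pi> = "\<lambda>z. tensor_null R A B +>\<^bsub>?F\<^esub> z"
  have e: "free_gen R (a, b) \<in> carrier ?F" if "a \<in> carrier A" "b \<in> carrier B" for a b
    using that by (intro free_gen_closed A.R.cring_axioms) auto
  note \<pi> = mod_hom_D[OF tensor_proj_hom[OF A B]]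
  note \<beta>l = mod_hom_D[OF bilinear_mapD(1)[OF \<beta>]] and \<beta>r = mod_hom_D[OF bilinear_mapD(2)[OF \<beta>]]
  define b where "b = (\<lambda>(x, y). \<beta> x y)"
  have b: "b \<in> carrier A \<times> carrier B \<rightarrow> carrier D" using \<beta>r(1) by (auto simp: b_def)
  let ?l = "lin_ext R D b"
  have l: "?l \<in> mod_hom R ?F D" by (rule lin_ext_hom[OF D b])
  have lg: "?l (free_gen R (x, y)) = \<beta> x y" if "x \<in> carrier A" "y \<in> carrier B" for x y
    using lin_ext_free_gen(2)[OF D b, of "(x, y)"] that by (simp add: b_def)
  have K: "submodule {z \<in> carrier ?F. ?l z = \<zero>\<^bsub>D\<^esub>} R ?F" by (rule submodule_ker[OF F D l])
  have ld: "?l (x \<ominus>\<^bsub>?F\<^esub> y) = \<zero>\<^bsub>D\<^esub> \<longleftrightarrow> ?l x = ?l y" if "x \<in> carrier ?F" "y \<in> carrier ?F" for x y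
    using that mod_hom_D(1)[OF l] by (simp add: mod_hom_diff[OF F D l] module_diff_eq_zero_iff[OF D])
  have "?l z = \<zero>\<^bsub>D\<^esub>" if "z \<in> tensor_relations R A B" for z
    using that unfolding tensor_relations_def Let_def
  proof (elim UnE CollectE exE conjE)
    fix a a' b assume "z = free_gen R (a \<oplus>\<^bsub>A\<^esub> a', b) \<ominus>\<^bsub>?F\<^esub> (free_gen R (a, b) \<oplus>\<^bsub>?F\<^esub> free_gen R (a', b))"
      and "a \<in> carrier A" "a' \<in> carrier A" "b \<in> carrier B"
    then show ?thesis by (simp add: ld e mod_hom_D(2)[OF l] lg \<beta>l)
  next
    fix a b b' assume "z = free_gen R (a, b \<oplus>\<^bsub>B\<^esub> b') \<ominus>\<^bsub>?F\<^esub> (free_gen R (a, b) \<oplus>\<^bsub>?F\<^esub> free_gen R (a, b'))"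
      and "a \<in> carrier A" "b \<in> carrier B" "b' \<in> carrier B"
    then show ?thesis by (simp add: ld e mod_hom_D(2)[OF l] lg \<beta>r)
  next
    fix r a b assume "z = free_gen R (r \<odot>\<^bsub>A\<^esub> a, b) \<ominus>\<^bsub>?F\<^esub> r \<odot>\<^bsub>?F\<^esub> free_gen R (a, b)"
      and "r \<in> carrier R" "a \<in> carrier A" "b \<in> carrier B"
    then show ?thesis by (simp add: ld e mod_hom_D(3)[OF l] lg \<beta>l)
  next
    fix r a b assume "z = free_gen R (a, r \<odot>\<^bsub>B\<^esub> b) \<ominus>\<^bsub>?F\<^esub> r \<odot>\<^bsub>?F\<^esub> free_gen R (a, b)"
      and "r \<in> carrier R" "a \<in> carrier A" "b \<in> carrier B"
    then show ?thesis by (simp add: ld e mod_hom_D(3)[OF l] lg \<beta>r)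
  qed
  then have "tensor_relations R A B \<subseteq> {z \<in> carrier ?F. ?l z = \<zero>\<^bsub>D\<^esub>}"
    using tensor_relations_closed[OF A B] by blast
  from mod_span_minimal[OF K this] have null: "?l z = \<zero>\<^bsub>D\<^esub>" if "z \<in> tensor_null R A B" for z
    using that by (auto simp: tensor_null_def)
  have lift: "tensor_lift R D \<beta> (?\<pi> z) = ?l z" if z: "z \<in> carrier ?F" for z
  proof -
    have "z \<in> ?\<pi> z" using z submodule_zero[OF tensor_null_submodule[OF A B]]
      by (simp add: tensor_proj_mem_iff[OF A B z] F.M.minus_eq F.M.r_neg)
    then have "(SOME w. w \<in> ?\<pi> z) \<in> ?\<pi> z" by (rule someI[of "\<lambda>w. w \<in> ?\<pi> z"])
    then have "(SOME w. w \<in> ?\<pi> z) \<in> carrier ?F" "(SOME w. w \<in> ?\<pi> z) \<ominus>\<^bsub>?F\<^esub> z \<in> tensor_null R A B"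
      using tensor_proj_mem_iff[OF A B z] by auto
    then show ?thesis using ld[of "SOME w. w \<in> ?\<pi> z" z] null z
      by (simp add: tensor_lift_def b_def)
  qed
  have ex: thesis if "x \<in> carrier ?T" "\<And>z. z \<in> carrier ?F \<Longrightarrow> x = ?\<pi> z \<Longrightarrow> thesis" for x thesis
    using that(1) unfolding tensor_proj_surj[OF A B, symmetric] by (rule imageE) (rule that(2))
  show "tensor_lift R D \<beta> \<in> mod_hom R ?T D"
  proof (rule mod_homI)
    fix x assume "x \<in> carrier ?T"
    then obtain z where "z \<in> carrier ?F" "x = ?\<pi> z" by (rule ex)
    then show "tensor_lift R D \<beta> x \<in> carrier D" using mod_hom_D(1)[OF l] by (simp add: lift)
  next
    fix x y assume x: "x \<in> carrier ?T" and y: "y \<in> carrier ?T"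
    from x obtain z where z: "z \<in> carrier ?F" "x = ?\<pi> z" by (rule ex)
    from y obtain w where w: "w \<in> carrier ?F" "y = ?\<pi> w" by (rule ex)
    show "tensor_lift R D \<beta> (x \<oplus>\<^bsub>?T\<^esub> y) = tensor_lift R D \<beta> x \<oplus>\<^bsub>D\<^esub> tensor_lift R D \<beta> y"
      unfolding z(2) w(2) \<pi>(2)[OF z(1) w(1), symmetric] lift[OF F.M.a_closed[OF z(1) w(1)]]
        lift[OF z(1)] lift[OF w(1)] by (rule mod_hom_D(2)[OF l z(1) w(1)])
  next
    fix r x assume r: "r \<in> carrier R" and x: "x \<in> carrier ?T"
    from x obtain z where z: "z \<in> carrier ?F" "x = ?\<pi> z" by (rule ex)
    show "tensor_lift R D \<beta> (r \<odot>\<^bsub>?T\<^esub> x) = r \<odot>\<^bsub>D\<^esub> tensor_lift R D \<beta> x"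
      unfolding z(2) \<pi>(3)[OF r z(1), symmetric] lift[OF F.smult_closed[OF r z(1)]]
        lift[OF z(1)] by (rule mod_hom_D(3)[OF l r z(1)])
  qed
  show "tensor_lift R D \<beta> (pure_tensor R A B x y) = \<beta> x y" if "x \<in> carrier A" "y \<in> carrier B" for x y
    using that e by (simp add: pure_tensor_def lift lg)
qed

text \<open>Induction over tensors that never touches sums: the projection modulo \<open>H\<close>
  agrees with the zero map on pure tensors, hence everywhere.\<close>

lemma tensor_induct_submodule:
  assumes A: "Module.module R A" and B: "Module.module R B"
    and H: "submodule H R (tensor_module R A B)"
    and pure: "\<And>a b. a \<in> carrier A \<Longrightarrow> b \<in> carrier B \<Longrightarrow> pure_tensor R A B a b \<in> H"
    and w: "w \<in> carrier (tensor_module R A B)"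
  shows "w \<in> H"
proof -
  let ?T = "tensor_module R A B"
  have T: "Module.module R ?T" by (rule tensor_module_module[OF A B])
  note p = mod_hom_D(1)[OF bilinear_mapD(2)[OF pure_tensor_bilinear[OF A B]]]
  have "H +>\<^bsub>?T\<^esub> w = \<zero>\<^bsub>quot_module ?T H\<^esub>"
    by (rule tensor_hom_eq[OF A B quot_module_module[OF T H] quot_proj_hom[OF T H]
        mod_hom_zero_map[OF T quot_module_module[OF T H]] _ w])
      (simp add: quot_proj_zero_iff[OF T H] p pure)
  then show ?thesis using quot_proj_zero_iff[OF T H w] by simp
qed

text \<open>Functoriality in the left factor, written so that the differential of
  \<open>tensor_complex\<close> is literally an instance.\<close>

definition tensor_map ::
    "('r, 'k) ring_scheme \<Rightarrow> ('r, 'd) module \<Rightarrow> ('r, 'b) module \<Rightarrow> ('a \<Rightarrow> 'd) \<Rightarrow>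
     ('a \<times> 'b \<Rightarrow> 'r) set \<Rightarrow> ('d \<times> 'b \<Rightarrow> 'r) set" where
  "tensor_map R D B f = tensor_lift R (tensor_module R D B) (\<lambda>x b. pure_tensor R D B (f x) b)"

lemma
  assumes A: "Module.module R A" and B: "Module.module R B" and D: "Module.module R D"
    and f: "f \<in> mod_hom R A D"
  shows tensor_map_hom: "tensor_map R D B f \<in> mod_hom R (tensor_module R A B) (tensor_module R D B)"
    and tensor_map_pure: "\<And>a b. a \<in> carrier A \<Longrightarrow> b \<in> carrier B \<Longrightarrow>
      tensor_map R D B f (pure_tensor R A B a b) = pure_tensor R D B (f a) b"
proof -
  have bil: "bilinear_map R A B (tensor_module R D B) (\<lambda>x b. pure_tensor R D B (f x) b)"
    by (rule bilinear_mapI)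
      (use mod_hom_comp[OF A f bilinear_mapD(1)[OF pure_tensor_bilinear[OF D B]]]
        bilinear_mapD(2)[OF pure_tensor_bilinear[OF D B]] mod_hom_D(1)[OF f] in auto)
  note T = tensor_module_module[OF D B]
  show "tensor_map R D B f \<in> mod_hom R (tensor_module R A B) (tensor_module R D B)"
    unfolding tensor_map_def by (rule tensor_lift_hom[OF A B T bil])
  show "tensor_map R D B f (pure_tensor R A B a b) = pure_tensor R D B (f a) b"
    if "a \<in> carrier A" "b \<in> carrier B" for a b
    unfolding tensor_map_def by (rule tensor_lift_pure[OF A B T bil that])
qed

section \<open>Exactness after applying Hom\<close>

lemma free_module_lifting:
  assumes B: "Module.module R B" and D: "Module.module R D"
    and p: "p \<in> mod_hom R B D" "p ` carrier B = carrier D"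
    and f: "f \<in> mod_hom R (free_module R X) D"
  shows "\<exists>h\<in>mod_hom R (free_module R X) B. \<forall>z\<in>carrier (free_module R X). p (h z) = f z"
proof -
  have R: "cring R" by (rule module_cring[OF B])
  note F = free_module_is_module[OF R]
  have "\<exists>b\<in>carrier B. p b = f (free_gen R x)" if "x \<in> X" for x
    using mod_hom_D(1)[OF f free_gen_closed[OF R that]] unfolding p(2)[symmetric] by (metis imageE)
  then obtain b where b: "\<And>x. x \<in> X \<Longrightarrow> b x \<in> carrier B \<and> p (b x) = f (free_gen R x)" by metis
  then have b': "b \<in> X \<rightarrow> carrier B" by simp
  note h = lin_ext_hom[OF B b']
  have "p (lin_ext R B b z) = f z" if "z \<in> carrier (free_module R X)" for z
    by (rule mod_hom_free_eq[OF D mod_hom_comp[OF F h p(1)] f _ that])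
      (use b in \<open>simp add: lin_ext_free_gen(2)[OF B b']\<close>)
  then show ?thesis using h by blast
qed

lemma mod_hom_factor:
  assumes E: "Module.module R E" and C: "Module.module R C" and B: "Module.module R B"
    and a: "a \<in> mod_hom R E C" "a ` carrier E = carrier C" and f: "f \<in> mod_hom R E B"
    and ker: "\<And>z. z \<in> carrier E \<Longrightarrow> a z = \<zero>\<^bsub>C\<^esub> \<Longrightarrow> f z = \<zero>\<^bsub>B\<^esub>"
  shows "\<exists>g\<in>mod_hom R C B. \<forall>z\<in>carrier E. g (a z) = f z"
proof -
  interpret E: Module.module R E by fact
  interpret C: Module.module R C by fact
  interpret B: Module.module R B by fact
  note ah = mod_hom_D[OF a(1)] and fh = mod_hom_D[OF f]
  define g where "g c = f (inv_into (carrier E) a c)" for c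
  have ga: "g (a z) = f z" if z: "z \<in> carrier E" for z
  proof -
    let ?w = "inv_into (carrier E) a (a z)"
    have w: "?w \<in> carrier E" "a ?w = a z" using z by (auto intro: inv_into_into f_inv_into_f)
    then have "a (?w \<ominus>\<^bsub>E\<^esub> z) = \<zero>\<^bsub>C\<^esub>"
      using z ah(1) by (simp add: mod_hom_diff[OF E C a(1)] module_diff_eq_zero_iff[OF C])
    then have "f (?w \<ominus>\<^bsub>E\<^esub> z) = \<zero>\<^bsub>B\<^esub>" using w z by (intro ker) auto
    then show ?thesis using w z fh(1) unfolding g_def
      by (simp add: mod_hom_diff[OF E B f] module_diff_eq_zero_iff[OF B])
  qed
  have ex: "\<exists>z\<in>carrier E. c = a z" if "c \<in> carrier C" for c using that unfolding a(2)[symmetric] by auto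
  have "g \<in> mod_hom R C B"
  proof (rule mod_homI)
    fix c assume "c \<in> carrier C"
    then show "g c \<in> carrier B" using ex[of c] fh(1) ga by auto
  next
    fix c d assume "c \<in> carrier C" "d \<in> carrier C"
    then obtain z w where "z \<in> carrier E" "c = a z" "w \<in> carrier E" "d = a w" using ex by meson
    then show "g (c \<oplus>\<^bsub>C\<^esub> d) = g c \<oplus>\<^bsub>B\<^esub> g d" by (simp add: ga fh(2) ah(2)[symmetric])
  next
    fix r c assume r: "r \<in> carrier R" and "c \<in> carrier C"
    then obtain z where "z \<in> carrier E" "c = a z" using ex by meson
    then show "g (r \<odot>\<^bsub>C\<^esub> c) = r \<odot>\<^bsub>B\<^esub> g c" using r by (simp add: ga fh(3) ah(3)[symmetric])
  qed
  then show ?thesis using ga by blast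
qed

text \<open>
  Exactness of \<open>Hom(E\<^sub>0, A) \<rightarrow> Hom(E\<^sub>1, A) \<rightarrow> Hom(E\<^sub>2, A)\<close> at the middle term.  Taking for \<open>E\<close> a free
  resolution gives the vanishing of Ext, taking the dual of a resolution by finite free
  modules gives the vanishing of Tor.
\<close>

definition hom_exact ::
    "('r, 'k) ring_scheme \<Rightarrow> ('r, 'e) module \<Rightarrow> ('e \<Rightarrow> 'e) \<Rightarrow> ('r, 'e) module \<Rightarrow> ('e \<Rightarrow> 'e) \<Rightarrow>
     ('r, 'e) module \<Rightarrow> ('r, 'a) module \<Rightarrow> bool" where
  "hom_exact R E2 d2 E1 d1 E0 A \<longleftrightarrow>
     (\<forall>f\<in>mod_hom R E1 A. (\<forall>z\<in>carrier E2. f (d2 z) = \<zero>\<^bsub>A\<^esub>) \<longrightarrow>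
        (\<exists>g\<in>mod_hom R E0 A. \<forall>z\<in>carrier E1. f z = g (d1 z)))"

lemma hom_exactI:
  assumes "\<And>f. f \<in> mod_hom R E1 A \<Longrightarrow> (\<And>z. z \<in> carrier E2 \<Longrightarrow> f (d2 z) = \<zero>\<^bsub>A\<^esub>) \<Longrightarrow>
    \<exists>g\<in>mod_hom R E0 A. \<forall>z\<in>carrier E1. f z = g (d1 z)"
  shows "hom_exact R E2 d2 E1 d1 E0 A"
  using assms by (simp add: hom_exact_def)

lemma hom_exactD:
  assumes "hom_exact R E2 d2 E1 d1 E0 A" "f \<in> mod_hom R E1 A" "\<And>z. z \<in> carrier E2 \<Longrightarrow> f (d2 z) = \<zero>\<^bsub>A\<^esub>"
  shows "\<exists>g\<in>mod_hom R E0 A. \<forall>z\<in>carrier E1. f z = g (d1 z)"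
  using assms unfolding hom_exact_def by simp

lemma hom_exactE:
  assumes "hom_exact R E2 d2 E1 d1 E0 A" "f \<in> mod_hom R E1 A" "\<And>z. z \<in> carrier E2 \<Longrightarrow> f (d2 z) = \<zero>\<^bsub>A\<^esub>"
  obtains g where "g \<in> mod_hom R E0 A" "\<And>z. z \<in> carrier E1 \<Longrightarrow> f z = g (d1 z)"
  using assms unfolding hom_exact_def by blast

lemma hom_exact_zero_module:
  assumes "Module.module R A" "Module.module R E0" "d1 \<in> mod_hom R E1 E0" "zero_module A"
  shows "hom_exact R E2 d2 E1 d1 E0 A"
proof (rule hom_exactI)
  fix f assume "f \<in> mod_hom R E1 A"
  from mod_hom_D(1)[OF this] have "\<forall>z\<in>carrier E1. f z = \<zero>\<^bsub>A\<^esub>"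
    using assms(4) by (simp add: zero_module_def)
  then show "\<exists>g\<in>mod_hom R E0 A. \<forall>z\<in>carrier E1. f z = g (d1 z)"
    by (intro bexI[OF _ mod_hom_zero_map[OF assms(2,1)]]) simp
qed

text \<open>Solve for \<open>s f\<close> in the larger module and project the solution back by
  \<open>q\<close>. Isomorphic modules, and later P \<otimes> C as a retract of the same
  construction for a free module, are reached this way.\<close>

lemma hom_exact_retract:
  assumes E: "Module.module R E0" "Module.module R E1" "d1 \<in> mod_hom R E1 E0" "d2 \<in> mod_hom R E2 E1"
    and A: "Module.module R A" and B: "Module.module R B"
    and s: "s \<in> mod_hom R A B" and q: "q \<in> mod_hom R B A" and qs: "\<And>x. x \<in> carrier A \<Longrightarrow> q (s x) = x"
    and ex: "hom_exact R E2 d2 E1 d1 E0 B"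
  shows "hom_exact R E2 d2 E1 d1 E0 A"
proof (rule hom_exactI)
  fix f assume f: "f \<in> mod_hom R E1 A" and 0: "\<And>z. z \<in> carrier E2 \<Longrightarrow> f (d2 z) = \<zero>\<^bsub>A\<^esub>"
  from ex obtain g where g: "g \<in> mod_hom R E0 B" "\<And>z. z \<in> carrier E1 \<Longrightarrow> s (f z) = g (d1 z)"
    by (rule hom_exactE[of R E2 d2 E1 d1 E0 B "\<lambda>z. s (f z)"])
      (simp_all add: mod_hom_comp[OF E(2) f s] 0 mod_hom_0[OF A B s])
  have "f z = q (g (d1 z))" if "z \<in> carrier E1" for z
    using g(2)[OF that] qs[OF mod_hom_D(1)[OF f that]] by simp
  then show "\<exists>g\<in>mod_hom R E0 A. \<forall>z\<in>carrier E1. f z = g (d1 z)"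
    using mod_hom_comp[OF E(1) g(1) q] by (intro bexI[of _ "\<lambda>z. q (g z)"]) auto
qed

lemma hom_exact_isomorphic:
  assumes E: "Module.module R E0" "Module.module R E1" "d1 \<in> mod_hom R E1 E0" "d2 \<in> mod_hom R E2 E1"
    and A: "Module.module R A" and B: "Module.module R B"
    and iso: "mod_isomorphic R A B" and ex: "hom_exact R E2 d2 E1 d1 E0 B"
  shows "hom_exact R E2 d2 E1 d1 E0 A"
proof -
  obtain f where f: "f \<in> mod_hom R A B" "bij_betw f (carrier A) (carrier B)"
    using iso by (rule mod_isomorphicE)
  show ?thesis
    by (rule hom_exact_retract[OF E A B f(1) mod_hom_inv_into[OF A B f] bij_betw_inv_into_left[OF f(2)] ex])
qed

lemma hom_exact_power:
  assumes E: "Module.module R E0" "Module.module R E1" "d1 \<in> mod_hom R E1 E0" "d2 \<in> mod_hom R E2 E1"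
    and A: "Module.module R A" and ex: "hom_exact R E2 d2 E1 d1 E0 A"
  shows "hom_exact R E2 d2 E1 d1 E0 (power_module A n)"
proof (rule hom_exactI)
  fix f assume f: "f \<in> mod_hom R E1 (power_module A n)"
    and 0: "\<And>z. z \<in> carrier E2 \<Longrightarrow> f (d2 z) = \<zero>\<^bsub>power_module A n\<^esub>"
  have "\<exists>g\<in>mod_hom R E0 A. \<forall>z\<in>carrier E1. f z i = g (d1 z)" if i: "i < n" for i
  proof -
    from ex obtain g where "g \<in> mod_hom R E0 A" "\<And>z. z \<in> carrier E1 \<Longrightarrow> f z i = g (d1 z)"
      by (rule hom_exactE[of R E2 d2 E1 d1 E0 A "\<lambda>z. f z i"])
        (use i in \<open>simp_all add: mod_hom_comp[OF E(2) f power_module_proj] 0 power_module_simps\<close>)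
    then show ?thesis by blast
  qed
  then obtain g where g: "\<And>i. i < n \<Longrightarrow> g i \<in> mod_hom R E0 A"
    "\<And>i z. i < n \<Longrightarrow> z \<in> carrier E1 \<Longrightarrow> f z i = g i (d1 z)" by metis
  have G: "(\<lambda>x. \<lambda>i\<in>{..<n}. g i x) \<in> mod_hom R E0 (power_module A n)"
    by (rule mod_hom_into_power[OF E(1) g(1)])
  have "f z = (\<lambda>i\<in>{..<n}. g i (d1 z))" if "z \<in> carrier E1" for z
    by (rule power_module_eqI[OF mod_hom_D(1)[OF f that] mod_hom_D(1)[OF G mod_hom_D(1)[OF E(3) that]]])
      (simp add: g that)
  then show "\<exists>g\<in>mod_hom R E0 (power_module A n). \<forall>z\<in>carrier E1. f z = g (d1 z)"
    using G by (intro bexI[of _ "\<lambda>x. \<lambda>i\<in>{..<n}. g i x"]) auto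
qed

text \<open>A short exact sequence with kernel \<open>K\<close>, middle term \<open>B\<close> and
  quotient \<open>D\<close>. The kernel remains a subset of the carrier of \<open>B\<close>, so
  cycles and boundaries fit in without transport along an inclusion.\<close>

locale module_ses =
  fixes R :: "('r, 'k) ring_scheme" and B :: "('r, 'b) module" and D :: "('r, 'd) module"
    and p :: "'b \<Rightarrow> 'd" and K :: "'b set"
  assumes B: "Module.module R B" and D: "Module.module R D"
    and p: "p \<in> mod_hom R B D" and p_surj: "p ` carrier B = carrier D"
    and K: "K = {x \<in> carrier B. p x = \<zero>\<^bsub>D\<^esub>}"
begin

lemma K_subset: "K \<subseteq> carrier B"
  by (auto simp: K)

lemma free_lifting:
  assumes "f \<in> mod_hom R (free_module R X) D"
  obtains h where "h \<in> mod_hom R (free_module R X) B" "\<And>z. z \<in> carrier (free_module R X) \<Longrightarrow> p (h z) = f z"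
  using free_module_lifting[OF B D p p_surj assms] by blast

lemma into_K:
  assumes "f \<in> mod_hom R E B" "\<And>z. z \<in> carrier E \<Longrightarrow> p (f z) = \<zero>\<^bsub>D\<^esub>"
  shows "f \<in> mod_hom R E (B\<lparr>carrier := K\<rparr>)"
  using assms mod_hom_D(1)[OF assms(1)] by (intro mod_hom_codomain_sub) (auto simp: K)

lemma from_K:
  assumes "f \<in> mod_hom R E (B\<lparr>carrier := K\<rparr>)"
  shows "f \<in> mod_hom R E B" "z \<in> carrier E \<Longrightarrow> p (f z) = \<zero>\<^bsub>D\<^esub>"
  using mod_hom_sub_D[OF assms K_subset] by (auto simp: K)

text \<open>Freeness of \<open>E0\<close> lifts the solution for \<open>p f\<close> to a map into
  \<open>B\<close>. Once its pullback is subtracted, \<open>f\<close> becomes a cocycle with values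
  in \<open>K\<close>, where exactness applies.\<close>

lemma hom_exact_middle:
  fixes E1 E2 :: "('r, 'e \<Rightarrow> 'r) module"
  assumes E: "E0 = free_module R X" "Module.module R E1" "Module.module R E2"
      "d1 \<in> mod_hom R E1 E0" "d2 \<in> mod_hom R E2 E1"
    and dd: "\<And>z. z \<in> carrier E2 \<Longrightarrow> d1 (d2 z) = \<zero>\<^bsub>E0\<^esub>"
    and exK: "hom_exact R E2 d2 E1 d1 E0 (B\<lparr>carrier := K\<rparr>)" and exD: "hom_exact R E2 d2 E1 d1 E0 D"
  shows "hom_exact R E2 d2 E1 d1 E0 B"
proof (rule hom_exactI)
  interpret B: Module.module R B by (rule B)
  interpret D: Module.module R D by (rule D)
  have E0: "Module.module R E0" unfolding E(1) by (rule free_module_is_module[OF B.R.cring_axioms])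
  note d1 = mod_hom_D(1)[OF E(4)] and d2 = mod_hom_D(1)[OF E(5)]
  fix f assume f: "f \<in> mod_hom R E1 B" and 0: "\<And>z. z \<in> carrier E2 \<Longrightarrow> f (d2 z) = \<zero>\<^bsub>B\<^esub>"
  from exD obtain g where g: "g \<in> mod_hom R E0 D" "\<And>z. z \<in> carrier E1 \<Longrightarrow> p (f z) = g (d1 z)"
    by (rule hom_exactE[of R E2 d2 E1 d1 E0 D "\<lambda>z. p (f z)"])
      (simp_all add: mod_hom_comp[OF E(2) f p] 0 mod_hom_0[OF B D p])
  obtain g' where g': "g' \<in> mod_hom R E0 B" "\<And>z. z \<in> carrier E0 \<Longrightarrow> p (g' z) = g z"
    using free_lifting g(1) unfolding E(1) by blast
  let ?f = "\<lambda>z. f z \<ominus>\<^bsub>B\<^esub> g' (d1 z)"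
  have f': "?f \<in> mod_hom R E1 B"
    by (rule mod_hom_minus[OF E(2) B f mod_hom_comp[OF E(2,4) g'(1)]])
  have "p (?f z) = \<zero>\<^bsub>D\<^esub>" if z: "z \<in> carrier E1" for z
    using mod_hom_D(1)[OF f z] mod_hom_D(1)[OF g'(1) d1[OF z]] mod_hom_D(1)[OF g(1) d1[OF z]]
    by (simp add: mod_hom_diff[OF B D p] g(2)[OF z] g'(2)[OF d1[OF z]] D.M.minus_eq D.M.r_neg)
  from into_K[OF f' this] have f'K: "?f \<in> mod_hom R E1 (B\<lparr>carrier := K\<rparr>)" .
  have van: "?f (d2 z) = \<zero>\<^bsub>B\<lparr>carrier := K\<rparr>\<^esub>" if "z \<in> carrier E2" for z
    by (simp add: 0[OF that] dd[OF that] mod_hom_0[OF E0 B g'(1)] B.M.minus_eq)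
  obtain h where h: "h \<in> mod_hom R E0 (B\<lparr>carrier := K\<rparr>)"
    "\<And>z. z \<in> carrier E1 \<Longrightarrow> ?f z = h (d1 z)"
    by (rule hom_exactE[of _ _ _ _ _ _ _ ?f, OF exK f'K van]) (assumption, erule that, simp)
  note h' = from_K(1)[OF h(1)]
  have "f z = g' (d1 z) \<oplus>\<^bsub>B\<^esub> h (d1 z)" if z: "z \<in> carrier E1" for z
    using mod_hom_D(1)[OF f z] mod_hom_D(1)[OF g'(1) d1[OF z]]
    by (simp add: h(2)[OF z, symmetric] B.M.minus_eq B.M.a_lcomm B.M.r_neg)
  then show "\<exists>g\<in>mod_hom R E0 B. \<forall>z\<in>carrier E1. f z = g (d1 z)"
    using mod_hom_add[OF E0 B g'(1) h'] by (intro bexI[of _ "\<lambda>z. g' z \<oplus>\<^bsub>B\<^esub> h z"]) auto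
qed

text \<open>This stands in for the connecting map from \<open>D\<close> to \<open>K\<close>. A lift
  \<open>f'\<close> of the cocycle \<open>f\<close> fails to be a cocycle only by
  \<open>f' d2\<close>, which has values in \<open>K\<close>. Exactness for \<open>K\<close> one
  step further along writes it as \<open>g d2\<close>, and \<open>f' - g\<close> is a cocycle in
  \<open>B\<close>.\<close>

lemma hom_exact_quotient:
  fixes E2 E3 :: "('r, 'e \<Rightarrow> 'r) module"
  assumes E: "E1 = free_module R X" "Module.module R E0" "Module.module R E2" "Module.module R E3"
      "d1 \<in> mod_hom R E1 E0" "d2 \<in> mod_hom R E2 E1" "d3 \<in> mod_hom R E3 E2"
    and dd: "\<And>z. z \<in> carrier E3 \<Longrightarrow> d2 (d3 z) = \<zero>\<^bsub>E1\<^esub>"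
    and exK: "hom_exact R E3 d3 E2 d2 E1 (B\<lparr>carrier := K\<rparr>)" and exB: "hom_exact R E2 d2 E1 d1 E0 B"
  shows "hom_exact R E2 d2 E1 d1 E0 D"
proof (rule hom_exactI)
  interpret B: Module.module R B by (rule B)
  interpret D: Module.module R D by (rule D)
  have E1: "Module.module R E1" unfolding E(1) by (rule free_module_is_module[OF B.R.cring_axioms])
  note d1 = mod_hom_D(1)[OF E(5)] and d2 = mod_hom_D(1)[OF E(6)]
  fix f assume f: "f \<in> mod_hom R E1 D" and 0: "\<And>z. z \<in> carrier E2 \<Longrightarrow> f (d2 z) = \<zero>\<^bsub>D\<^esub>"
  obtain f' where f': "f' \<in> mod_hom R E1 B" "\<And>z. z \<in> carrier E1 \<Longrightarrow> p (f' z) = f z"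
    using free_lifting f unfolding E(1) by blast
  have fd: "(\<lambda>z. f' (d2 z)) \<in> mod_hom R E2 (B\<lparr>carrier := K\<rparr>)"
    by (rule into_K[OF mod_hom_comp[OF E(3,6) f'(1)]]) (simp add: f'(2)[OF d2] 0)
  have van: "f' (d2 (d3 z)) = \<zero>\<^bsub>B\<lparr>carrier := K\<rparr>\<^esub>" if "z \<in> carrier E3" for z
    by (simp add: dd[OF that] mod_hom_0[OF E1 B f'(1)])
  obtain g where g: "g \<in> mod_hom R E1 (B\<lparr>carrier := K\<rparr>)"
    "\<And>z. z \<in> carrier E2 \<Longrightarrow> f' (d2 z) = g (d2 z)"
    by (rule hom_exactE[of _ _ _ _ _ _ _ "\<lambda>z. f' (d2 z)", OF exK fd van]) (assumption, erule that, simp)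
  note g' = from_K[OF g(1)]
  let ?f = "\<lambda>z. f' z \<ominus>\<^bsub>B\<^esub> g z"
  have fh: "?f \<in> mod_hom R E1 B" by (rule mod_hom_minus[OF E1 B f'(1) g'(1)])
  have van': "?f (d2 z) = \<zero>\<^bsub>B\<^esub>" if z: "z \<in> carrier E2" for z
    using mod_hom_D(1)[OF g'(1) d2[OF z]] by (simp add: g(2)[OF z] B.M.minus_eq B.M.r_neg)
  obtain h where h: "h \<in> mod_hom R E0 B"
    "\<And>z. z \<in> carrier E1 \<Longrightarrow> ?f z = h (d1 z)"
    by (rule hom_exactE[of _ _ _ _ _ _ _ ?f, OF exB fh van']) (assumption, erule that, simp)
  have "f z = p (h (d1 z))" if z: "z \<in> carrier E1" for z
    using mod_hom_D(1)[OF f'(1) z] mod_hom_D(1)[OF g'(1) z] mod_hom_D(1)[OF f z]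
    by (simp add: h(2)[OF z, symmetric] mod_hom_diff[OF B D p] f'(2)[OF z] g'(2)[OF z] D.M.minus_eq)
  then show "\<exists>g\<in>mod_hom R E0 D. \<forall>z\<in>carrier E1. f z = g (d1 z)"
    using mod_hom_comp[OF E(2) h(1) p] by (intro bexI[of _ "\<lambda>z. p (h z)"]) auto
qed

text \<open>As \<open>p w\<close> vanishes on the image of \<open>d1\<close>, it factors through
  \<open>d0\<close>. Lifting this factor to \<open>B\<close> by freeness of \<open>E'\<close> and
  subtracting it moves \<open>w\<close> into \<open>K\<close>, and \<open>d0 d1 = 0\<close> ensures
  that nothing changes on the image of \<open>d1\<close>.\<close>

lemma hom_correct_into_K:
  fixes E1 E0 :: "('r, 'e \<Rightarrow> 'r) module"
  assumes E: "E' = free_module R X" "Module.module R E0" "Module.module R E1"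
      "d0 \<in> mod_hom R E0 E'" "d1 \<in> mod_hom R E1 E0"
    and dd: "\<And>z. z \<in> carrier E1 \<Longrightarrow> d0 (d1 z) = \<zero>\<^bsub>E'\<^esub>"
    and exD: "hom_exact R E1 d1 E0 d0 E' D"
    and w: "w \<in> mod_hom R E0 B" and 0: "\<And>z. z \<in> carrier E1 \<Longrightarrow> p (w (d1 z)) = \<zero>\<^bsub>D\<^esub>"
  obtains w' where "w' \<in> mod_hom R E0 (B\<lparr>carrier := K\<rparr>)" "\<And>z. z \<in> carrier E1 \<Longrightarrow> w' (d1 z) = w (d1 z)"
proof -
  interpret B: Module.module R B by (rule B)
  interpret D: Module.module R D by (rule D)
  have E': "Module.module R E'" unfolding E(1) by (rule free_module_is_module[OF B.R.cring_axioms])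
  note d0 = mod_hom_D(1)[OF E(4)] and d1 = mod_hom_D(1)[OF E(5)]
  obtain g where g: "g \<in> mod_hom R E' D" "\<And>z. z \<in> carrier E0 \<Longrightarrow> p (w z) = g (d0 z)"
    by (rule hom_exactE[of _ _ _ _ _ _ _ "\<lambda>z. p (w z)", OF exD mod_hom_comp[OF E(2) w p] 0]) (assumption, erule that, simp)
  obtain g' where g': "g' \<in> mod_hom R E' B" "\<And>z. z \<in> carrier E' \<Longrightarrow> p (g' z) = g z"
    using free_lifting g(1) unfolding E(1) by blast
  let ?w = "\<lambda>z. w z \<ominus>\<^bsub>B\<^esub> g' (d0 z)"
  have w': "?w \<in> mod_hom R E0 B"
    by (rule mod_hom_minus[OF E(2) B w mod_hom_comp[OF E(2,4) g'(1)]])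
  have "p (?w z) = \<zero>\<^bsub>D\<^esub>" if z: "z \<in> carrier E0" for z
    using mod_hom_D(1)[OF w z] mod_hom_D(1)[OF g'(1) d0[OF z]] mod_hom_D(1)[OF g(1) d0[OF z]]
    by (simp add: mod_hom_diff[OF B D p] g(2)[OF z] g'(2)[OF d0[OF z]] D.M.minus_eq D.M.r_neg)
  note wK = into_K[OF w' this]
  have "?w (d1 z) = w (d1 z)" if z: "z \<in> carrier E1" for z
    using mod_hom_D(1)[OF w d1[OF z]] by (simp add: dd[OF z] mod_hom_0[OF E' B g'(1)] B.M.minus_eq)
  then show thesis using wK that by blast
qed

text \<open>A solution with values in \<open>B\<close> exists by \<open>exB\<close>. It can be moved
  into \<open>K\<close> while its values on the image of \<open>d1\<close>, the only ones that
  count, stay the same.\<close>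

lemma hom_exact_kernel:
  fixes E1 E0 :: "('r, 'e \<Rightarrow> 'r) module"
  assumes E: "E' = free_module R X" "Module.module R E0" "Module.module R E1"
      "d0 \<in> mod_hom R E0 E'" "d1 \<in> mod_hom R E1 E0"
    and dd: "\<And>z. z \<in> carrier E1 \<Longrightarrow> d0 (d1 z) = \<zero>\<^bsub>E'\<^esub>"
    and exD: "hom_exact R E1 d1 E0 d0 E' D"
    and exB: "hom_exact R E2 d2 E1 d1 E0 B"
  shows "hom_exact R E2 d2 E1 d1 E0 (B\<lparr>carrier := K\<rparr>)"
proof (rule hom_exactI)
  fix f assume fK: "f \<in> mod_hom R E1 (B\<lparr>carrier := K\<rparr>)"
    and 0: "\<And>z. z \<in> carrier E2 \<Longrightarrow> f (d2 z) = \<zero>\<^bsub>B\<lparr>carrier := K\<rparr>\<^esub>"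
  note f = from_K[OF fK]
  from exB f(1) obtain w where w: "w \<in> mod_hom R E0 B" "\<And>z. z \<in> carrier E1 \<Longrightarrow> f z = w (d1 z)"
    by (rule hom_exactE) (use 0 in auto)
  have "p (w (d1 z)) = \<zero>\<^bsub>D\<^esub>" if "z \<in> carrier E1" for z
    using f(2)[OF that] w(2)[OF that] by simp
  then obtain w' where "w' \<in> mod_hom R E0 (B\<lparr>carrier := K\<rparr>)"
    "\<And>z. z \<in> carrier E1 \<Longrightarrow> w' (d1 z) = w (d1 z)"
    using hom_correct_into_K[OF E dd exD w(1)] by blast
  then show "\<exists>g\<in>mod_hom R E0 (B\<lparr>carrier := K\<rparr>). \<forall>z\<in>carrier E1. f z = g (d1 z)"
    using w(2) by (intro bexI[of _ w']) auto
qed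

text \<open>Lift \<open>h a\<close> to \<open>B\<close> on the free cover \<open>E0\<close>. The
  lift composed with \<open>d1\<close> has values in \<open>K\<close>, so a map into
  \<open>K\<close> corrects the lift to one that kills the kernel of \<open>a\<close> and descends
  to \<open>C\<close>. For a resolution the hypothesis \<open>exK\<close> is the vanishing of
  Ext^1(C, K).\<close>

lemma hom_lift_from_cokernel:
  fixes E1 E2 :: "('r, 'e \<Rightarrow> 'r) module"
  assumes E: "E0 = free_module R X" "Module.module R E1" "Module.module R E2"
      "d1 \<in> mod_hom R E1 E0" "d2 \<in> mod_hom R E2 E1"
    and dd: "\<And>z. z \<in> carrier E2 \<Longrightarrow> d1 (d2 z) = \<zero>\<^bsub>E0\<^esub>"
    and C: "Module.module R C" "a \<in> mod_hom R E0 C" "a ` carrier E0 = carrier C"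
    and ker: "{z \<in> carrier E0. a z = \<zero>\<^bsub>C\<^esub>} = d1 ` carrier E1"
    and exK: "hom_exact R E2 d2 E1 d1 E0 (B\<lparr>carrier := K\<rparr>)"
    and h: "h \<in> mod_hom R C D"
  obtains h' where "h' \<in> mod_hom R C B" "\<And>c. c \<in> carrier C \<Longrightarrow> p (h' c) = h c"
proof -
  interpret B: Module.module R B by (rule B)
  interpret D: Module.module R D by (rule D)
  have E0: "Module.module R E0" unfolding E(1) by (rule free_module_is_module[OF B.R.cring_axioms])
  note d1 = mod_hom_D(1)[OF E(4)] and d2 = mod_hom_D(1)[OF E(5)] and a = mod_hom_D(1)[OF C(2)]
  have ad: "a (d1 z) = \<zero>\<^bsub>C\<^esub>" if "z \<in> carrier E1" for z using ker that by blast
  obtain f where f: "f \<in> mod_hom R E0 B" "\<And>z. z \<in> carrier E0 \<Longrightarrow> p (f z) = h (a z)"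
    using free_lifting mod_hom_comp[OF E0 C(2) h] unfolding E(1) by blast
  have fd: "(\<lambda>z. f (d1 z)) \<in> mod_hom R E1 (B\<lparr>carrier := K\<rparr>)"
    by (rule into_K[OF mod_hom_comp[OF E(2,4) f(1)]]) (simp add: f(2)[OF d1] ad mod_hom_0[OF C(1) D h])
  have van: "f (d1 (d2 z)) = \<zero>\<^bsub>B\<lparr>carrier := K\<rparr>\<^esub>" if "z \<in> carrier E2" for z
    by (simp add: dd[OF that] mod_hom_0[OF E0 B f(1)])
  obtain g where g: "g \<in> mod_hom R E0 (B\<lparr>carrier := K\<rparr>)"
    "\<And>z. z \<in> carrier E1 \<Longrightarrow> f (d1 z) = g (d1 z)"
    by (rule hom_exactE[of _ _ _ _ _ _ _ "\<lambda>z. f (d1 z)", OF exK fd van]) (assumption, erule that, simp)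
  note g' = from_K[OF g(1)]
  let ?f = "\<lambda>z. f z \<ominus>\<^bsub>B\<^esub> g z"
  have fh: "?f \<in> mod_hom R E0 B" by (rule mod_hom_minus[OF E0 B f(1) g'(1)])
  have "?f z = \<zero>\<^bsub>B\<^esub>" if "z \<in> carrier E0" "a z = \<zero>\<^bsub>C\<^esub>" for z
  proof -
    have "z \<in> d1 ` carrier E1" unfolding ker[symmetric] using that by simp
    then obtain y where "y \<in> carrier E1" "z = d1 y" by (elim imageE)
    then show ?thesis using mod_hom_D(1)[OF g'(1) d1] g(2) by (simp add: B.M.minus_eq B.M.r_neg)
  qed
  from mod_hom_factor[OF E0 C(1) B C(2,3) fh this] obtain h'
    where h': "h' \<in> mod_hom R C B" "\<And>z. z \<in> carrier E0 \<Longrightarrow> h' (a z) = ?f z" by blast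
  have "p (h' c) = h c" if "c \<in> carrier C" for c
  proof -
    have "c \<in> a ` carrier E0" unfolding C(3) by (rule that)
    then obtain z where z: "z \<in> carrier E0" "c = a z" by (elim imageE)
    then show ?thesis using mod_hom_D(1)[OF f(1)] mod_hom_D(1)[OF g'(1)] mod_hom_D(1)[OF h a]
      by (simp add: h'(2) mod_hom_diff[OF B D p] f(2) g'(2) D.M.minus_eq)
  qed
  then show thesis using h'(1) that by blast
qed

end

section \<open>A resolution by finite free modules\<close>

lemma free_module_simps:
  "\<zero>\<^bsub>free_module R X\<^esub> = (\<lambda>x. \<zero>\<^bsub>R\<^esub>)"
  "z \<oplus>\<^bsub>free_module R X\<^esub> w = (\<lambda>x. z x \<oplus>\<^bsub>R\<^esub> w x)"
  "r \<odot>\<^bsub>free_module R X\<^esub> z = (\<lambda>x. r \<otimes>\<^bsub>R\<^esub> z x)"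
  by (simp_all add: free_module_def)

lemma free_module_mono:
  assumes R: "cring R" and sub: "X \<subseteq> X'"
  shows "carrier (free_module R X) \<subseteq> carrier (free_module R X')"
proof
  fix z assume z: "z \<in> carrier (free_module R X)"
  have "\<forall>x. x \<notin> X' \<longrightarrow> z x = \<zero>\<^bsub>R\<^esub>" "finite {x. z x \<noteq> \<zero>\<^bsub>R\<^esub>}"
    using z sub by (auto simp: free_module_def)
  then show "z \<in> carrier (free_module R X')"
    using free_module_mem[OF z R] by (simp add: free_module_def)
qed

lemma free_module_update:
  "(free_module R X')\<lparr>carrier := carrier (free_module R X)\<rparr> = free_module R X"
  by (simp add: free_module_def)

lemma free_module_uminus:
  assumes "cring R" "z \<in> carrier (free_module R X)"
  shows "\<ominus>\<^bsub>free_module R X\<^esub> z = (\<lambda>x. \<ominus>\<^bsub>R\<^esub> z x)"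
proof -
  interpret F: Module.module R "free_module R X" by (rule free_module_is_module[OF assms(1)])
  have "\<ominus>\<^bsub>free_module R X\<^esub> z = (\<ominus>\<^bsub>R\<^esub> \<one>\<^bsub>R\<^esub>) \<odot>\<^bsub>free_module R X\<^esub> z"
    using assms(2) by (simp add: F.smult_l_minus)
  also have "\<dots> = (\<lambda>x. \<ominus>\<^bsub>R\<^esub> z x)"
    by (auto simp: free_module_simps F.R.l_minus free_module_mem[OF assms(2,1)])
  finally show ?thesis .
qed

lemma free_module_diff:
  assumes "cring R" "z \<in> carrier (free_module R X)" "w \<in> carrier (free_module R X)"
  shows "(z \<ominus>\<^bsub>free_module R X\<^esub> w) x = z x \<ominus>\<^bsub>R\<^esub> w x"
  by (simp add: a_minus_def free_module_uminus[OF assms(1,3)] free_module_simps)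

section \<open>Finite generation of submodules over a Noetherian ring\<close>

lemma submodule_eval_ideal:
  assumes R: "cring R" and K: "submodule K R (free_module R X)"
  shows "ideal ((\<lambda>z. z y) ` K) R"
proof -
  interpret cring R by fact
  interpret F: Module.module R "free_module R X" by (rule free_module_is_module[OF R])
  note E = F.submoduleE[OF K]
  have c: "z x \<in> carrier R" if "z \<in> K" for z x
    by (rule free_module_mem[OF subsetD[OF E(1) that] R])
  have sm: "r \<otimes>\<^bsub>R\<^esub> z y \<in> (\<lambda>z. z y) ` K" if "r \<in> carrier R" "z \<in> K" for r z
    by (rule image_eqI[OF _ E(4)[OF that]]) (simp add: free_module_simps)
  show ?thesis
  proof (rule idealI)
    show "subgroup ((\<lambda>z. z y) ` K) (add_monoid R)"
    proof (rule add.subgroupI)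
      show "(\<lambda>z. z y) ` K \<noteq> {}" using submodule_zero[OF K] by (simp add: image_is_empty) blast
      show "\<ominus>\<^bsub>R\<^esub> a \<in> (\<lambda>z. z y) ` K" if a: "a \<in> (\<lambda>z. z y) ` K" for a
      proof -
        obtain z where "z \<in> K" "a = z y" using a by (elim imageE)
        then show ?thesis using sm[of "\<ominus>\<^bsub>R\<^esub> \<one>\<^bsub>R\<^esub>" z] c by (simp add: l_minus)
      qed
      show "a \<oplus>\<^bsub>R\<^esub> b \<in> (\<lambda>z. z y) ` K" if a: "a \<in> (\<lambda>z. z y) ` K" and b: "b \<in> (\<lambda>z. z y) ` K" for a b
      proof -
        obtain z where z: "z \<in> K" "a = z y" using a by (elim imageE)
        obtain w where w: "w \<in> K" "b = w y" using b by (elim imageE)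
        show ?thesis by (rule image_eqI[OF _ E(5)[OF z(1) w(1)]]) (simp add: free_module_simps z w)
      qed
    qed (use c in auto)
  next
    fix a r assume ar: "a \<in> (\<lambda>z. z y) ` K" "r \<in> carrier R"
    then show "r \<otimes>\<^bsub>R\<^esub> a \<in> (\<lambda>z. z y) ` K" by (elim imageE) (simp add: sm)
    then show "a \<otimes>\<^bsub>R\<^esub> r \<in> (\<lambda>z. z y) ` K" using ar c by (elim imageE) (simp add: m_comm)
  qed (rule ring_axioms)
qed

text \<open>Induction on a finite set that contains all supports: elements with zero coordinate at
  \<open>y\<close> are covered by the induction hypothesis, and the coordinates at \<open>y\<close>
  form a finitely generated ideal. The ambient free module stays fixed, so nothing has to be
  embedded or restricted when \<open>y\<close> is dropped.\<close>

lemma noetherian_submodule_finite_span: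
  assumes R: "cring R" "noetherian_ring R" and "finite Y"
    and "submodule H R (free_module R X)" "\<And>z x. z \<in> H \<Longrightarrow> z x \<noteq> \<zero>\<^bsub>R\<^esub> \<Longrightarrow> x \<in> Y"
  shows "\<exists>S. finite S \<and> S \<subseteq> H \<and> mod_span R (free_module R X) S = H"
  using assms(3-)
proof (induction Y arbitrary: H rule: finite_induct)
  let ?F = "free_module R X"
  have F: "Module.module R ?F" by (rule free_module_is_module[OF R(1)])
  case empty
  then have "H = {\<zero>\<^bsub>?F\<^esub>}"
    using submodule_zero[OF empty(1)] by (auto simp: free_module_simps fun_eq_iff)
  moreover have "mod_span R ?F {} \<subseteq> H" by (rule mod_span_minimal[OF empty(1)]) simp
  moreover have "\<zero>\<^bsub>?F\<^esub> \<in> mod_span R ?F {}" by (rule submodule_zero[OF mod_span_submodule[OF F]]) simp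
  ultimately show ?case by (intro exI[of _ "{}"]) auto
next
  case (insert y Y)
  let ?F = "free_module R X"
  have F: "Module.module R ?F" by (rule free_module_is_module[OF R(1)])
  interpret R: cring R by fact
  interpret F: Module.module R ?F by (rule F)
  note H = insert.prems(1)
  have Hc: "H \<subseteq> carrier ?F" by (rule submodule_subset[OF H])
  note HE = F.submoduleE[OF H]
  let ?H0 = "{z \<in> H. z y = \<zero>\<^bsub>R\<^esub>}"
  have "submodule ?H0 R ?F"
  proof (rule F.submoduleI)
    show "\<ominus>\<^bsub>?F\<^esub> z \<in> ?H0" if "z \<in> ?H0" for z
      using that HE(3) Hc by (auto simp: free_module_uminus[OF R(1)] subset_iff)
  qed (use HE submodule_zero[OF H] in \<open>auto simp: free_module_simps\<close>)
  then have "\<exists>S. finite S \<and> S \<subseteq> ?H0 \<and> mod_span R ?F S = ?H0"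
    using insert.prems(2) by (intro insert.IH) auto
  then obtain S0 where S0: "finite S0" "S0 \<subseteq> ?H0" "mod_span R ?F S0 = ?H0" by blast
  obtain A where A: "A \<subseteq> carrier R" "finite A" "(\<lambda>z. z y) ` H = genideal R A"
    using noetherian_ring.finetely_gen[OF R(2) submodule_eval_ideal[OF R(1) H]] by meson
  have "A \<subseteq> (\<lambda>z. z y) ` H" unfolding A(3) by (rule R.genideal_self[OF A(1)])
  then have "\<forall>a\<in>A. \<exists>z\<in>H. z y = a" by auto
  then obtain h where h: "\<And>a. a \<in> A \<Longrightarrow> h a \<in> H \<and> h a y = a" by metis
  let ?S = "S0 \<union> h ` A"
  have S: "finite ?S" "?S \<subseteq> H" using S0 A(2) h by auto
  let ?P = "mod_span R ?F ?S"
  have P: "submodule ?P R ?F" by (rule mod_span_submodule[OF F]) (use S Hc in auto)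
  note PE = F.submoduleE[OF P]
  have "A \<subseteq> (\<lambda>z. z y) ` ?P"
  proof
    fix a assume "a \<in> A"
    then have "h a \<in> ?P" "a = h a y" using h mod_span_superset by fastforce+
    then show "a \<in> (\<lambda>z. z y) ` ?P" by blast
  qed
  then have sub: "(\<lambda>z. z y) ` H \<subseteq> (\<lambda>z. z y) ` ?P"
    unfolding A(3) by (rule R.genideal_minimal[OF submodule_eval_ideal[OF R(1) P]])
  have "H \<subseteq> ?P"
  proof
    fix z assume z: "z \<in> H"
    \<comment> \<open>Subtracting an element \<open>w\<close> of the span with the same coordinate
      at \<open>y\<close> leaves an element of \<open>?H0\<close>, which is spanned by
      \<open>S0\<close>.\<close>
    have "z y \<in> (\<lambda>z. z y) ` ?P" using sub imageI[OF z, of "\<lambda>z. z y"] by (rule subsetD)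
    then obtain w where w: "w \<in> ?P" "z y = w y" by (elim imageE)
    have wH: "w \<in> H" using mod_span_minimal[OF H S(2)] w by blast
    have c: "z \<in> carrier ?F" "w \<in> carrier ?F" using z wH Hc by auto
    have "z \<ominus>\<^bsub>?F\<^esub> w \<in> H" unfolding a_minus_def using z wH HE by auto
    moreover have "(z \<ominus>\<^bsub>?F\<^esub> w) y = \<zero>\<^bsub>R\<^esub>"
      using w(2) free_module_mem[OF c(2) R(1)] by (simp add: free_module_diff[OF R(1) c] R.minus_eq R.r_neg)
    ultimately have "z \<ominus>\<^bsub>?F\<^esub> w \<in> mod_span R ?F S0" unfolding S0(3) by simp
    then have "z \<ominus>\<^bsub>?F\<^esub> w \<in> ?P" by (auto simp: mod_span_def)
    then have "(z \<ominus>\<^bsub>?F\<^esub> w) \<oplus>\<^bsub>?F\<^esub> w \<in> ?P" using w by (intro PE(5))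
    then show "z \<in> ?P" using c by (simp add: F.M.minus_eq F.M.a_assoc F.M.l_neg)
  qed
  then have "?P = H" using mod_span_minimal[OF H S(2)] by blast
  then show ?case using S by blast
qed

text \<open>On basis elements in \<open>Y\<close> the preimage is not chosen but prescribed by
  \<open>h0\<close>. With the identity as \<open>h0\<close>, a comparison map becomes a
  retraction.\<close>

lemma free_module_lifting_extend:
  assumes B: "Module.module R B" and D: "Module.module R D"
    and p: "p \<in> mod_hom R B D" "p ` carrier B = carrier D"
    and f: "f \<in> mod_hom R (free_module R X) D" and "Y \<subseteq> X"
    and h0: "h0 \<in> mod_hom R (free_module R Y) B"
      "\<And>z. z \<in> carrier (free_module R Y) \<Longrightarrow> p (h0 z) = f z"
  shows "\<exists>h\<in>mod_hom R (free_module R X) B. (\<forall>z\<in>carrier (free_module R X). p (h z) = f z) \<and>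
    (\<forall>z\<in>carrier (free_module R Y). h z = h0 z)"
proof -
  have R: "cring R" by (rule module_cring[OF B])
  have "\<exists>b\<in>carrier B. p b = f (free_gen R x) \<and> (x \<in> Y \<longrightarrow> b = h0 (free_gen R x))" if "x \<in> X" for x
  proof (cases "x \<in> Y")
    case True
    then show ?thesis using h0(2)[OF free_gen_closed[OF R True]] mod_hom_D(1)[OF h0(1) free_gen_closed[OF R True]] by auto
  next
    case False
    have "f (free_gen R x) \<in> p ` carrier B" unfolding p(2)
      by (rule mod_hom_D(1)[OF f free_gen_closed[OF R that]])
    then show ?thesis using False by auto
  qed
  then obtain b where b: "\<And>x. x \<in> X \<Longrightarrow> b x \<in> carrier B \<and> p (b x) = f (free_gen R x)"
    "\<And>x. x \<in> X \<Longrightarrow> x \<in> Y \<Longrightarrow> b x = h0 (free_gen R x)" by metis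
  then have b': "b \<in> X \<rightarrow> carrier B" by simp
  note h = lin_ext_hom[OF B b']
  have hY: "lin_ext R B b \<in> mod_hom R (free_module R Y) B"
    using mod_hom_domain_sub[OF h free_module_mono[OF R \<open>Y \<subseteq> X\<close>]] by (simp add: free_module_update)
  have "p (lin_ext R B b z) = f z" if "z \<in> carrier (free_module R X)" for z
    by (rule mod_hom_free_eq[OF D mod_hom_comp[OF free_module_is_module[OF R] h p(1)] f _ that])
      (use b in \<open>simp add: lin_ext_free_gen(2)[OF B b']\<close>)
  moreover have "lin_ext R B b z = h0 z" if "z \<in> carrier (free_module R Y)" for z
    by (rule mod_hom_free_eq[OF B hY h0(1) _ that])
      (use b \<open>Y \<subseteq> X\<close> in \<open>auto simp: lin_ext_free_gen(2)[OF B b']\<close>)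
  ultimately show ?thesis using h by blast
qed

text \<open>
  A subresolution \<open>free_module R (Y n)\<close> by finite free modules of the canonical resolution,
  together with a chain retraction \<open>\<psi>\<close> onto it.
\<close>

locale finite_resolution =
  fixes R :: "('r, 'k) ring_scheme" and C :: "('r, 'c) module"
    and Y :: "nat \<Rightarrow> ('r, 'c) res_gen set"
    and \<psi> :: "nat \<Rightarrow> (('r, 'c) res_gen \<Rightarrow> 'r) \<Rightarrow> ('r, 'c) res_gen \<Rightarrow> 'r"
  assumes C: "Module.module R C"
    and finite_Y: "finite (Y n)"
    and Y_subset: "Y n \<subseteq> res_basis R C n"
    and aug_surj: "res_aug R C ` carrier (free_module R (Y 0)) = carrier C"
    and aug_ker: "{z \<in> carrier (free_module R (Y 0)). res_aug R C z = \<zero>\<^bsub>C\<^esub>} =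
      res_diff R ` carrier (free_module R (Y (Suc 0)))"
    and diff_hom: "res_diff R \<in> mod_hom R (free_module R (Y (Suc n))) (free_module R (Y n))"
    and diff_ker: "{z \<in> carrier (free_module R (Y (Suc n))). res_diff R z = (\<lambda>_. \<zero>\<^bsub>R\<^esub>)} =
      res_diff R ` carrier (free_module R (Y (Suc (Suc n))))"
    and retr_hom: "\<psi> n \<in> mod_hom R (free_module R (res_basis R C n)) (free_module R (Y n))"
    and retr_id: "z \<in> carrier (free_module R (Y n)) \<Longrightarrow> \<psi> n z = z"
    and retr_diff: "z \<in> carrier (free_module R (res_basis R C (Suc n))) \<Longrightarrow>
      res_diff R (\<psi> (Suc n) z) = \<psi> n (res_diff R z)"

text \<open>The bases consist of codes of finitely many kernel generators, hence they are subsets of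
  the canonical bases, and the canonical augmentation and differential can be reused.
  \<open>K n Y\<close> is the kernel that the next basis has to generate.\<close>

lemma ex_finite_subresolution:
  fixes R :: "('r, 'k) ring_scheme" and C :: "('r, 'c) module"
  assumes R: "cring R" "noetherian_ring R" and C: "Module.module R C" "fin_gen R C"
  defines "K \<equiv> (\<lambda>n Y. {z \<in> carrier (free_module R Y). case n of 0 \<Rightarrow> res_aug R C z = \<zero>\<^bsub>C\<^esub>
    | Suc m \<Rightarrow> res_diff R z = (\<lambda>_. \<zero>\<^bsub>R\<^esub>)})"
  shows "\<exists>Y :: nat \<Rightarrow> ('r, 'c) res_gen set. \<forall>n. finite (Y n) \<and> Y n \<subseteq> res_basis R C n \<and>
    res_diff R \<in> mod_hom R (free_module R (Y (Suc n))) (free_module R (Y n)) \<and>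
    res_diff R ` carrier (free_module R (Y (Suc n))) = K n (Y n) \<and>
    res_aug R C ` carrier (free_module R (Y 0)) = carrier C"
proof -
  let ?U = "free_module R (UNIV :: ('r, 'c) res_gen set)"
  have U: "Module.module R ?U" by (rule free_module_is_module[OF R(1)])
  have FX: "Module.module R (free_module R X)" for X :: "('r, 'c) res_gen set"
    by (rule free_module_is_module[OF R(1)])
  \<comment> \<open>The submodule clause feeds the Noetherian argument of the next step; the
    surjectivity clause concerns degree 0 only.\<close>
  define P where "P n Y \<longleftrightarrow> finite Y \<and> Y \<subseteq> res_basis R C n \<and> submodule (K n Y) R (free_module R Y) \<and>
    (n = 0 \<longrightarrow> res_aug R C ` carrier (free_module R Y) = carrier C)" for n and Y :: "('r, 'c) res_gen set"
  define Q where "Q n Y Y' \<longleftrightarrow> res_diff R \<in> mod_hom R (free_module R Y') (free_module R Y) \<and>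
    res_diff R ` carrier (free_module R Y') = K n Y" for n and Y Y' :: "('r, 'c) res_gen set"
  have start: "\<exists>Y. P 0 Y"
  proof -
    obtain S where S: "finite S" "S \<subseteq> carrier C" "mod_span R C S = carrier C"
      using C(2) by (auto simp: fin_gen_def)
    let ?Y = "Gen ` S :: ('r, 'c) res_gen set"
    have sub: "?Y \<subseteq> res_basis R C 0" using S(2) by auto
    have hom: "res_aug R C \<in> mod_hom R (free_module R ?Y) C"
      using mod_hom_domain_sub[OF mod_hom_res_aug[OF C(1)] free_module_mono[OF R(1) sub]]
      by (simp add: free_module_update)
    have im: "submodule (res_aug R C ` carrier (free_module R ?Y)) R C"
      by (rule submodule_im[OF FX C(1) hom])
    have "S \<subseteq> res_aug R C ` carrier (free_module R ?Y)"
    proof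
      fix s assume s: "s \<in> S"
      have g: "res_aug R C (free_gen R (Gen s)) = s"
        unfolding res_aug_def by (subst lin_ext_free_gen(2)[OF C(1), of _ ?Y]) (use s S(2) in auto)
      show "s \<in> res_aug R C ` carrier (free_module R ?Y)"
        by (rule rev_image_eqI[OF free_gen_closed[OF R(1), of "Gen s" ?Y]]) (simp_all add: g s)
    qed
    from mod_span_minimal[OF im this] have "res_aug R C ` carrier (free_module R ?Y) = carrier C"
      using submodule_subset[OF im] unfolding S(3) by blast
    moreover have "submodule (K 0 ?Y) R (free_module R ?Y)"
      unfolding K_def using submodule_ker[OF FX C(1) hom] by simp
    ultimately show ?thesis unfolding P_def using S(1) sub by blast
  qed
  have step: "\<exists>Y'. P (Suc n) Y' \<and> Q n Y Y'" if P: "P n Y" for n Y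
  proof -
    have Y: "finite Y" "Y \<subseteq> res_basis R C n" "submodule (K n Y) R (free_module R Y)"
      using P by (auto simp: P_def)
    have supp: "x \<in> Y" if "z \<in> K n Y" "z x \<noteq> \<zero>\<^bsub>R\<^esub>" for z x
      using that by (auto simp: K_def free_module_def)
    have "\<exists>S. finite S \<and> S \<subseteq> K n Y \<and> mod_span R (free_module R Y) S = K n Y"
      by (rule noetherian_submodule_finite_span[OF R Y(1,3)]) (rule supp)
    then obtain S where S: "finite S" "S \<subseteq> K n Y" "mod_span R (free_module R Y) S = K n Y"
      by (elim exE conjE)
    let ?Y = "res_code R ` S"
    \<comment> \<open>The kernel over the smaller basis lies in the kernel over the full one, so
      codes of its elements belong to the next canonical basis.\<close>
    have "K n Y \<subseteq> K n (res_basis R C n)"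
      unfolding K_def using subsetD[OF free_module_mono[OF R(1) Y(2)]] by (intro Collect_mono) simp
    then have "res_code R ` S \<subseteq> res_code R ` K n (res_basis R C n)" using S(2) by (intro image_mono) simp
    then have sub: "?Y \<subseteq> res_basis R C (Suc n)" by (simp add: K_def)
    have dec: "res_decode R (res_code R z) = z" if "z \<in> S" for z
      using that S(2) by (intro res_decode_code) (auto simp: K_def free_module_def)
    have KY: "K n Y \<subseteq> carrier (free_module R Y)" by (auto simp: K_def)
    have b: "res_decode R \<in> ?Y \<rightarrow> K n Y" using dec S(2) by auto
    have YU: "carrier (free_module R Y) \<subseteq> carrier ?U" by (rule free_module_mono[OF R(1)]) simp
    have bU: "res_decode R \<in> ?Y \<rightarrow> carrier ?U" using b KY YU by auto
    \<comment> \<open>The differential is a linear extension formed in the free module on all trees,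
      so the kernel has to be viewed as a submodule there.\<close>
    have KU: "submodule (K n Y) R ?U"
    proof -
      interpret U: Module.module R ?U by (rule U)
      have "Module.module R ((free_module R Y)\<lparr>carrier := K n Y\<rparr>)"
        by (rule submodule_module[OF FX Y(3)])
      then have "Module.module R (?U\<lparr>carrier := K n Y\<rparr>)" by (simp add: free_module_def)
      then show ?thesis using KY YU by (intro U.module_incl_imp_submodule) auto
    qed
    have homU: "res_diff R \<in> mod_hom R (free_module R ?Y) ?U"
      unfolding res_diff_def by (rule lin_ext_hom[OF U bU])
    have in_K: "res_diff R z \<in> K n Y" if "z \<in> carrier (free_module R ?Y)" for z
      unfolding res_diff_def by (rule lin_ext_in_submodule[OF U KU b that])
    have hom: "res_diff R \<in> mod_hom R (free_module R ?Y) (free_module R Y)"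
      using mod_hom_codomain_sub[OF homU, of "carrier (free_module R Y)"] in_K KY
      by (auto simp: free_module_update)
    have im: "submodule (res_diff R ` carrier (free_module R ?Y)) R (free_module R Y)"
      by (rule submodule_im[OF FX FX hom])
    have "S \<subseteq> res_diff R ` carrier (free_module R ?Y)"
    proof
      fix s assume s: "s \<in> S"
      then have y: "res_code R s \<in> ?Y" by blast
      have g: "res_diff R (free_gen R (res_code R s)) = s"
        unfolding res_diff_def using lin_ext_free_gen(2)[OF U bU y] dec[OF s] by simp
      show "s \<in> res_diff R ` carrier (free_module R ?Y)"
        by (rule rev_image_eqI[OF free_gen_closed[OF R(1) y]]) (simp add: g)
    qed
    from mod_span_minimal[OF im this] have imK: "res_diff R ` carrier (free_module R ?Y) = K n Y"
      using in_K unfolding S(3) by blast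
    have "submodule (K (Suc n) ?Y) R (free_module R ?Y)"
      unfolding K_def using submodule_ker[OF FX FX hom] by (simp add: free_module_simps)
    then show ?thesis using imK hom S(1) sub unfolding P_def Q_def by blast
  qed
  obtain Y where "\<And>n. P n (Y n)" "\<And>n. Q n (Y n) (Y (Suc n))"
    using dependent_nat_choice[of P Q, OF start step] by blast
  then show ?thesis unfolding P_def Q_def by (intro exI[of _ Y]) blast
qed

lemma res_diff_hom:
  fixes R :: "('r, 'k) ring_scheme" and C :: "('r, 'c) module"
  assumes "Module.module R C"
  shows "res_diff R \<in> mod_hom R (free_module R (res_basis R C (Suc n))) (free_module R (res_basis R C n))"
  using res_exact[OF assms, of "Suc n"] by simp

text \<open>The comparison theorem for resolutions, lifting degree by degree from the canonical free
  modules to the exact finite subresolution, with the lift prescribed to be the identity on the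
  latter.\<close>

lemma ex_finite_resolution:
  fixes R :: "('r, 'k) ring_scheme" and C :: "('r, 'c) module"
  assumes R: "cring R" "noetherian_ring R" and C: "Module.module R C" "fin_gen R C"
  shows "\<exists>Y \<psi>. finite_resolution R C Y \<psi>"
proof -
  define K where "K = (\<lambda>n Y. {z \<in> carrier (free_module R Y). case n of 0 \<Rightarrow> res_aug R C z = \<zero>\<^bsub>C\<^esub>
    | Suc m \<Rightarrow> res_diff R z = (\<lambda>_. \<zero>\<^bsub>R\<^esub>)})"
  have "\<exists>Y. \<forall>n. finite (Y n) \<and> Y n \<subseteq> res_basis R C n \<and>
    res_diff R \<in> mod_hom R (free_module R (Y (Suc n))) (free_module R (Y n)) \<and>
    res_diff R ` carrier (free_module R (Y (Suc n))) = K n (Y n) \<and>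
    res_aug R C ` carrier (free_module R (Y 0)) = carrier C"
    unfolding K_def by (rule ex_finite_subresolution[OF assms])
  then obtain Y where "\<forall>n. finite (Y n) \<and> Y n \<subseteq> res_basis R C n \<and>
    res_diff R \<in> mod_hom R (free_module R (Y (Suc n))) (free_module R (Y n)) \<and>
    res_diff R ` carrier (free_module R (Y (Suc n))) = K n (Y n) \<and>
    res_aug R C ` carrier (free_module R (Y 0)) = carrier C" ..
  then have Y: "finite (Y n)" "Y n \<subseteq> res_basis R C n"
    "res_diff R \<in> mod_hom R (free_module R (Y (Suc n))) (free_module R (Y n))"
    "res_diff R ` carrier (free_module R (Y (Suc n))) = K n (Y n)"
    "res_aug R C ` carrier (free_module R (Y 0)) = carrier C" for n
    by simp_all
  let ?G = "\<lambda>n. free_module R (Y n)" and ?F = "\<lambda>n. free_module R (res_basis R C n)"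
  let ?d = "res_diff R"
  have mG: "Module.module R (?G n)" and mF: "Module.module R (?F n)" for n
    by (rule free_module_is_module[OF R(1)])+
  have dF: "?d ` carrier (?F (Suc n)) = K n (res_basis R C n)" for n
    using res_exact[OF C(1), of n] by (simp add: K_def del: res_basis.simps)
  have hF: "?d \<in> mod_hom R (?F (Suc n)) (?F n)" for n by (rule res_diff_hom[OF C(1)])
  have augG: "res_aug R C \<in> mod_hom R (?G 0) C"
    using mod_hom_domain_sub[OF mod_hom_res_aug[OF C(1)] free_module_mono[OF R(1) Y(2)]]
    by (simp add: free_module_update del: res_basis.simps)
  have KG: "submodule (K n (Y n)) R (?G n)" for n
    unfolding Y(4)[symmetric] by (rule submodule_im[OF mG mG Y(3)])
  \<comment> \<open>The last clause, that kernels go to kernels, makes the next lift possible: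
    \<open>f\<close> applied to a boundary must lie in the image of the next differential.\<close>
  define P where "P n f \<longleftrightarrow> f \<in> mod_hom R (?F n) (?G n) \<and> (\<forall>z\<in>carrier (?G n). f z = z) \<and>
    (\<forall>z\<in>K n (res_basis R C n). f z \<in> K n (Y n))"
    for n and f :: "(('r, 'c) res_gen \<Rightarrow> 'r) \<Rightarrow> ('r, 'c) res_gen \<Rightarrow> 'r"
  define Q where "Q n f f' \<longleftrightarrow> (\<forall>z\<in>carrier (?F (Suc n)). ?d (f' z) = f (?d z))"
    for n and f f' :: "(('r, 'c) res_gen \<Rightarrow> 'r) \<Rightarrow> ('r, 'c) res_gen \<Rightarrow> 'r"
  have start: "\<exists>f. P 0 f"
  proof -
    obtain f where f: "f \<in> mod_hom R (?F 0) (?G 0)" "\<And>z. z \<in> carrier (?F 0) \<Longrightarrow> res_aug R C (f z) = res_aug R C z"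
      "\<And>z. z \<in> carrier (?G 0) \<Longrightarrow> f z = z"
      using free_module_lifting_extend[OF mG C(1) augG Y(5) mod_hom_res_aug[OF C(1)] Y(2) mod_hom_id refl]
      by blast
    have "f z \<in> K 0 (Y 0)" if "z \<in> K 0 (res_basis R C 0)" for z
      using that f(2) mod_hom_D(1)[OF f(1)] by (simp add: K_def del: res_basis.simps)
    then show ?thesis using f unfolding P_def by blast
  qed
  have step: "\<exists>f'. P (Suc n) f' \<and> Q n f f'" if P: "P n f" for n f
  proof -
    have f: "f \<in> mod_hom R (?F n) (?G n)" "\<And>z. z \<in> carrier (?G n) \<Longrightarrow> f z = z"
      "\<And>z. z \<in> K n (res_basis R C n) \<Longrightarrow> f z \<in> K n (Y n)"
      using P by (auto simp: P_def)
    let ?D = "(?G n)\<lparr>carrier := K n (Y n)\<rparr>"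
    have D: "Module.module R ?D" by (rule submodule_module[OF mG KG])
    have d: "?d \<in> mod_hom R (?G (Suc n)) ?D"
      by (rule mod_hom_codomain_sub[OF Y(3)]) (simp add: Y(4)[symmetric])
    have surj: "?d ` carrier (?G (Suc n)) = carrier ?D" by (simp add: Y(4))
    have inK: "f (?d z) \<in> K n (Y n)" if "z \<in> carrier (?F (Suc n))" for z
      using f(3) dF imageI[OF that, of ?d] by simp
    have fd: "(\<lambda>z. f (?d z)) \<in> mod_hom R (?F (Suc n)) ?D"
      by (rule mod_hom_codomain_sub[OF mod_hom_comp[OF mF hF f(1)]]) (rule inK)
    have "?d z = f (?d z)" if "z \<in> carrier (?G (Suc n))" for z
      using f(2)[OF mod_hom_D(1)[OF Y(3) that]] by simp
    from free_module_lifting_extend[OF mG D d surj fd Y(2) mod_hom_id this]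
    obtain f' where f': "f' \<in> mod_hom R (?F (Suc n)) (?G (Suc n))"
      "\<And>z. z \<in> carrier (?F (Suc n)) \<Longrightarrow> ?d (f' z) = f (?d z)"
      "\<And>z. z \<in> carrier (?G (Suc n)) \<Longrightarrow> f' z = z" by blast
    have "f' z \<in> K (Suc n) (Y (Suc n))" if z: "z \<in> K (Suc n) (res_basis R C (Suc n))" for z
    proof -
      have zF: "z \<in> carrier (?F (Suc n))" and dz: "?d z = \<zero>\<^bsub>?F n\<^esub>"
        using z by (simp_all add: K_def free_module_simps del: res_basis.simps)
      have "?d (f' z) = \<zero>\<^bsub>?G n\<^esub>" unfolding f'(2)[OF zF] dz by (rule mod_hom_0[OF mF mG f(1)])
      then show ?thesis using mod_hom_D(1)[OF f'(1) zF] by (simp add: K_def free_module_simps)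
    qed
    then show ?thesis using f' unfolding P_def Q_def by blast
  qed
  obtain \<psi> where \<psi>: "\<And>n. P n (\<psi> n)" "\<And>n. Q n (\<psi> n) (\<psi> (Suc n))"
    using dependent_nat_choice[of P Q, OF start step] by blast
  note P = \<psi>(1)[unfolded P_def] and Q = \<psi>(2)[unfolded Q_def]
  have "finite_resolution R C Y \<psi>"
  proof (rule finite_resolution.intro)
    show "{z \<in> carrier (?G 0). res_aug R C z = \<zero>\<^bsub>C\<^esub>} = ?d ` carrier (?G (Suc 0))"
      unfolding Y(4) by (simp add: K_def)
    show "{z \<in> carrier (?G (Suc n)). ?d z = (\<lambda>_. \<zero>\<^bsub>R\<^esub>)} = ?d ` carrier (?G (Suc (Suc n)))" for n
      unfolding Y(4) by (simp add: K_def)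
    show "\<psi> n \<in> mod_hom R (?F n) (?G n)" for n using P[of n] by blast
    show "\<psi> n z = z" if "z \<in> carrier (?G n)" for n z using P[of n] that by blast
    show "?d (\<psi> (Suc n) z) = \<psi> n (?d z)" if "z \<in> carrier (?F (Suc n))" for n z
      using Q[of n] that by blast
  qed (rule C(1) Y(1) Y(2) Y(3) Y(5))+
  then show ?thesis by blast
qed

section \<open>Double sums, the ring as a module, and the dot product on finite free modules\<close>

lemma (in abelian_monoid) finsum_swap:
  assumes "finite A" "finite B" "\<And>a b. a \<in> A \<Longrightarrow> b \<in> B \<Longrightarrow> f a b \<in> carrier G"
  shows "(\<Oplus>a\<in>A. \<Oplus>b\<in>B. f a b) = (\<Oplus>b\<in>B. \<Oplus>a\<in>A. f a b)"
  using assms(1,3)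
proof (induction A rule: finite_induct)
  case (insert x A)
  have "(\<Oplus>a\<in>insert x A. \<Oplus>b\<in>B. f a b) = (\<Oplus>b\<in>B. f x b) \<oplus> (\<Oplus>b\<in>B. \<Oplus>a\<in>A. f a b)"
    using insert by (subst finsum_insert) (auto intro!: finsum_closed)
  also have "\<dots> = (\<Oplus>b\<in>B. f x b \<oplus> (\<Oplus>a\<in>A. f a b))"
    using insert.prems by (intro finsum_addf[symmetric]) (auto intro!: finsum_closed)
  also have "\<dots> = (\<Oplus>b\<in>B. \<Oplus>a\<in>insert x A. f a b)"
    using insert by (intro finsum_cong') (auto intro!: finsum_closed)
  finally show ?case .
qed simp

lemma ring_as_module_simps:
  "carrier (ring_as_module R) = carrier R" "\<zero>\<^bsub>ring_as_module R\<^esub> = \<zero>\<^bsub>R\<^esub>"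
  "x \<oplus>\<^bsub>ring_as_module R\<^esub> y = x \<oplus>\<^bsub>R\<^esub> y" "r \<odot>\<^bsub>ring_as_module R\<^esub> x = r \<otimes>\<^bsub>R\<^esub> x"
  by (simp_all add: ring_as_module_def)

lemma ring_as_module_module:
  assumes "cring R"
  shows "Module.module R (ring_as_module R)"
proof -
  interpret cring R by fact
  show ?thesis
  proof (rule Module.moduleI)
    show "abelian_group (ring_as_module R)"
      by (rule abelian_groupI) (auto simp: ring_as_module_simps a_ac intro: bexI[of _ "\<ominus>\<^bsub>R\<^esub> _"] l_neg)
  qed (auto simp: ring_as_module_simps l_distr r_distr m_assoc intro: cring_axioms)
qed

lemma mod_hom_smult_const:
  assumes "Module.module R A" "f \<in> mod_hom R E (ring_as_module R)" "a \<in> carrier A"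
  shows "(\<lambda>z. f z \<odot>\<^bsub>A\<^esub> a) \<in> mod_hom R E A"
proof -
  interpret A: Module.module R A by fact
  note f = mod_hom_D[OF assms(2), unfolded ring_as_module_simps]
  show ?thesis using assms(3) by (intro mod_homI) (simp_all add: f A.smult_l_distr A.smult_assoc1)
qed

lemma mod_hom_free_expand:
  assumes A: "Module.module R A" and f: "f \<in> mod_hom R (free_module R X) A" and X: "finite X"
    and z: "z \<in> carrier (free_module R X)"
  shows "f z = (\<Oplus>\<^bsub>A\<^esub>x\<in>X. z x \<odot>\<^bsub>A\<^esub> f (free_gen R x))"
proof -
  have R: "cring R" by (rule module_cring[OF A])
  have b: "(\<lambda>x. f (free_gen R x)) \<in> X \<rightarrow> carrier A"
    using mod_hom_D(1)[OF f free_gen_closed[OF R]] by auto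
  have "f z = lin_ext R A (\<lambda>x. f (free_gen R x)) z"
    by (rule mod_hom_free_eq[OF A f lin_ext_hom[OF A b] _ z]) (simp add: lin_ext_free_gen(2)[OF A b])
  also have "\<dots> = (\<Oplus>\<^bsub>A\<^esub>x\<in>X. z x \<odot>\<^bsub>A\<^esub> f (free_gen R x))"
    by (rule lin_ext_superset[OF A b z X]) (use z in \<open>auto simp: free_module_def\<close>)
  finally show ?thesis .
qed

text \<open>The dot product. On a finite basis it identifies the free module with its dual, so the
  dual of a complex can be formed on the same modules.\<close>

definition free_pairing :: "('r, 'k) ring_scheme \<Rightarrow> ('b \<Rightarrow> 'r) \<Rightarrow> ('b \<Rightarrow> 'r) \<Rightarrow> 'r" where
  "free_pairing R u z = lin_ext R (ring_as_module R) u z"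

lemma
  assumes R: "cring R" and X: "finite X"
  shows free_pairing_comm: "\<And>u z. u \<in> carrier (free_module R X) \<Longrightarrow> z \<in> carrier (free_module R X) \<Longrightarrow>
      free_pairing R u z = free_pairing R z u"
    and free_pairing_hom: "\<And>u. u \<in> carrier (free_module R X) \<Longrightarrow>
      free_pairing R u \<in> mod_hom R (free_module R X) (ring_as_module R)"
    and free_pairing_hom': "\<And>z. z \<in> carrier (free_module R X) \<Longrightarrow>
      (\<lambda>u. free_pairing R u z) \<in> mod_hom R (free_module R X) (ring_as_module R)"
    and free_pairing_gen: "\<And>u x. u \<in> carrier (free_module R X) \<Longrightarrow> x \<in> X \<Longrightarrow>
      free_pairing R u (free_gen R x) = u x"
    and free_pairing_gen': "\<And>u x. u \<in> carrier (free_module R X) \<Longrightarrow> x \<in> X \<Longrightarrow>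
      free_pairing R (free_gen R x) u = u x"
proof -
  let ?F = "free_module R X" and ?M = "ring_as_module R"
  interpret R: cring R by fact
  have M: "Module.module R ?M" by (rule ring_as_module_module[OF R])
  have F: "Module.module R ?F" by (rule free_module_is_module[OF R])
  have b: "u \<in> X \<rightarrow> carrier ?M" if "u \<in> carrier ?F" for u
    using free_module_mem[OF that R] by (simp add: ring_as_module_simps)
  have sum: "free_pairing R u z = (\<Oplus>\<^bsub>?M\<^esub>x\<in>X. z x \<otimes>\<^bsub>R\<^esub> u x)" if "u \<in> carrier ?F" "z \<in> carrier ?F" for u z
    unfolding free_pairing_def using lin_ext_superset[OF M b[OF that(1)] that(2) X] that(2)
    by (auto simp: free_module_def ring_as_module_simps)
  show comm: "free_pairing R u z = free_pairing R z u" if "u \<in> carrier ?F" "z \<in> carrier ?F" for u z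
    unfolding sum[OF that] sum[OF that(2,1)]
    using free_module_mem[OF that(1) R] free_module_mem[OF that(2) R] by (simp add: R.m_comm)
  show hom: "free_pairing R u \<in> mod_hom R ?F ?M" if "u \<in> carrier ?F" for u
    unfolding free_pairing_def[abs_def] using lin_ext_hom[OF M b[OF that]] .
  show "(\<lambda>u. free_pairing R u z) \<in> mod_hom R ?F ?M" if "z \<in> carrier ?F" for z
    by (rule mod_hom_cong[OF F hom[OF that]]) (rule comm[OF _ that])
  show gen: "free_pairing R u (free_gen R x) = u x" if "u \<in> carrier ?F" "x \<in> X" for u x
    unfolding free_pairing_def by (rule lin_ext_free_gen(2)[OF M b[OF that(1)] that(2)])
  show "free_pairing R (free_gen R x) u = u x" if "u \<in> carrier ?F" "x \<in> X" for u x
    using comm[OF free_gen_closed[OF R that(2)] that(1)] gen[OF that] by simp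
qed

section \<open>Vanishing of Ext and Tor in terms of elements\<close>

lemma quot_zeroD:
  assumes "zero_module (quot_module A N)" "x \<in> carrier A" "\<zero>\<^bsub>A\<^esub> \<in> N" "\<zero>\<^bsub>A\<^esub> \<oplus>\<^bsub>A\<^esub> x = x"
  shows "x \<in> N"
proof -
  have "N +>\<^bsub>A\<^esub> x \<in> carrier (quot_module A N)"
    using assms(2) by (auto simp: quot_module_def A_RCOSETS_def')
  then have "N +>\<^bsub>A\<^esub> x = N" using assms(1) by (simp add: zero_module_def) (simp add: quot_module_def)
  moreover have "x \<in> N +>\<^bsub>A\<^esub> x" unfolding a_r_coset_def' using assms(3,4) by force
  ultimately show ?thesis by simp
qed

lemma homology_zeroD:
  assumes "zero_module (homology X i)" "x \<in> carrier (cx_mod X i)" "cx_diff X i x = \<zero>\<^bsub>cx_mod X (i - 1)\<^esub>"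
    and "Module.module R (cx_mod X i)" "Module.module R (cx_mod X (i + 1))"
      "cx_diff X (i + 1) \<in> mod_hom R (cx_mod X (i + 1)) (cx_mod X i)"
  shows "x \<in> cx_diff X (i + 1) ` carrier (cx_mod X (i + 1))"
proof -
  interpret X: Module.module R "cx_mod X i" by fact
  interpret X': Module.module R "cx_mod X (i + 1)" by fact
  have "\<zero>\<^bsub>cx_mod X i\<^esub> \<in> cx_diff X (i + 1) ` carrier (cx_mod X (i + 1))"
    by (rule image_eqI[of _ _ "\<zero>\<^bsub>cx_mod X (i + 1)\<^esub>"]) (simp_all add: mod_hom_0[OF assms(5,4,6)])
  then show ?thesis
    by (rule_tac quot_zeroD[OF assms(1)[unfolded homology_def]]) (simp_all add: assms(2,3))
qed

lemma free_resolution_simps: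
  "cx_mod (free_resolution R A) (int n) = free_module R (res_basis R A n)"
  "cx_diff (free_resolution R A) (int (Suc n)) = res_diff R"
  by (simp_all add: free_resolution_def)

text \<open>Homomorphisms from the n-th free module sit in degree \<open>-n\<close> and are
  extensional functions. The work consists in translating the degrees and in restricting to
  carriers.\<close>

lemma Ext_zeroD:
  assumes A: "Module.module R A" and B: "Module.module R B" and ext: "zero_module (Ext R A B (Suc m))"
  shows "hom_exact R (free_module R (res_basis R A (Suc (Suc m)))) (res_diff R)
    (free_module R (res_basis R A (Suc m))) (res_diff R) (free_module R (res_basis R A m)) B"
proof (rule hom_exactI)
  let ?F = "\<lambda>n. free_module R (res_basis R A n)"
  let ?X = "hom_complex R (free_resolution R A) B" and ?i = "- int (Suc m)"
  have F: "Module.module R (?F n)" for n by (rule free_module_is_module[OF module_cring[OF A]])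
  have e: "1 - ?i = int (Suc (Suc m))" "- (?i - 1) = int (Suc (Suc m))" "- ?i = int (Suc m)"
    "- (?i + 1) = int m" "1 - (?i + 1) = int (Suc m)" by simp_all
  have m: "cx_mod ?X ?i = hom_module R (?F (Suc m)) B" "cx_mod ?X (?i + 1) = hom_module R (?F m) B"
    "cx_mod ?X (?i - 1) = hom_module R (?F (Suc (Suc m))) B"
    unfolding hom_complex_def mod_complex.simps e free_resolution_simps by (rule refl)+
  have d: "cx_diff ?X ?i f = (\<lambda>x\<in>carrier (?F (Suc (Suc m))). f (res_diff R x))"
    "cx_diff ?X (?i + 1) f = (\<lambda>x\<in>carrier (?F (Suc m)). f (res_diff R x))" for f
    unfolding hom_complex_def mod_complex.simps e free_resolution_simps by (rule refl)+
  note dh = res_diff_hom[OF A]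
  fix f assume f: "f \<in> mod_hom R (?F (Suc m)) B"
    and 0: "\<And>z. z \<in> carrier (?F (Suc (Suc m))) \<Longrightarrow> f (res_diff R z) = \<zero>\<^bsub>B\<^esub>"
  let ?f = "restrict f (carrier (?F (Suc m)))"
  have "?f \<in> cx_diff ?X (?i + 1) ` carrier (cx_mod ?X (?i + 1))"
  proof (rule homology_zeroD[where R = R])
    show "zero_module (homology ?X ?i)" using ext unfolding Ext_def .
    show "?f \<in> carrier (cx_mod ?X ?i)" unfolding m by (rule restrict_mod_hom[OF F f])
    show "cx_diff ?X ?i ?f = \<zero>\<^bsub>cx_mod ?X (?i - 1)\<^esub>"
      unfolding m d hom_module_simps using mod_hom_D(1)[OF dh] by (intro restrict_ext) (simp add: 0 del: res_basis.simps)
    show "Module.module R (cx_mod ?X ?i)" "Module.module R (cx_mod ?X (?i + 1))"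
      unfolding m by (rule hom_module_module[OF F B])+
    show "cx_diff ?X (?i + 1) \<in> mod_hom R (cx_mod ?X (?i + 1)) (cx_mod ?X ?i)"
      unfolding m
    proof (rule mod_homI, unfold d)
      fix f assume "f \<in> carrier (hom_module R (?F m) B)"
      then show "(\<lambda>x\<in>carrier (?F (Suc m)). f (res_diff R x)) \<in> carrier (hom_module R (?F (Suc m)) B)"
        by (intro restrict_mod_hom[OF F] mod_hom_comp[OF F dh] hom_module_mod_hom)
    qed (use mod_hom_D(1)[OF dh] in \<open>auto simp: hom_module_simps(3,4) simp del: res_basis.simps intro!: restrict_ext\<close>)
  qed
  then obtain g where g: "g \<in> carrier (hom_module R (?F m) B)"
    "?f = (\<lambda>x\<in>carrier (?F (Suc m)). g (res_diff R x))" unfolding m d by (elim imageE)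
  have "f z = g (res_diff R z)" if "z \<in> carrier (?F (Suc m))" for z
    using fun_cong[OF g(2), of z] that by simp
  then show "\<exists>g\<in>mod_hom R (?F m) B. \<forall>z\<in>carrier (?F (Suc m)). f z = g (res_diff R z)"
    using hom_module_mod_hom[OF g(1)] by blast
qed

lemma Tor_zeroD:
  assumes A: "Module.module R A" and B: "Module.module R B" and tor: "zero_module (Tor R A B (Suc m))"
    and x: "x \<in> carrier (tensor_module R (free_module R (res_basis R A (Suc m))) B)"
    and 0: "tensor_map R (free_module R (res_basis R A m)) B (res_diff R) x =
      \<zero>\<^bsub>tensor_module R (free_module R (res_basis R A m)) B\<^esub>"
  obtains w where "w \<in> carrier (tensor_module R (free_module R (res_basis R A (Suc (Suc m)))) B)"
    "x = tensor_map R (free_module R (res_basis R A (Suc m))) B (res_diff R) w"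
proof -
  let ?F = "\<lambda>n. free_module R (res_basis R A n)"
  let ?X = "tensor_complex R (free_resolution R A) B" and ?i = "int (Suc m)"
  have F: "Module.module R (?F n)" for n
    by (rule free_module_is_module[OF module_cring[OF A]])
  have e: "?i + 1 = int (Suc (Suc m))" "int (Suc n) - 1 = int n" for n by simp_all
  have m: "cx_mod ?X ?i = tensor_module R (?F (Suc m)) B" "cx_mod ?X (?i - 1) = tensor_module R (?F m) B"
    "cx_mod ?X (?i + 1) = tensor_module R (?F (Suc (Suc m))) B"
    unfolding tensor_complex_def mod_complex.simps e free_resolution_simps by (rule refl)+
  have d: "cx_diff ?X ?i = tensor_map R (?F m) B (res_diff R)"
    "cx_diff ?X (?i + 1) = tensor_map R (?F (Suc m)) B (res_diff R)"
    unfolding tensor_complex_def mod_complex.simps e free_resolution_simps tensor_map_def by (rule refl)+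
  note dh = res_diff_hom[OF A]
  have "x \<in> cx_diff ?X (?i + 1) ` carrier (cx_mod ?X (?i + 1))"
  proof (rule homology_zeroD[where R = R])
    show "zero_module (homology ?X ?i)" using tor unfolding Tor_def .
    show "Module.module R (cx_mod ?X ?i)" "Module.module R (cx_mod ?X (?i + 1))"
      unfolding m by (rule tensor_module_module[OF F B])+
    show "cx_diff ?X (?i + 1) \<in> mod_hom R (cx_mod ?X (?i + 1)) (cx_mod ?X ?i)"
      unfolding m d by (rule tensor_map_hom[OF F B F dh])
  qed (use x 0 in \<open>simp_all only: m d\<close>)
  then show thesis unfolding m d by (elim imageE) (rule that)
qed

section \<open>Transfer of Ext and Tor to the finite resolution\<close>

context finite_resolution
begin

abbreviation G :: "nat \<Rightarrow> ('r, ('r, 'c) res_gen \<Rightarrow> 'r) module" where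
  "G n \<equiv> free_module R (Y n)"

abbreviation F :: "nat \<Rightarrow> ('r, ('r, 'c) res_gen \<Rightarrow> 'r) module" where
  "F n \<equiv> free_module R (res_basis R C n)"

abbreviation d :: "(('r, 'c) res_gen \<Rightarrow> 'r) \<Rightarrow> ('r, 'c) res_gen \<Rightarrow> 'r" where
  "d \<equiv> res_diff R"

abbreviation aug :: "(('r, 'c) res_gen \<Rightarrow> 'r) \<Rightarrow> 'c" where
  "aug \<equiv> res_aug R C"

abbreviation M1 :: "('r, 'r) module" where
  "M1 \<equiv> ring_as_module R"

lemma R: "cring R"
  by (rule module_cring[OF C])

lemma G_module: "Module.module R (G n)" and F_module: "Module.module R (F n)"
  by (rule free_module_is_module[OF R])+

lemma M1_module: "Module.module R M1"
  by (rule ring_as_module_module[OF R])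

lemma G_subset_F: "carrier (G n) \<subseteq> carrier (F n)"
  by (rule free_module_mono[OF R Y_subset])

lemma aug_hom: "aug \<in> mod_hom R (G 0) C"
  using mod_hom_domain_sub[OF mod_hom_res_aug[OF C] G_subset_F] by (simp only: free_module_update)

lemma F_diff_hom: "d \<in> mod_hom R (F (Suc n)) (F n)"
  by (rule res_diff_hom[OF C])

lemma diff_diff:
  assumes "z \<in> carrier (G (Suc (Suc n)))"
  shows "d (d z) = \<zero>\<^bsub>G n\<^esub>"
  using imageI[OF assms, of d] unfolding diff_ker[symmetric] by (simp add: free_module_simps)

lemma aug_diff:
  assumes "z \<in> carrier (G (Suc 0))"
  shows "aug (d z) = \<zero>\<^bsub>C\<^esub>"
  using imageI[OF assms, of d] unfolding aug_ker[symmetric] by simp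

lemma gen_closed: "y \<in> Y n \<Longrightarrow> free_gen R y \<in> carrier (G n)"
  by (rule free_gen_closed[OF R])

text \<open>Vanishing of Ext(C, A) in all positive degrees, computed from the finite resolution;
  degree 0 is left out because the middle term is \<open>G (Suc n)\<close>.\<close>

definition ext_acyclic :: "('r, 'a) module \<Rightarrow> bool" where
  "ext_acyclic A \<longleftrightarrow> (\<forall>n. hom_exact R (G (Suc (Suc n))) d (G (Suc n)) d (G n) A)"

text \<open>A cocycle on \<open>G\<close> pulled back along the chain map \<open>\<psi>\<close> is a
  cocycle on \<open>F\<close>, where the hypothesis applies. Restricting the solution to
  \<open>G\<close> loses nothing, as \<open>\<psi>\<close> is the identity there.\<close>

lemma ext_acyclicI:
  assumes A: "Module.module R A" and ext: "\<And>n. n > 0 \<Longrightarrow> zero_module (Ext R C A n)"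
  shows "ext_acyclic A"
  unfolding ext_acyclic_def
proof (intro allI hom_exactI)
  fix n f assume f: "f \<in> mod_hom R (G (Suc n)) A"
    and 0: "\<And>z. z \<in> carrier (G (Suc (Suc n))) \<Longrightarrow> f (d z) = \<zero>\<^bsub>A\<^esub>"
  have ex: "hom_exact R (F (Suc (Suc n))) d (F (Suc n)) d (F n) A"
    by (rule Ext_zeroD[OF C A ext]) simp
  have van: "f (\<psi> (Suc n) (d z)) = \<zero>\<^bsub>A\<^esub>" if "z \<in> carrier (F (Suc (Suc n)))" for z
    using 0[OF mod_hom_D(1)[OF retr_hom that]] unfolding retr_diff[OF that] .
  obtain g where g: "g \<in> mod_hom R (F n) A" "\<And>z. z \<in> carrier (F (Suc n)) \<Longrightarrow> f (\<psi> (Suc n) z) = g (d z)"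
    by (rule hom_exactE[of _ _ _ _ _ _ _ "\<lambda>z. f (\<psi> (Suc n) z)", OF ex mod_hom_comp[OF F_module retr_hom f] van])
      (assumption, erule that, simp)
  have "f z = g (d z)" if "z \<in> carrier (G (Suc n))" for z
    using g(2)[OF subsetD[OF G_subset_F that]] unfolding retr_id[OF that] .
  moreover have "g \<in> mod_hom R (G n) A"
    using mod_hom_domain_sub[OF g(1) G_subset_F] by (simp only: free_module_update)
  ultimately show "\<exists>g\<in>mod_hom R (G n) A. \<forall>z\<in>carrier (G (Suc n)). f z = g (d z)" by blast
qed

lemmas pairing_comm = free_pairing_comm[OF R finite_Y]
lemmas pairing_hom = free_pairing_hom[OF R finite_Y]
lemmas pairing_hom' = free_pairing_hom'[OF R finite_Y]
lemmas pairing_gen = free_pairing_gen[OF R finite_Y]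
lemmas pairing_gen' = free_pairing_gen'[OF R finite_Y]

lemma pairing_closed:
  assumes "u \<in> carrier (G n)" "z \<in> carrier (G n)"
  shows "free_pairing R u z \<in> carrier R"
  using mod_hom_D(1)[OF pairing_hom[OF assms(1)] assms(2)] by (simp add: ring_as_module_simps)

text \<open>The transpose of \<open>d : G (n + 1) \<rightarrow> G n\<close>, the differential of the dual complex \<open>Hom(G, R)\<close>.\<close>

definition dual_diff :: "nat \<Rightarrow> (('r, 'c) res_gen \<Rightarrow> 'r) \<Rightarrow> ('r, 'c) res_gen \<Rightarrow> 'r" where
  "dual_diff n z = (\<lambda>y. if y \<in> Y (Suc n) then free_pairing R z (d (free_gen R y)) else \<zero>\<^bsub>R\<^esub>)"

lemma dual_diff_hom: "dual_diff n \<in> mod_hom R (G n) (G (Suc n))"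
proof (rule mod_homI)
  interpret R: cring R by (rule R)
  have h: "(\<lambda>u. free_pairing R u (d (free_gen R y))) \<in> mod_hom R (G n) M1" if "y \<in> Y (Suc n)" for y
    by (rule pairing_hom'[OF mod_hom_D(1)[OF diff_hom gen_closed[OF that]]])
  note h = mod_hom_D[OF h, unfolded ring_as_module_simps]
  fix z assume z: "z \<in> carrier (G n)"
  show "dual_diff n z \<in> carrier (G (Suc n))"
    using h(1) z finite_subset[OF _ finite_Y, of _ "Suc n"]
    by (auto simp: dual_diff_def free_module_def)
  show "dual_diff n (r \<odot>\<^bsub>G n\<^esub> z) = r \<odot>\<^bsub>G (Suc n)\<^esub> dual_diff n z" if r: "r \<in> carrier R" for r
    unfolding free_module_simps(3)[where X = "Y (Suc n)"] dual_diff_def using r by (auto simp: h(3)[OF _ r z])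
  fix w assume w: "w \<in> carrier (G n)"
  show "dual_diff n (z \<oplus>\<^bsub>G n\<^esub> w) = dual_diff n z \<oplus>\<^bsub>G (Suc n)\<^esub> dual_diff n w"
    unfolding free_module_simps(2)[where X = "Y (Suc n)"] dual_diff_def by (auto simp: h(2)[OF _ z w])
qed

text \<open>Both sides are linear in \<open>w\<close>, and on basis elements the equation is the
  definition of the transpose.\<close>

lemma dual_adjoint:
  assumes z: "z \<in> carrier (G n)" and w: "w \<in> carrier (G (Suc n))"
  shows "free_pairing R z (d w) = free_pairing R (dual_diff n z) w"
proof (rule mod_hom_free_eq[OF M1_module _ _ _ w])
  note dz = mod_hom_D(1)[OF dual_diff_hom z]
  show "(\<lambda>w. free_pairing R z (d w)) \<in> mod_hom R (G (Suc n)) M1"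
    by (rule mod_hom_comp[OF G_module diff_hom pairing_hom[OF z]])
  show "free_pairing R (dual_diff n z) \<in> mod_hom R (G (Suc n)) M1"
    by (rule pairing_hom[OF dz])
  show "free_pairing R z (d (free_gen R y)) = free_pairing R (dual_diff n z) (free_gen R y)" if "y \<in> Y (Suc n)" for y
    unfolding pairing_gen[OF dz that] using that by (simp add: dual_diff_def)
qed

lemma dual_dual:
  assumes z: "z \<in> carrier (G n)"
  shows "dual_diff (Suc n) (dual_diff n z) = \<zero>\<^bsub>G (Suc (Suc n))\<^esub>"
proof -
  have "free_pairing R (dual_diff n z) (d (free_gen R y)) = \<zero>\<^bsub>R\<^esub>" if y: "y \<in> Y (Suc (Suc n))" for y
  proof -
    have "free_pairing R (dual_diff n z) (d (free_gen R y)) = free_pairing R z (d (d (free_gen R y)))"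
      by (rule dual_adjoint[OF z mod_hom_D(1)[OF diff_hom gen_closed[OF y]], symmetric])
    also have "\<dots> = \<zero>\<^bsub>R\<^esub>"
      unfolding diff_diff[OF gen_closed[OF y]]
      using mod_hom_0[OF G_module M1_module pairing_hom[OF z]] by (simp add: ring_as_module_simps)
    finally show ?thesis .
  qed
  then show ?thesis by (auto simp: dual_diff_def[of "Suc n"] free_module_simps)
qed

text \<open>For a finite free module, Hom of its dual into \<open>A\<close> is its tensor product
  with \<open>A\<close>, so this is the vanishing of Tor(C, A) in all positive degrees. The dual
  differential raises degrees, hence the reversed order of the three modules.\<close>

definition tor_acyclic :: "('r, 'a) module \<Rightarrow> bool" where
  "tor_acyclic A \<longleftrightarrow>
     (\<forall>n. hom_exact R (G n) (dual_diff n) (G (Suc n)) (dual_diff (Suc n)) (G (Suc (Suc n))) A)"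

text \<open>The transpose of the basis element at \<open>y\<close> has as its coordinates the row of
  the matrix of \<open>d\<close> that belongs to \<open>y\<close>.\<close>

lemma dual_expand:
  assumes A: "Module.module R A" and w: "w \<in> mod_hom R (G (Suc n)) A" and y: "y \<in> Y n"
  shows "w (dual_diff n (free_gen R y)) =
    (\<Oplus>\<^bsub>A\<^esub>x\<in>Y (Suc n). d (free_gen R x) y \<odot>\<^bsub>A\<^esub> w (free_gen R x))"
proof -
  interpret A: Module.module R A by fact
  have c: "d (free_gen R x) \<in> carrier (G n)" if "x \<in> Y (Suc n)" for x
    by (rule mod_hom_D(1)[OF diff_hom gen_closed[OF that]])
  have e: "dual_diff n (free_gen R y) x = d (free_gen R x) y" if "x \<in> Y (Suc n)" for x
    using pairing_gen'[OF c[OF that] y] that by (simp add: dual_diff_def)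
  show ?thesis
    unfolding mod_hom_free_expand[OF A w finite_Y mod_hom_D(1)[OF dual_diff_hom gen_closed[OF y]]]
    by (rule A.M.finsum_cong') (auto simp: e intro!: A.smult_closed free_module_mem[OF c R] mod_hom_D(1)[OF w gen_closed])
qed

text \<open>Both sides are the double sum over the matrix entries of \<open>d\<close>, taken in opposite orders.\<close>

lemma bilinear_dual_sum:
  assumes A: "Module.module R A" and E: "Module.module R E" and T: "Module.module R T"
    and t: "bilinear_map R A E T t" and w: "w \<in> mod_hom R (G (Suc n)) A"
    and e: "e \<in> mod_hom R (G n) E"
  shows "(\<Oplus>\<^bsub>T\<^esub>y\<in>Y n. t (w (dual_diff n (free_gen R y))) (e (free_gen R y))) =
    (\<Oplus>\<^bsub>T\<^esub>x\<in>Y (Suc n). t (w (free_gen R x)) (e (d (free_gen R x))))"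
proof -
  interpret A: Module.module R A by fact
  interpret E: Module.module R E by fact
  interpret T: Module.module R T by fact
  note t1 = bilinear_mapD(1)[OF t] and t2 = bilinear_mapD(2)[OF t]
  have dc: "d (free_gen R x) \<in> carrier (G n)" if "x \<in> Y (Suc n)" for x
    by (rule mod_hom_D(1)[OF diff_hom gen_closed[OF that]])
  have r: "d (free_gen R x) y \<in> carrier R" if "x \<in> Y (Suc n)" for x y
    by (rule free_module_mem[OF dc[OF that] R])
  have wc: "w (free_gen R x) \<in> carrier A" if "x \<in> Y (Suc n)" for x
    by (rule mod_hom_D(1)[OF w gen_closed[OF that]])
  have ec: "e (free_gen R y) \<in> carrier E" if "y \<in> Y n" for y
    by (rule mod_hom_D(1)[OF e gen_closed[OF that]])
  have tc: "t a b \<in> carrier T" if "a \<in> carrier A" "b \<in> carrier E" for a b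
    by (rule mod_hom_D(1)[OF t2[OF that(1)] that(2)])
  let ?f = "\<lambda>x y. d (free_gen R x) y \<odot>\<^bsub>T\<^esub> t (w (free_gen R x)) (e (free_gen R y))"
  have fc: "?f x y \<in> carrier T" if "x \<in> Y (Suc n)" "y \<in> Y n" for x y
    by (intro T.smult_closed r tc wc ec that)
  have L: "t (w (dual_diff n (free_gen R y))) (e (free_gen R y)) = (\<Oplus>\<^bsub>T\<^esub>x\<in>Y (Suc n). ?f x y)"
    if y: "y \<in> Y n" for y
  proof -
    have "t (w (dual_diff n (free_gen R y))) (e (free_gen R y)) =
      (\<Oplus>\<^bsub>T\<^esub>x\<in>Y (Suc n). t (d (free_gen R x) y \<odot>\<^bsub>A\<^esub> w (free_gen R x)) (e (free_gen R y)))"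
      unfolding dual_expand[OF A w y]
      by (rule mod_hom_sum[OF A T t1[OF ec[OF y]] finite_Y]) (auto intro!: A.smult_closed r wc)
    also have "\<dots> = (\<Oplus>\<^bsub>T\<^esub>x\<in>Y (Suc n). ?f x y)"
      by (rule T.M.finsum_cong') (auto intro!: fc[OF _ y] mod_hom_D(3)[OF t1[OF ec[OF y]] r wc])
    finally show ?thesis .
  qed
  have Rr: "t (w (free_gen R x)) (e (d (free_gen R x))) = (\<Oplus>\<^bsub>T\<^esub>y\<in>Y n. ?f x y)"
    if x: "x \<in> Y (Suc n)" for x
  proof -
    have "t (w (free_gen R x)) (e (d (free_gen R x))) =
      (\<Oplus>\<^bsub>T\<^esub>y\<in>Y n. t (w (free_gen R x)) (d (free_gen R x) y \<odot>\<^bsub>E\<^esub> e (free_gen R y)))"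
      unfolding mod_hom_free_expand[OF E e finite_Y dc[OF x]]
      by (rule mod_hom_sum[OF E T t2[OF wc[OF x]] finite_Y]) (auto intro!: E.smult_closed r[OF x] ec)
    also have "\<dots> = (\<Oplus>\<^bsub>T\<^esub>y\<in>Y n. ?f x y)"
      by (rule T.M.finsum_cong') (auto intro!: fc[OF x] mod_hom_D(3)[OF t2[OF wc[OF x]] r[OF x] ec])
    finally show ?thesis .
  qed
  have "(\<Oplus>\<^bsub>T\<^esub>y\<in>Y n. t (w (dual_diff n (free_gen R y))) (e (free_gen R y))) =
    (\<Oplus>\<^bsub>T\<^esub>y\<in>Y n. \<Oplus>\<^bsub>T\<^esub>x\<in>Y (Suc n). ?f x y)"
    by (rule T.M.finsum_cong') (auto simp: L intro!: T.M.finsum_closed fc)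
  also have "\<dots> = (\<Oplus>\<^bsub>T\<^esub>x\<in>Y (Suc n). \<Oplus>\<^bsub>T\<^esub>y\<in>Y n. ?f x y)"
    by (rule T.M.finsum_swap[OF finite_Y finite_Y]) (rule fc)
  also have "\<dots> = (\<Oplus>\<^bsub>T\<^esub>x\<in>Y (Suc n). t (w (free_gen R x)) (e (d (free_gen R x))))"
    by (rule T.M.finsum_cong') (auto simp: Rr intro!: T.M.finsum_closed fc)
  finally show ?thesis .
qed

text \<open>A homomorphism \<open>f\<close> on a finite free module is the same as the tensor that
  sums e_y \<otimes> f(e_y) over the basis, and vanishing of \<open>f\<close> on the image of the
  dual differential makes this tensor a cycle. A chain that bounds it turns back into a homomorphism
  by contraction of its first factor.\<close>

lemma tor_acyclicI:
  assumes L: "Module.module R L" and tor: "\<And>n. n > 0 \<Longrightarrow> zero_module (Tor R C L n)"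
  shows "tor_acyclic L"
  unfolding tor_acyclic_def
proof (intro allI hom_exactI)
  interpret L: Module.module R L by fact
  fix n f assume f: "f \<in> mod_hom R (G (Suc n)) L"
    and 0: "\<And>z. z \<in> carrier (G n) \<Longrightarrow> f (dual_diff n z) = \<zero>\<^bsub>L\<^esub>"
  let ?T = "\<lambda>n. tensor_module R (F n) L" and ?p = "\<lambda>n. pure_tensor R (F n) L"
  have T: "Module.module R (?T n)" for n by (rule tensor_module_module[OF F_module L])
  note pb = pure_tensor_bilinear[OF F_module L]
  have pb': "bilinear_map R L (F n) (?T n) (\<lambda>l z. ?p n z l)" for n by (rule bilinear_map_flip[OF pb])
  note fc = mod_hom_D(1)[OF f gen_closed]
  have gF: "free_gen R y \<in> carrier (F n)" if "y \<in> Y n" for y n by (rule subsetD[OF G_subset_F gen_closed[OF that]])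
  have pc: "?p n z l \<in> carrier (?T n)" if "z \<in> carrier (F n)" "l \<in> carrier L" for n z l
    by (rule mod_hom_D(1)[OF bilinear_mapD(2)[OF pb that(1)] that(2)])
  let ?x = "\<Oplus>\<^bsub>?T (Suc n)\<^esub>y\<in>Y (Suc n). ?p (Suc n) (free_gen R y) (f (free_gen R y))"
  interpret T: Module.module R "?T (Suc n)" by (rule T)
  interpret T0: Module.module R "?T n" by (rule T)
  have sc: "(\<lambda>y. ?p (Suc n) (free_gen R y) (f (free_gen R y))) \<in> Y (Suc n) \<rightarrow> carrier (?T (Suc n))"
    by (intro Pi_I pc gF fc)
  have x: "?x \<in> carrier (?T (Suc n))" by (rule T.M.finsum_closed[OF sc])
  have incl: "(\<lambda>z. z) \<in> mod_hom R (G n) (F n)" for n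
    using mod_hom_domain_sub[OF mod_hom_id G_subset_F] by (simp only: free_module_update)
  note tm = tensor_map_hom[OF F_module L F_module F_diff_hom] and tp = tensor_map_pure[OF F_module L F_module F_diff_hom]
  have "tensor_map R (F n) L d ?x =
    (\<Oplus>\<^bsub>?T n\<^esub>y\<in>Y (Suc n). tensor_map R (F n) L d (?p (Suc n) (free_gen R y) (f (free_gen R y))))"
    by (rule mod_hom_sum[OF T T tm finite_Y sc])
  also have "\<dots> = (\<Oplus>\<^bsub>?T n\<^esub>y\<in>Y (Suc n). ?p n (d (free_gen R y)) (f (free_gen R y)))"
    by (rule T0.M.finsum_cong') (auto simp del: res_basis.simps simp: tp gF fc intro!: pc mod_hom_D(1)[OF F_diff_hom gF] fc)
  \<comment> \<open>Moved across, \<open>d\<close> becomes its transpose inside \<open>f\<close>,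
    where the hypothesis gives zero.\<close>
  also have "\<dots> = (\<Oplus>\<^bsub>?T n\<^esub>y\<in>Y n. ?p n (free_gen R y) (f (dual_diff n (free_gen R y))))"
    by (rule bilinear_dual_sum[OF L F_module T pb' f incl, symmetric])
  also have "\<dots> = (\<Oplus>\<^bsub>?T n\<^esub>y\<in>Y n. \<zero>\<^bsub>?T n\<^esub>)"
    by (rule T0.M.finsum_cong')
      (auto simp del: res_basis.simps simp: 0 gen_closed mod_hom_0[OF L T bilinear_mapD(2)[OF pb gF]])
  also have "\<dots> = \<zero>\<^bsub>?T n\<^esub>" by (rule T0.M.finsum_zero)
  finally have dx: "tensor_map R (F n) L d ?x = \<zero>\<^bsub>?T n\<^esub>" .
  obtain w where w: "w \<in> carrier (?T (Suc (Suc n)))" "?x = tensor_map R (F (Suc n)) L d w"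
    by (rule Tor_zeroD[OF C L tor x dx]) (simp, rule that)
  \<comment> \<open>Contraction of the first factor against \<open>z\<close>. It passes through
    \<open>\<psi>\<close> because \<open>w\<close> lives over the canonical resolution, whereas the
    pairing is linear on the finite modules \<open>G n\<close>.\<close>
  let ?\<beta> = "\<lambda>n z u l. free_pairing R (\<psi> n u) z \<odot>\<^bsub>L\<^esub> l"
  have \<beta>: "bilinear_map R (F n) L L (?\<beta> n z)" if z: "z \<in> carrier (G n)" for n z
  proof (rule bilinear_mapI)
    show "(\<lambda>u. ?\<beta> n z u l) \<in> mod_hom R (F n) L" if "l \<in> carrier L" for l
      by (rule mod_hom_smult_const[OF L mod_hom_comp[OF F_module retr_hom pairing_hom'[OF z]] that])
    show "?\<beta> n z u \<in> mod_hom R L L" if "u \<in> carrier (F n)" for u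
      by (rule mod_hom_smult[OF L L mod_hom_id pairing_closed[OF mod_hom_D(1)[OF retr_hom that] z]])
  qed
  let ?S = "\<lambda>n z. tensor_lift R L (?\<beta> n z)"
  have S: "?S n z \<in> mod_hom R (?T n) L" "\<And>u l. u \<in> carrier (F n) \<Longrightarrow> l \<in> carrier L \<Longrightarrow>
    ?S n z (?p n u l) = ?\<beta> n z u l" if "z \<in> carrier (G n)" for n z
    by (rule tensor_lift_hom[OF F_module L L \<beta>[OF that]]) (rule tensor_lift_pure[OF F_module L L \<beta>[OF that]])
  define g where "g z = ?S (Suc (Suc n)) z w" for z
  have g: "g \<in> mod_hom R (G (Suc (Suc n))) L"
  proof (rule mod_homI)
    fix z assume z: "z \<in> carrier (G (Suc (Suc n)))"
    show "g z \<in> carrier L" unfolding g_def by (rule mod_hom_D(1)[OF S(1)[OF z] w(1)])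
    interpret GG: Module.module R "G (Suc (Suc n))" by (rule G_module)
    note ps = mod_hom_D[OF pairing_hom, unfolded ring_as_module_simps]
    note rc = mod_hom_D(1)[OF retr_hom]
    show "g (r \<odot>\<^bsub>G (Suc (Suc n))\<^esub> z) = r \<odot>\<^bsub>L\<^esub> g z" if r: "r \<in> carrier R" for r
      unfolding g_def
    proof (rule tensor_hom_eq[OF F_module L L S(1)[OF GG.smult_closed[OF r z]] mod_hom_smult[OF T L S(1)[OF z] r] _ w(1)])
      fix u l assume ul: "u \<in> carrier (F (Suc (Suc n)))" "l \<in> carrier L"
      show "?S (Suc (Suc n)) (r \<odot>\<^bsub>G (Suc (Suc n))\<^esub> z) (?p (Suc (Suc n)) u l) = r \<odot>\<^bsub>L\<^esub> ?S (Suc (Suc n)) z (?p (Suc (Suc n)) u l)"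
        unfolding S(2)[OF GG.smult_closed[OF r z] ul] S(2)[OF z ul] ps(3)[OF rc[OF ul(1)] r z]
        by (rule L.smult_assoc1[OF r pairing_closed[OF rc[OF ul(1)] z] ul(2)])
    qed
    fix z' assume z': "z' \<in> carrier (G (Suc (Suc n)))"
    show "g (z \<oplus>\<^bsub>G (Suc (Suc n))\<^esub> z') = g z \<oplus>\<^bsub>L\<^esub> g z'"
      unfolding g_def
    proof (rule tensor_hom_eq[OF F_module L L S(1)[OF GG.M.a_closed[OF z z']] mod_hom_add[OF T L S(1)[OF z] S(1)[OF z']] _ w(1)])
      fix u l assume ul: "u \<in> carrier (F (Suc (Suc n)))" "l \<in> carrier L"
      show "?S (Suc (Suc n)) (z \<oplus>\<^bsub>G (Suc (Suc n))\<^esub> z') (?p (Suc (Suc n)) u l) =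
        ?S (Suc (Suc n)) z (?p (Suc (Suc n)) u l) \<oplus>\<^bsub>L\<^esub> ?S (Suc (Suc n)) z' (?p (Suc (Suc n)) u l)"
        unfolding S(2)[OF GG.M.a_closed[OF z z'] ul] S(2)[OF z ul] S(2)[OF z' ul] ps(2)[OF rc[OF ul(1)] z z']
        by (rule L.smult_l_distr[OF pairing_closed[OF rc[OF ul(1)] z] pairing_closed[OF rc[OF ul(1)] z'] ul(2)])
    qed
  qed
  \<comment> \<open>Contracting \<open>?x\<close> against \<open>z\<close> returns
    \<open>f z\<close> by expansion in the basis; contracting the boundary of \<open>w\<close>
    against \<open>z\<close> amounts to contracting \<open>w\<close> against the transpose of
    \<open>z\<close>.\<close>
  have "f z = g (dual_diff (Suc n) z)" if z: "z \<in> carrier (G (Suc n))" for z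
  proof -
    note dz = mod_hom_D(1)[OF dual_diff_hom z]
    have "f z = (\<Oplus>\<^bsub>L\<^esub>y\<in>Y (Suc n). z y \<odot>\<^bsub>L\<^esub> f (free_gen R y))"
      by (rule mod_hom_free_expand[OF L f finite_Y z])
    also have "\<dots> = (\<Oplus>\<^bsub>L\<^esub>y\<in>Y (Suc n). ?S (Suc n) z (?p (Suc n) (free_gen R y) (f (free_gen R y))))"
      by (rule L.M.finsum_cong')
        (auto simp del: res_basis.simps simp: S(2)[OF z] gF fc retr_id gen_closed pairing_gen'[OF z]
          intro!: L.smult_closed free_module_mem[OF z R])
    also have "\<dots> = ?S (Suc n) z ?x"
      by (rule mod_hom_sum[OF T L S(1)[OF z] finite_Y sc, symmetric])
    also have "\<dots> = ?S (Suc n) z (tensor_map R (F (Suc n)) L d w)" by (simp only: w(2))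
    also have "\<dots> = ?S (Suc (Suc n)) (dual_diff (Suc n) z) w"
    proof (rule tensor_hom_eq[OF F_module L L mod_hom_comp[OF T tm S(1)[OF z]] S(1)[OF dz] _ w(1)])
      fix u l assume ul: "u \<in> carrier (F (Suc (Suc n)))" "l \<in> carrier L"
      note du = mod_hom_D(1)[OF F_diff_hom ul(1)]
      note ru = mod_hom_D(1)[OF retr_hom ul(1)]
      have "free_pairing R (\<psi> (Suc n) (d u)) z = free_pairing R (\<psi> (Suc (Suc n)) u) (dual_diff (Suc n) z)"
        unfolding retr_diff[OF ul(1), symmetric] pairing_comm[OF mod_hom_D(1)[OF diff_hom ru] z]
          dual_adjoint[OF z ru] by (rule pairing_comm[OF dz ru])
      then show "?S (Suc n) z (tensor_map R (F (Suc n)) L d (?p (Suc (Suc n)) u l)) =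
        ?S (Suc (Suc n)) (dual_diff (Suc n) z) (?p (Suc (Suc n)) u l)"
        unfolding tp[OF ul] S(2)[OF z du ul(2)] S(2)[OF dz ul] by simp
    qed
    finally show ?thesis unfolding g_def .
  qed
  then show "\<exists>g\<in>mod_hom R (G (Suc (Suc n))) L. \<forall>z\<in>carrier (G (Suc n)). f z = g (dual_diff (Suc n) z)"
    using g by blast
qed

end

section \<open>Tensoring with the resolved module\<close>

lemma mod_hom_eval: "x \<in> carrier A \<Longrightarrow> (\<lambda>f. f x) \<in> mod_hom R (hom_module R A B) B"
  by (rule mod_homI) (auto simp: hom_module_simps mod_hom_D)

lemma mod_hom_precompose:
  assumes "Module.module R A" "Module.module R A'" "Module.module R B" "e \<in> mod_hom R A A'"
  shows "(\<lambda>f. \<lambda>x\<in>carrier A. f (e x)) \<in> mod_hom R (hom_module R A' B) (hom_module R A B)"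
proof (rule mod_homI)
  fix f assume "f \<in> carrier (hom_module R A' B)"
  then show "(\<lambda>x\<in>carrier A. f (e x)) \<in> carrier (hom_module R A B)"
    by (intro restrict_mod_hom[OF assms(1)] mod_hom_comp[OF assms(1,4)] hom_module_mod_hom)
qed (auto simp: hom_module_simps mod_hom_D[OF assms(4)] intro!: restrict_ext)

lemma mod_hom_postcompose:
  assumes "Module.module R A" "f \<in> mod_hom R B D"
  shows "(\<lambda>v. \<lambda>x\<in>carrier A. f (v x)) \<in> mod_hom R (hom_module R A B) (hom_module R A D)"
proof (rule mod_homI)
  fix v assume "v \<in> carrier (hom_module R A B)"
  then show "(\<lambda>x\<in>carrier A. f (v x)) \<in> carrier (hom_module R A D)"
    by (intro restrict_mod_hom[OF assms(1)] mod_hom_comp[OF assms(1) _ assms(2)] hom_module_mod_hom)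
qed (auto simp: hom_module_simps mod_hom_D[OF assms(2)] mod_hom_D intro!: restrict_ext)

context finite_resolution
begin

text \<open>
  Every element of \<open>A \<otimes> C\<close> has the form \<open>\<Sum> v(e\<^sub>y) \<otimes> aug(e\<^sub>y)\<close> with \<open>v \<in> Hom(G 0, A)\<close>, and it
  vanishes iff \<open>v\<close> factors through the dual differential: \<open>A \<otimes> C\<close> is the cokernel of
  \<open>Hom(G 1, A) \<rightarrow> Hom(G 0, A)\<close>.  The bilinear map \<open>t\<close> allows for both orders of the factors.
\<close>

definition tensor_sum ::
    "('r, 't) module \<Rightarrow> ('a \<Rightarrow> 'c \<Rightarrow> 't) \<Rightarrow> ((('r, 'c) res_gen \<Rightarrow> 'r) \<Rightarrow> 'a) \<Rightarrow> 't" where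
  "tensor_sum T t v = (\<Oplus>\<^bsub>T\<^esub>y\<in>Y 0. t (v (free_gen R y)) (aug (free_gen R y)))"

lemma aug_gen_closed: "y \<in> Y 0 \<Longrightarrow> aug (free_gen R y) \<in> carrier C"
  by (rule mod_hom_D(1)[OF aug_hom gen_closed])

lemma tensor_sum_hom:
  assumes A: "Module.module R A" and T: "Module.module R T" and t: "bilinear_map R A C T t"
  shows "tensor_sum T t \<in> mod_hom R (hom_module R (G 0) A) T"
  unfolding tensor_sum_def[abs_def]
  by (intro mod_hom_finsum[OF hom_module_module[OF G_module A] T finite_Y]
      mod_hom_comp[OF hom_module_module[OF G_module A] mod_hom_eval[OF gen_closed] bilinear_mapD(1)[OF t aug_gen_closed]])

lemma tensor_sum_cong:
  assumes A: "Module.module R A" and T: "Module.module R T" and t: "bilinear_map R A C T t"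
    and v: "v \<in> mod_hom R (G 0) A" and eq: "\<And>z. z \<in> carrier (G 0) \<Longrightarrow> v' z = v z"
  shows "tensor_sum T t v' = tensor_sum T t v"
proof -
  interpret T: Module.module R T by fact
  show ?thesis unfolding tensor_sum_def
    by (rule T.M.finsum_cong')
      (auto simp: eq gen_closed intro!: mod_hom_D(1)[OF bilinear_mapD(1)[OF t aug_gen_closed]] mod_hom_D(1)[OF v gen_closed])
qed

lemma tensor_sum_closed:
  assumes "Module.module R A" "Module.module R T" "bilinear_map R A C T t" "v \<in> mod_hom R (G 0) A"
  shows "tensor_sum T t v \<in> carrier T"
  using mod_hom_D(1)[OF tensor_sum_hom[OF assms(1-3)] restrict_mod_hom[OF G_module assms(4)]]
    tensor_sum_cong[OF assms, of "restrict v (carrier (G 0))"] by simp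

lemma tensor_sum_add:
  assumes A: "Module.module R A" and T: "Module.module R T" and t: "bilinear_map R A C T t"
    and v: "v \<in> mod_hom R (G 0) A" and w: "w \<in> mod_hom R (G 0) A"
  shows "tensor_sum T t (\<lambda>z. v z \<oplus>\<^bsub>A\<^esub> w z) = tensor_sum T t v \<oplus>\<^bsub>T\<^esub> tensor_sum T t w"
proof -
  let ?r = "\<lambda>v. restrict v (carrier (G 0))"
  note c = tensor_sum_cong[OF A T t]
  have "tensor_sum T t (?r v \<oplus>\<^bsub>hom_module R (G 0) A\<^esub> ?r w) = tensor_sum T t (?r v) \<oplus>\<^bsub>T\<^esub> tensor_sum T t (?r w)"
    by (rule mod_hom_D(2)[OF tensor_sum_hom[OF A T t] restrict_mod_hom[OF G_module v] restrict_mod_hom[OF G_module w]])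
  moreover have "tensor_sum T t (?r v \<oplus>\<^bsub>hom_module R (G 0) A\<^esub> ?r w) = tensor_sum T t (\<lambda>z. v z \<oplus>\<^bsub>A\<^esub> w z)"
    by (rule c[OF mod_hom_add[OF G_module A v w]]) (simp add: hom_module_simps)
  moreover have "tensor_sum T t (?r v) = tensor_sum T t v" "tensor_sum T t (?r w) = tensor_sum T t w"
    by (rule c[OF v], simp, rule c[OF w], simp)
  ultimately show ?thesis by simp
qed

text \<open>One statement serves both for naturality in \<open>A\<close>, where \<open>g\<close> is
  the map on the left factor, and for a change of the target \<open>T\<close>, where
  \<open>g\<close> is the identity.\<close>

lemma tensor_sum_comp:
  assumes T: "Module.module R T" and T': "Module.module R T'"
    and t: "bilinear_map R A C T t" and v: "v \<in> mod_hom R (G 0) A" and f: "f \<in> mod_hom R T T'"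
    and eq: "\<And>a c. a \<in> carrier A \<Longrightarrow> c \<in> carrier C \<Longrightarrow> f (t a c) = t' (g a) c"
  shows "f (tensor_sum T t v) = tensor_sum T' t' (\<lambda>z. g (v z))"
proof -
  interpret T': Module.module R T' by fact
  have tc: "t (v (free_gen R y)) (aug (free_gen R y)) \<in> carrier T" if "y \<in> Y 0" for y
    by (rule mod_hom_D(1)[OF bilinear_mapD(1)[OF t aug_gen_closed[OF that]] mod_hom_D(1)[OF v gen_closed[OF that]]])
  have e: "f (t (v (free_gen R y)) (aug (free_gen R y))) = t' (g (v (free_gen R y))) (aug (free_gen R y))"
    if "y \<in> Y 0" for y
    by (rule eq[OF mod_hom_D(1)[OF v gen_closed[OF that]] aug_gen_closed[OF that]])
  have "f (tensor_sum T t v) = (\<Oplus>\<^bsub>T'\<^esub>y\<in>Y 0. f (t (v (free_gen R y)) (aug (free_gen R y))))"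
    unfolding tensor_sum_def by (rule mod_hom_sum[OF T T' f finite_Y]) (auto intro: tc)
  also have "\<dots> = tensor_sum T' t' (\<lambda>z. g (v z))"
    unfolding tensor_sum_def
    by (rule T'.M.finsum_cong'[OF refl _ e]) (auto simp: e[symmetric] intro!: mod_hom_D(1)[OF f tc])
  finally show ?thesis .
qed

text \<open>Moving the transpose across the sum turns it into \<open>d\<close> on the side of
  \<open>C\<close>, where \<open>aug d = 0\<close>.\<close>

lemma tensor_sum_dual:
  assumes A: "Module.module R A" and T: "Module.module R T" and t: "bilinear_map R A C T t"
    and w: "w \<in> mod_hom R (G (Suc 0)) A"
  shows "tensor_sum T t (\<lambda>z. w (dual_diff 0 z)) = \<zero>\<^bsub>T\<^esub>"
proof -
  interpret T: Module.module R T by fact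
  have "tensor_sum T t (\<lambda>z. w (dual_diff 0 z)) =
    (\<Oplus>\<^bsub>T\<^esub>x\<in>Y (Suc 0). t (w (free_gen R x)) (aug (d (free_gen R x))))"
    unfolding tensor_sum_def by (rule bilinear_dual_sum[OF A C T t w aug_hom])
  also have "\<dots> = (\<Oplus>\<^bsub>T\<^esub>x\<in>Y (Suc 0). \<zero>\<^bsub>T\<^esub>)"
    by (rule T.M.finsum_cong')
      (auto simp: aug_diff gen_closed mod_hom_0[OF C T bilinear_mapD(2)[OF t mod_hom_D(1)[OF w gen_closed]]])
  also have "\<dots> = \<zero>\<^bsub>T\<^esub>" by (rule T.M.finsum_zero)
  finally show ?thesis .
qed

text \<open>The image of \<open>tensor_sum\<close> is a submodule containing all values of
  \<open>t\<close>. The hypothesis \<open>gen\<close> says that \<open>x\<close> is generated by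
  these values, and \<open>tensor_induct_submodule\<close> provides it for either order of the
  factors.\<close>

lemma tensor_sum_surj:
  assumes A: "Module.module R A" and T: "Module.module R T" and t: "bilinear_map R A C T t"
    and gen: "\<And>H. submodule H R T \<Longrightarrow> (\<And>a c. a \<in> carrier A \<Longrightarrow> c \<in> carrier C \<Longrightarrow> t a c \<in> H) \<Longrightarrow> x \<in> H"
  obtains v where "v \<in> mod_hom R (G 0) A" "x = tensor_sum T t v"
proof -
  let ?W = "hom_module R (G 0) A"
  interpret A: Module.module R A by fact
  interpret T: Module.module R T by fact
  have W: "Module.module R ?W" by (rule hom_module_module[OF G_module A])
  have "x \<in> tensor_sum T t ` carrier ?W"
  proof (rule gen[OF submodule_im[OF W T tensor_sum_hom[OF A T t]]])
    fix a c assume a: "a \<in> carrier A" and c: "c \<in> carrier C"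
    \<comment> \<open>A lift \<open>u\<close> of \<open>c\<close> supplies the coefficients:
      \<open>?v\<close> takes the basis element at \<open>y\<close> to \<open>u y\<close> times
      \<open>a\<close>.\<close>
    then obtain u where u: "u \<in> carrier (G 0)" "c = aug u" using aug_surj by (metis imageE)
    let ?v = "\<lambda>z. free_pairing R u z \<odot>\<^bsub>A\<^esub> a"
    have v: "?v \<in> mod_hom R (G 0) A" by (rule mod_hom_smult_const[OF A pairing_hom[OF u(1)] a])
    have uc: "u y \<in> carrier R" for y by (rule free_module_mem[OF u(1) R])
    note t1 = bilinear_mapD(1)[OF t aug_gen_closed] and t2 = bilinear_mapD(2)[OF t a]
    have tc: "t a (aug (free_gen R y)) \<in> carrier T" if "y \<in> Y 0" for y
      by (rule mod_hom_D(1)[OF t2 aug_gen_closed[OF that]])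
    have "t a c = (\<Oplus>\<^bsub>T\<^esub>y\<in>Y 0. u y \<odot>\<^bsub>T\<^esub> t a (aug (free_gen R y)))"
      unfolding u(2) by (rule mod_hom_free_expand[OF T mod_hom_comp[OF G_module aug_hom t2] finite_Y u(1)])
    also have "\<dots> = tensor_sum T t ?v" unfolding tensor_sum_def
      by (rule T.M.finsum_cong')
        (auto simp: pairing_gen[OF u(1)] mod_hom_D(3)[OF t1 uc a] intro!: T.smult_closed uc tc)
    also have "\<dots> = tensor_sum T t (restrict ?v (carrier (G 0)))"
      by (rule tensor_sum_cong[OF A T t v, symmetric]) simp
    finally have eq: "t a c = tensor_sum T t (restrict ?v (carrier (G 0)))" .
    show "t a c \<in> tensor_sum T t ` carrier ?W"
      by (rule image_eqI, rule eq, rule restrict_mod_hom[OF G_module v])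
  qed
  then obtain v where "v \<in> carrier ?W" "x = tensor_sum T t v" by (elim imageE)
  then show thesis by (intro that[OF hom_module_mod_hom])
qed

text \<open>This yields the inverse of the map from the cokernel to the tensor product: the pair
  \<open>a\<close>, \<open>aug u\<close> goes to the class of the homomorphism pairing with
  \<open>u\<close> and multiplying \<open>a\<close>. The kernel of \<open>tensor_sum\<close> is thus
  found without a separate proof that tensor products are right exact.\<close>

lemma ex_cokernel_bilinear:
  fixes A :: "('r, 'a) module"
  assumes A: "Module.module R A"
  defines "W \<equiv> hom_module R (G 0) A"
  defines "N \<equiv> (\<lambda>w. \<lambda>z\<in>carrier (G 0). w (dual_diff 0 z)) ` carrier (hom_module R (G (Suc 0)) A)"
  obtains \<beta> where "bilinear_map R A C (quot_module W N) \<beta>"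
    "\<And>v. v \<in> carrier W \<Longrightarrow> tensor_sum (quot_module W N) \<beta> v = N +>\<^bsub>W\<^esub> v" "submodule N R W"
proof -
  interpret A: Module.module R A by fact
  have W: "Module.module R W" unfolding W_def by (rule hom_module_module[OF G_module A])
  interpret W: Module.module R W by (rule W)
  have N: "submodule N R W" unfolding N_def W_def
    by (rule submodule_im[OF hom_module_module[OF G_module A] hom_module_module[OF G_module A]
        mod_hom_precompose[OF G_module G_module A dual_diff_hom]])
  let ?K = "quot_module W N"
  have K: "Module.module R ?K" by (rule quot_module_module[OF W N])
  interpret K: Module.module R ?K by (rule K)
  let ?\<pi> = "\<lambda>v. N +>\<^bsub>W\<^esub> v"
  have \<pi>: "?\<pi> \<in> mod_hom R W ?K" by (rule quot_proj_hom[OF W N])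
  define b where "b u a = (\<lambda>z\<in>carrier (G 0). free_pairing R u z \<odot>\<^bsub>A\<^esub> a)" for u a
  have bW: "b u a \<in> carrier W" if "u \<in> carrier (G 0)" "a \<in> carrier A" for u a
    unfolding b_def W_def
    by (rule restrict_mod_hom[OF G_module mod_hom_smult_const[OF A pairing_hom[OF that(1)] that(2)]])
  note ph = mod_hom_D[OF pairing_hom', unfolded ring_as_module_simps]
  have pc: "free_pairing R u z \<in> carrier R" if "u \<in> carrier (G 0)" "z \<in> carrier (G 0)" for u z
    by (rule pairing_closed[OF that])
  have bb: "bilinear_map R (G 0) A W b"
  proof (rule bilinear_mapI; rule mod_homI)
    fix a u u' assume a: "a \<in> carrier A" and u: "u \<in> carrier (G 0)" "u' \<in> carrier (G 0)"
    show "b (u \<oplus>\<^bsub>G 0\<^esub> u') a = b u a \<oplus>\<^bsub>W\<^esub> b u' a"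
      unfolding b_def W_def hom_module_simps
      by (rule restrict_ext) (simp add: ph(2)[OF _ u] A.smult_l_distr pc a u)
  next
    fix a u r assume a: "a \<in> carrier A" and u: "u \<in> carrier (G 0)" and r: "r \<in> carrier R"
    show "b (r \<odot>\<^bsub>G 0\<^esub> u) a = r \<odot>\<^bsub>W\<^esub> b u a"
      unfolding b_def W_def hom_module_simps
      by (rule restrict_ext) (simp add: ph(3)[OF _ r u] A.smult_assoc1 pc a u r)
    show "b u (r \<odot>\<^bsub>A\<^esub> a) = r \<odot>\<^bsub>W\<^esub> b u a"
      unfolding b_def W_def hom_module_simps
      by (rule restrict_ext) (simp add: A.smult_assoc1[symmetric] pc a u r A.R.m_comm)
  next
    fix a a' u assume a: "a \<in> carrier A" "a' \<in> carrier A" and u: "u \<in> carrier (G 0)"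
    show "b u (a \<oplus>\<^bsub>A\<^esub> a') = b u a \<oplus>\<^bsub>W\<^esub> b u a'"
      unfolding b_def W_def hom_module_simps
      by (rule restrict_ext) (simp add: A.smult_r_distr pc a u)
  qed (simp_all add: bW)
  \<comment> \<open>If \<open>u = d w\<close>, adjointness shows that the homomorphism attached to
    \<open>u\<close> is the one attached to \<open>w\<close> composed with the dual differential, so
    it lies in \<open>N\<close>. The class therefore depends on \<open>aug u\<close> only.\<close>
  have b0: "?\<pi> (b u a) = \<zero>\<^bsub>?K\<^esub>" if u: "u \<in> carrier (G 0)" "aug u = \<zero>\<^bsub>C\<^esub>" and a: "a \<in> carrier A" for u a
  proof -
    have "u \<in> d ` carrier (G (Suc 0))" unfolding aug_ker[symmetric] using u by simp
    then obtain w where w: "w \<in> carrier (G (Suc 0))" "u = d w" by (elim imageE)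
    let ?w = "\<lambda>z\<in>carrier (G (Suc 0)). free_pairing R w z \<odot>\<^bsub>A\<^esub> a"
    have "free_pairing R (d w) z = free_pairing R w (dual_diff 0 z)" if z: "z \<in> carrier (G 0)" for z
      using dual_adjoint[OF z w(1)] pairing_comm[OF u(1) z] pairing_comm[OF w(1) mod_hom_D(1)[OF dual_diff_hom z]]
      unfolding w(2) by simp
    then have eq: "b u a = (\<lambda>z\<in>carrier (G 0). ?w (dual_diff 0 z))"
      unfolding b_def w(2) by (intro restrict_ext) (simp add: mod_hom_D(1)[OF dual_diff_hom])
    have "b u a \<in> N" unfolding N_def
      by (rule image_eqI, rule eq, rule restrict_mod_hom[OF G_module mod_hom_smult_const[OF A pairing_hom[OF w(1)] a]])
    then show ?thesis using quot_proj_zero_iff[OF W N bW[OF u(1) a]] by simp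
  qed
  note bh = mod_hom_comp[OF G_module bilinear_mapD(1)[OF bb] \<pi>]
    and bh' = mod_hom_comp[OF A bilinear_mapD(2)[OF bb] \<pi>]
  \<comment> \<open>An arbitrary preimage under \<open>aug\<close>; by \<open>b0\<close> the choice
    does not affect the class, which is what \<open>\<beta>_aug\<close> records.\<close>
  define lift where "lift c = inv_into (carrier (G 0)) aug c" for c
  have lift: "lift c \<in> carrier (G 0)" "aug (lift c) = c" if "c \<in> carrier C" for c
    using that unfolding aug_surj[symmetric] lift_def by (rule inv_into_into, rule f_inv_into_f)
  define \<beta> where "\<beta> a c = ?\<pi> (b (lift c) a)" for a c
  have ex: "\<exists>g\<in>mod_hom R C ?K. \<forall>u\<in>carrier (G 0). g (aug u) = ?\<pi> (b u a)" if a: "a \<in> carrier A" for a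
    by (rule mod_hom_factor[OF G_module C K aug_hom aug_surj bh[OF a]]) (rule b0[OF _ _ a])
  have \<beta>_aug: "\<beta> a (aug u) = ?\<pi> (b u a)" if a: "a \<in> carrier A" and u: "u \<in> carrier (G 0)" for a u
  proof -
    obtain g where g: "\<forall>u\<in>carrier (G 0). g (aug u) = ?\<pi> (b u a)" using ex[OF a] by blast
    note c = mod_hom_D(1)[OF aug_hom u]
    show ?thesis using bspec[OF g lift(1)[OF c]] bspec[OF g u] unfolding lift(2)[OF c] \<beta>_def by simp
  qed
  have \<beta>: "bilinear_map R A C ?K \<beta>"
  proof (rule bilinear_mapI)
    show "(\<lambda>a. \<beta> a c) \<in> mod_hom R A ?K" if "c \<in> carrier C" for c
      unfolding \<beta>_def by (rule bh'[OF lift(1)[OF that]])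
    show "\<beta> a \<in> mod_hom R C ?K" if a: "a \<in> carrier A" for a
    proof -
      obtain g where g: "g \<in> mod_hom R C ?K" "\<forall>u\<in>carrier (G 0). g (aug u) = ?\<pi> (b u a)"
        using ex[OF a] by blast
      have "\<beta> a c = g c" if c: "c \<in> carrier C" for c
        using bspec[OF g(2) lift(1)[OF c]] \<beta>_aug[OF a lift(1)[OF c]] unfolding lift(2)[OF c] by simp
      then show ?thesis by (rule mod_hom_cong[OF C g(1)])
    qed
  qed
  have "tensor_sum ?K \<beta> v = ?\<pi> v" if v: "v \<in> carrier W" for v
  proof -
    have vh: "v \<in> mod_hom R (G 0) A" using v unfolding W_def by (rule hom_module_mod_hom)
    note vc = mod_hom_D(1)[OF vh gen_closed]
    have bc: "(\<lambda>y. b (free_gen R y) (v (free_gen R y))) \<in> Y 0 \<rightarrow> carrier W"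
      by (intro Pi_I bW gen_closed vc)
    have "tensor_sum ?K \<beta> v = (\<Oplus>\<^bsub>?K\<^esub>y\<in>Y 0. ?\<pi> (b (free_gen R y) (v (free_gen R y))))"
      unfolding tensor_sum_def
      by (rule K.M.finsum_cong')
        (auto simp: \<beta>_aug vc gen_closed intro!: mod_hom_D(1)[OF \<pi>] bW)
    also have "\<dots> = ?\<pi> (\<Oplus>\<^bsub>W\<^esub>y\<in>Y 0. b (free_gen R y) (v (free_gen R y)))"
      by (rule mod_hom_sum[OF W K \<pi> finite_Y bc, symmetric])
    \<comment> \<open>The expansion of \<open>v\<close> in the dual basis, checked pointwise by
      evaluation at \<open>z\<close>.\<close>
    also have "(\<Oplus>\<^bsub>W\<^esub>y\<in>Y 0. b (free_gen R y) (v (free_gen R y))) = v"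
    proof (rule hom_module_eqI[where R = R and A = "G 0" and B = A])
      show "(\<Oplus>\<^bsub>W\<^esub>y\<in>Y 0. b (free_gen R y) (v (free_gen R y))) \<in> carrier (hom_module R (G 0) A)"
        using W.M.finsum_closed[OF bc] by (simp add: W_def)
      show "v \<in> carrier (hom_module R (G 0) A)" using v by (simp add: W_def)
      fix z assume z: "z \<in> carrier (G 0)"
      have ev: "(\<lambda>f. f z) \<in> mod_hom R W A" unfolding W_def by (rule mod_hom_eval[OF z])
      have "(\<Oplus>\<^bsub>W\<^esub>y\<in>Y 0. b (free_gen R y) (v (free_gen R y))) z =
        (\<Oplus>\<^bsub>A\<^esub>y\<in>Y 0. b (free_gen R y) (v (free_gen R y)) z)"
        by (rule mod_hom_sum[OF W A ev finite_Y bc])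
      also have "\<dots> = (\<Oplus>\<^bsub>A\<^esub>y\<in>Y 0. z y \<odot>\<^bsub>A\<^esub> v (free_gen R y))"
        by (rule A.M.finsum_cong')
          (auto simp: b_def z pairing_gen'[OF z] intro!: A.smult_closed free_module_mem[OF z R] vc)
      also have "\<dots> = v z" by (rule mod_hom_free_expand[OF A vh finite_Y z, symmetric])
      finally show "(\<Oplus>\<^bsub>W\<^esub>y\<in>Y 0. b (free_gen R y) (v (free_gen R y))) z = v z" .
    qed
    finally show ?thesis .
  qed
  then show thesis using that \<beta> N by blast
qed

text \<open>The map from \<open>T\<close> to the cokernel that \<open>univ\<close> provides sends
  \<open>tensor_sum T t v\<close> to the class of \<open>v\<close>, so this class is zero. The
  universal property is stated for the element type of that cokernel, which is the target of its
  application.\<close>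

lemma tensor_sum_zeroD:
  fixes A :: "('r, 'a) module" and T :: "('r, 't) module"
  assumes A: "Module.module R A" and T: "Module.module R T" and t: "bilinear_map R A C T t"
    and univ: "\<And>(D :: ('r, (((('r, 'c) res_gen \<Rightarrow> 'r) \<Rightarrow> 'a) set)) module) \<beta>.
      Module.module R D \<Longrightarrow> bilinear_map R A C D \<beta> \<Longrightarrow>
      \<exists>f\<in>mod_hom R T D. \<forall>a\<in>carrier A. \<forall>c\<in>carrier C. f (t a c) = \<beta> a c"
    and v: "v \<in> mod_hom R (G 0) A" and 0: "tensor_sum T t v = \<zero>\<^bsub>T\<^esub>"
  obtains w where "w \<in> mod_hom R (G (Suc 0)) A" "\<And>z. z \<in> carrier (G 0) \<Longrightarrow> v z = w (dual_diff 0 z)"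
proof -
  let ?W = "hom_module R (G 0) A"
  let ?N = "(\<lambda>w. \<lambda>z\<in>carrier (G 0). w (dual_diff 0 z)) ` carrier (hom_module R (G (Suc 0)) A)"
  have W: "Module.module R ?W" by (rule hom_module_module[OF G_module A])
  let ?K = "quot_module ?W ?N"
  obtain \<beta> where \<beta>: "bilinear_map R A C ?K \<beta>"
    "\<And>v. v \<in> carrier ?W \<Longrightarrow> tensor_sum ?K \<beta> v = ?N +>\<^bsub>?W\<^esub> v" and N: "submodule ?N R ?W"
    using ex_cokernel_bilinear[OF A] by blast
  have K: "Module.module R ?K" by (rule quot_module_module[OF W N])
  obtain f where f: "f \<in> mod_hom R T ?K" "\<And>a c. a \<in> carrier A \<Longrightarrow> c \<in> carrier C \<Longrightarrow> f (t a c) = \<beta> a c"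
    using univ[OF K \<beta>(1)] by blast
  let ?v = "restrict v (carrier (G 0))"
  have vW: "?v \<in> carrier ?W" by (rule restrict_mod_hom[OF G_module v])
  have "?N +>\<^bsub>?W\<^esub> ?v = tensor_sum ?K \<beta> v"
    unfolding \<beta>(2)[OF vW, symmetric] by (rule tensor_sum_cong[OF A K \<beta>(1) v]) simp
  also have "\<dots> = f (tensor_sum T t v)"
    by (rule tensor_sum_comp[OF T K t v f(1), of \<beta> "\<lambda>a. a", symmetric]) (rule f(2))
  also have "\<dots> = \<zero>\<^bsub>?K\<^esub>" unfolding 0 by (rule mod_hom_0[OF T K f(1)])
  finally have "?v \<in> ?N" using quot_proj_zero_iff[OF W N vW] by simp
  then obtain w where w: "w \<in> carrier (hom_module R (G (Suc 0)) A)"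
    "?v = (\<lambda>z\<in>carrier (G 0). w (dual_diff 0 z))" by (elim imageE)
  have "v z = w (dual_diff 0 z)" if "z \<in> carrier (G 0)" for z
    using fun_cong[OF w(2), of z] that by simp
  then show thesis using that hom_module_mod_hom[OF w(1)] by blast
qed

end

section \<open>Tensoring projective modules with a semidualizing module\<close>

lemma mod_hom_coord:
  assumes "cring R"
  shows "(\<lambda>z. z j) \<in> mod_hom R (free_module R X) (ring_as_module R)"
  by (rule mod_homI) (simp_all add: ring_as_module_simps free_module_simps free_module_mem[OF _ assms])

text \<open>
  Elements of \<open>R\<^bsup>(X)\<^esup> \<otimes> C\<close> have finitely many coordinates in \<open>C\<close>, so a map into it from a
  finitely generated module lands in a finite power of \<open>C\<close>.  This carries properties of
  \<open>C = R \<otimes> C\<close> over to \<open>P \<otimes> C\<close> for projective \<open>P\<close> of any size.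
\<close>

locale free_tensor =
  fixes R :: "('r, 'k) ring_scheme" and X :: "'p set" and C :: "('r, 'c) module"
  assumes C: "Module.module R C"
begin

abbreviation E :: "('r, 'p \<Rightarrow> 'r) module" where
  "E \<equiv> free_module R X"

abbreviation T :: "('r, ((('p \<Rightarrow> 'r) \<times> 'c) \<Rightarrow> 'r) set) module" where
  "T \<equiv> tensor_module R E C"

abbreviation t :: "('p \<Rightarrow> 'r) \<Rightarrow> 'c \<Rightarrow> ((('p \<Rightarrow> 'r) \<times> 'c) \<Rightarrow> 'r) set" where
  "t \<equiv> pure_tensor R E C"

definition coord :: "'p \<Rightarrow> ((('p \<Rightarrow> 'r) \<times> 'c) \<Rightarrow> 'r) set \<Rightarrow> 'c" where
  "coord j = tensor_lift R C (\<lambda>z c. z j \<odot>\<^bsub>C\<^esub> c)"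

text \<open>For finite \<open>J\<close>, the projection onto the part supported on \<open>J\<close>;
  a fixed element has all its nonzero coordinates in \<open>J\<close>.\<close>

definition part :: "'p set \<Rightarrow> ((('p \<Rightarrow> 'r) \<times> 'c) \<Rightarrow> 'r) set \<Rightarrow> ((('p \<Rightarrow> 'r) \<times> 'c) \<Rightarrow> 'r) set" where
  "part J w = (\<Oplus>\<^bsub>T\<^esub>j\<in>J. t (free_gen R j) (coord j w))"

lemma R: "cring R"
  by (rule module_cring[OF C])

lemma E: "Module.module R E"
  by (rule free_module_is_module[OF R])

lemma T: "Module.module R T"
  by (rule tensor_module_module[OF E C])

lemmas t_bilinear = pure_tensor_bilinear[OF E C]

lemma t_closed: "z \<in> carrier E \<Longrightarrow> c \<in> carrier C \<Longrightarrow> t z c \<in> carrier T"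
  by (rule mod_hom_D(1)[OF bilinear_mapD(2)[OF t_bilinear]])

lemma coord_bilinear: "bilinear_map R E C C (\<lambda>z c. z j \<odot>\<^bsub>C\<^esub> c)"
  by (rule bilinear_mapI)
    (auto intro: mod_hom_smult_const[OF C mod_hom_coord[OF R]] mod_hom_smult[OF C C mod_hom_id] free_module_mem[OF _ R])

lemma coord_hom: "coord j \<in> mod_hom R T C"
  unfolding coord_def by (rule tensor_lift_hom[OF E C C coord_bilinear])

lemma coord_t: "z \<in> carrier E \<Longrightarrow> c \<in> carrier C \<Longrightarrow> coord j (t z c) = z j \<odot>\<^bsub>C\<^esub> c"
  unfolding coord_def by (rule tensor_lift_pure[OF E C C coord_bilinear])

lemma part_hom:
  assumes "finite J" "J \<subseteq> X"
  shows "part J \<in> mod_hom R T T"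
  unfolding part_def[abs_def]
  by (intro mod_hom_finsum[OF T T assms(1)] mod_hom_comp[OF T coord_hom bilinear_mapD(2)[OF t_bilinear free_gen_closed[OF R]]])
    (use assms(2) in auto)

text \<open>An element fixed by \<open>part J\<close> has zero coordinates outside \<open>J\<close>,
  so the additional summands vanish.\<close>

lemma part_mono:
  assumes J: "finite J'" "J \<subseteq> J'" "J' \<subseteq> X" and w: "w \<in> carrier T" and part: "part J w = w"
  shows "part J' w = w"
proof -
  interpret T: Module.module R T by (rule T)
  interpret C: Module.module R C by (rule C)
  have fJ: "finite J" using J finite_subset by blast
  have cc: "coord j w \<in> carrier C" for j by (rule mod_hom_D(1)[OF coord_hom w])
  have g: "free_gen R j \<in> carrier E" if "j \<in> J'" for j using that J by (intro free_gen_closed[OF R]) auto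
  have "coord j w = \<zero>\<^bsub>C\<^esub>" if j: "j \<in> J'" "j \<notin> J" for j
  proof -
    have "coord j w = coord j (part J w)" by (simp only: part)
    also have "\<dots> = (\<Oplus>\<^bsub>C\<^esub>i\<in>J. coord j (t (free_gen R i) (coord i w)))"
      unfolding part_def by (rule mod_hom_sum[OF T C coord_hom fJ]) (use J g cc t_closed in auto)
    also have "\<dots> = (\<Oplus>\<^bsub>C\<^esub>i\<in>J. \<zero>\<^bsub>C\<^esub>)"
      by (rule C.M.finsum_cong') (use J j g cc in \<open>auto simp: coord_t free_gen_def\<close>)
    also have "\<dots> = \<zero>\<^bsub>C\<^esub>" by (rule C.M.finsum_zero)
    finally show ?thesis .
  qed
  then have "part J w = part J' w" unfolding part_def
    by (intro T.M.add.finprod_mono_neutral_cong_left)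
      (use J g cc t_closed mod_hom_0[OF C T bilinear_mapD(2)[OF t_bilinear]] in auto)
  then show ?thesis using part by simp
qed

lemma free_gen_subset_expand:
  assumes z: "z \<in> carrier E" and J: "finite J" "J \<subseteq> X" "{x. z x \<noteq> \<zero>\<^bsub>R\<^esub>} \<subseteq> J"
    and B: "Module.module R B" and f: "f \<in> mod_hom R E B"
  shows "f z = (\<Oplus>\<^bsub>B\<^esub>j\<in>J. z j \<odot>\<^bsub>B\<^esub> f (free_gen R j))"
proof (rule mod_hom_free_expand[OF B _ J(1)])
  show "f \<in> mod_hom R (free_module R J) B"
    using mod_hom_domain_sub[OF f free_module_mono[OF R J(2)]] by (simp only: free_module_update)
  show "z \<in> carrier (free_module R J)"
    using J finite_subset[OF J(3,1)] free_module_mem[OF z R] by (auto simp: free_module_def)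
qed

lemma part_t:
  assumes z: "z \<in> carrier E" and c: "c \<in> carrier C" and J: "finite J" "J \<subseteq> X" "{x. z x \<noteq> \<zero>\<^bsub>R\<^esub>} \<subseteq> J"
  shows "part J (t z c) = t z c"
proof -
  interpret T: Module.module R T by (rule T)
  interpret C: Module.module R C by (rule C)
  have zc: "z j \<in> carrier R" for j by (rule free_module_mem[OF z R])
  have g: "free_gen R j \<in> carrier E" if "j \<in> J" for j using that J by (intro free_gen_closed[OF R]) auto
  have "t z c = (\<Oplus>\<^bsub>T\<^esub>j\<in>J. z j \<odot>\<^bsub>T\<^esub> t (free_gen R j) c)"
    by (rule free_gen_subset_expand[OF z J T bilinear_mapD(1)[OF t_bilinear c]])
  also have "\<dots> = part J (t z c)" unfolding part_def
    by (rule T.M.finsum_cong')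
      (auto simp: coord_t[OF z c] mod_hom_D(3)[OF bilinear_mapD(2)[OF t_bilinear g] zc c] intro!: t_closed g zc c C.smult_closed)
  finally show ?thesis by simp
qed

text \<open>A pure tensor is fixed by the part over the support of its left factor, and by
  \<open>part_mono\<close> two fixed elements have a common finite part. The fixed elements hence
  form a submodule containing all pure tensors.\<close>

lemma ex_part:
  assumes w: "w \<in> carrier T"
  shows "\<exists>J. finite J \<and> J \<subseteq> X \<and> part J w = w"
proof -
  interpret T: Module.module R T by (rule T)
  let ?H = "{w \<in> carrier T. \<exists>J. finite J \<and> J \<subseteq> X \<and> part J w = w}"
  have "submodule ?H R T"
  proof (rule T.submoduleI)
    show "\<zero>\<^bsub>T\<^esub> \<in> ?H" using mod_hom_0[OF T T part_hom, of "{}"] by auto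
    show "\<ominus>\<^bsub>T\<^esub> v \<in> ?H" if "v \<in> ?H" for v
      using that mod_hom_uminus[OF T T part_hom] by auto
    show "r \<odot>\<^bsub>T\<^esub> v \<in> ?H" if "v \<in> ?H" "r \<in> carrier R" for v r
      using that mod_hom_D(3)[OF part_hom] by auto
    show "v \<oplus>\<^bsub>T\<^esub> w \<in> ?H" if v: "v \<in> ?H" and w: "w \<in> ?H" for v w
    proof -
      obtain J where J: "finite J" "J \<subseteq> X" "part J v = v" using v by blast
      obtain J' where J': "finite J'" "J' \<subseteq> X" "part J' w = w" using w by blast
      have c: "v \<in> carrier T" "w \<in> carrier T" using v w by auto
      have U: "finite (J \<union> J')" "J \<union> J' \<subseteq> X" using J J' by auto
      have "part (J \<union> J') v = v" "part (J \<union> J') w = w"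
        by (rule part_mono[OF U(1) _ U(2) c(1) J(3)], blast, rule part_mono[OF U(1) _ U(2) c(2) J'(3)], blast)
      then have "part (J \<union> J') (v \<oplus>\<^bsub>T\<^esub> w) = v \<oplus>\<^bsub>T\<^esub> w" using mod_hom_D(2)[OF part_hom[OF U] c] by simp
      then show ?thesis using U c T.M.a_closed by blast
    qed
  qed auto
  then have "w \<in> ?H"
  proof (rule tensor_induct_submodule[OF E C _ _ w])
    fix z c assume z: "z \<in> carrier E" and c: "c \<in> carrier C"
    have J: "finite {x. z x \<noteq> \<zero>\<^bsub>R\<^esub>}" "{x. z x \<noteq> \<zero>\<^bsub>R\<^esub>} \<subseteq> X"
      using z by (auto simp: free_module_def)
    show "t z c \<in> ?H" using part_t[OF z c J order_refl] J t_closed[OF z c] by blast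
  qed
  then show ?thesis by blast
qed

text \<open>The last hypothesis expresses generation by \<open>S\<close> through uniqueness of
  homomorphisms, so spanning sets and bases of free modules are treated alike. The union of finite
  parts for the elements of \<open>S\<close> then works on all of \<open>N\<close>.\<close>

lemma ex_part_hom:
  assumes N: "Module.module R N" and S: "finite S" "S \<subseteq> carrier N"
    and h: "h \<in> mod_hom R N T" and x: "\<And>f g x. f \<in> mod_hom R N T \<Longrightarrow> g \<in> mod_hom R N T \<Longrightarrow>
      (\<And>x. x \<in> S \<Longrightarrow> f x = g x) \<Longrightarrow> x \<in> carrier N \<Longrightarrow> f x = g x"
  obtains J where "finite J" "J \<subseteq> X" "\<And>x. x \<in> carrier N \<Longrightarrow> part J (h x) = h x"
proof -
  have hc: "h s \<in> carrier T" if "s \<in> S" for s using mod_hom_D(1)[OF h] S(2) that by blast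
  have "\<forall>s\<in>S. \<exists>J. finite J \<and> J \<subseteq> X \<and> part J (h s) = h s" using ex_part[OF hc] by blast
  then obtain J where J: "\<And>s. s \<in> S \<Longrightarrow> finite (J s) \<and> J s \<subseteq> X \<and> part (J s) (h s) = h s" by metis
  let ?J = "\<Union>s\<in>S. J s"
  have U: "finite ?J" "?J \<subseteq> X" using J S(1) by auto
  have "part ?J (h s) = h s" if "s \<in> S" for s
    using part_mono[OF U(1) _ U(2) hc[OF that], of "J s"] J[OF that] that by blast
  then have "part ?J (h x) = h x" if "x \<in> carrier N" for x
    by (rule assms(5)[OF mod_hom_comp[OF N h part_hom[OF U]] h _ that])
  then show thesis using that U by blast
qed

end

section \<open>The map from P to Hom(C, P \<otimes> C)\<close>

lemma projective_moduleE:
  fixes P :: "('r, 'p) module"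
  assumes "projective_module R P"
  obtains X :: "'p set" and s q where "Module.module R P" "s \<in> mod_hom R P (free_module R X)"
    "q \<in> mod_hom R (free_module R X) P" "\<And>x. x \<in> carrier P \<Longrightarrow> q (s x) = x"
  using assms unfolding projective_module_def by (elim conjE exE bexE) (rule that, auto)

lemma homothety_inj:
  assumes C: "Module.module R C" and iso: "homothety C \<in> mod_iso R (ring_as_module R) (hom_module R C C)"
    and r: "r \<in> carrier R" "\<And>c. c \<in> carrier C \<Longrightarrow> r \<odot>\<^bsub>C\<^esub> c = \<zero>\<^bsub>C\<^esub>"
  shows "r = \<zero>\<^bsub>R\<^esub>"
proof -
  interpret C: Module.module R C by fact
  have "homothety C r = homothety C \<zero>\<^bsub>R\<^esub>"
    unfolding homothety_def by (rule restrict_ext) (simp add: r)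
  moreover have "inj_on (homothety C) (carrier R)"
    using iso by (auto simp: mod_iso_def bij_betw_def ring_as_module_simps)
  ultimately show ?thesis using r(1) by (simp add: inj_on_eq_iff)
qed

lemma homothety_surj:
  assumes C: "Module.module R C" and iso: "homothety C \<in> mod_iso R (ring_as_module R) (hom_module R C C)"
    and h: "h \<in> mod_hom R C C"
  obtains r where "r \<in> carrier R" "\<And>c. c \<in> carrier C \<Longrightarrow> h c = r \<odot>\<^bsub>C\<^esub> c"
proof -
  have "restrict h (carrier C) \<in> homothety C ` carrier R"
    using restrict_mod_hom[OF C h] iso by (auto simp: mod_iso_def bij_betw_def ring_as_module_simps)
  then obtain r where r: "r \<in> carrier R" "restrict h (carrier C) = homothety C r" by (elim imageE)
  have "h c = r \<odot>\<^bsub>C\<^esub> c" if "c \<in> carrier C" for c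
    using fun_cong[OF r(2), of c] that by (simp add: homothety_def)
  then show thesis using that r(1) by blast
qed

text \<open>After embedding \<open>P\<close> into a free module, each coordinate of the image of
  \<open>x\<close> annihilates \<open>C\<close>, and the homothety map is injective.\<close>

lemma projective_tensor_inj:
  fixes P :: "('r, 'p) module"
  assumes C: "Module.module R C" and iso: "homothety C \<in> mod_iso R (ring_as_module R) (hom_module R C C)"
    and P: "projective_module R P" and x: "x \<in> carrier P"
    and 0: "\<And>c. c \<in> carrier C \<Longrightarrow> pure_tensor R P C x c = \<zero>\<^bsub>tensor_module R P C\<^esub>"
  shows "x = \<zero>\<^bsub>P\<^esub>"
proof -
  obtain X :: "'p set" and s q where PM: "Module.module R P" and s: "s \<in> mod_hom R P (free_module R X)"
    and q: "q \<in> mod_hom R (free_module R X) P" and qs: "\<And>x. x \<in> carrier P \<Longrightarrow> q (s x) = x"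
    by (rule projective_moduleE[OF P], rule that) (assumption | simp)+
  interpret free_tensor R X C by (rule free_tensor.intro) (rule C)
  have sx: "s x \<in> carrier E" by (rule mod_hom_D(1)[OF s x])
  have "s x j = \<zero>\<^bsub>R\<^esub>" for j
  proof (rule homothety_inj[OF C iso])
    show "s x j \<in> carrier R" by (rule free_module_mem[OF sx R])
    fix c assume c: "c \<in> carrier C"
    have "t (s x) c = tensor_map R E C s (pure_tensor R P C x c)"
      by (rule tensor_map_pure[OF PM C E s x c, symmetric])
    also have "\<dots> = \<zero>\<^bsub>T\<^esub>" unfolding 0[OF c]
      by (rule mod_hom_0[OF tensor_module_module[OF PM C] T tensor_map_hom[OF PM C E s]])
    finally show "s x j \<odot>\<^bsub>C\<^esub> c = \<zero>\<^bsub>C\<^esub>"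
      unfolding coord_t[OF sx c, symmetric] using mod_hom_0[OF T C coord_hom] by simp
  qed
  then have "s x = \<zero>\<^bsub>E\<^esub>" by (simp add: free_module_simps fun_eq_iff)
  then show ?thesis using qs[OF x] mod_hom_0[OF E PM q] by simp
qed

text \<open>Since \<open>C\<close> is finitely generated, \<open>h\<close> involves only finitely
  many coordinates of the surrounding free module. Each of them is an endomorphism of
  \<open>C\<close>, hence multiplication by some \<open>r j\<close>; the combination of basis
  elements with these coefficients, projected to \<open>P\<close>, is the required
  \<open>x\<close>.\<close>

lemma projective_tensor_surj:
  fixes P :: "('r, 'p) module"
  assumes C: "Module.module R C" "fin_gen R C"
    and iso: "homothety C \<in> mod_iso R (ring_as_module R) (hom_module R C C)"
    and P: "projective_module R P" and h: "h \<in> mod_hom R C (tensor_module R P C)"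
  obtains x where "x \<in> carrier P" "\<And>c. c \<in> carrier C \<Longrightarrow> h c = pure_tensor R P C x c"
proof -
  obtain X :: "'p set" and s q where PM: "Module.module R P" and s: "s \<in> mod_hom R P (free_module R X)"
    and q: "q \<in> mod_hom R (free_module R X) P" and qs: "\<And>x. x \<in> carrier P \<Longrightarrow> q (s x) = x"
    by (rule projective_moduleE[OF P], rule that) (assumption | simp)+
  interpret C: Module.module R C by (rule C(1))
  obtain S where S: "finite S" "S \<subseteq> carrier C" "mod_span R C S = carrier C"
    using C(2) by (auto simp: fin_gen_def)
  interpret free_tensor R X C by (rule free_tensor.intro) (rule C(1))
  interpret T: Module.module R T by (rule T)
  interpret E: Module.module R E by (rule E)
  have PC: "Module.module R (tensor_module R P C)" by (rule tensor_module_module[OF PM C])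
  let ?s = "tensor_map R E C s" and ?q = "tensor_map R P C q"
  have sh: "?s \<in> mod_hom R (tensor_module R P C) T" by (rule tensor_map_hom[OF PM C E s])
  have qh: "?q \<in> mod_hom R T (tensor_module R P C)" by (rule tensor_map_hom[OF E C PM q])
  have qs': "?q (?s w) = w" if "w \<in> carrier (tensor_module R P C)" for w
    by (rule tensor_hom_eq[OF PM C PC mod_hom_comp[OF PC sh qh] mod_hom_id _ that])
      (simp add: tensor_map_pure[OF PM C E s] tensor_map_pure[OF E C PM q] mod_hom_D(1)[OF s] qs)
  let ?h = "\<lambda>c. ?s (h c)"
  have h': "?h \<in> mod_hom R C T" by (rule mod_hom_comp[OF C h sh])
  obtain J where J: "finite J" "J \<subseteq> X" "\<And>c. c \<in> carrier C \<Longrightarrow> part J (?h c) = ?h c"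
  proof (rule ex_part_hom[OF C S(1,2) h'])
    show "f x = g x" if "f \<in> mod_hom R C T" "g \<in> mod_hom R C T" "\<And>x. x \<in> S \<Longrightarrow> f x = g x" "x \<in> carrier C" for f g x
      by (rule mod_hom_eq_on_span[OF C T that(1,2) S(2) that(3)]) (use that(4) S(3) in auto)
  qed blast
  have "\<exists>r\<in>carrier R. \<forall>c\<in>carrier C. coord j (?h c) = r \<odot>\<^bsub>C\<^esub> c" for j
    using homothety_surj[OF C iso mod_hom_comp[OF C h' coord_hom]] by metis
  then obtain r where r: "\<And>j. r j \<in> carrier R" "\<And>j c. c \<in> carrier C \<Longrightarrow> coord j (?h c) = r j \<odot>\<^bsub>C\<^esub> c" by metis
  have g: "free_gen R j \<in> carrier E" if "j \<in> J" for j using that J by (intro free_gen_closed[OF R]) auto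
  let ?z = "\<Oplus>\<^bsub>E\<^esub>j\<in>J. r j \<odot>\<^bsub>E\<^esub> free_gen R j"
  have z: "?z \<in> carrier E" by (rule E.M.finsum_closed) (auto intro!: E.smult_closed r g)
  have hz: "?h c = t ?z c" if c: "c \<in> carrier C" for c
  proof -
    note t1 = bilinear_mapD(1)[OF t_bilinear c]
    have "t ?z c = (\<Oplus>\<^bsub>T\<^esub>j\<in>J. t (r j \<odot>\<^bsub>E\<^esub> free_gen R j) c)"
      by (rule mod_hom_sum[OF E T t1 J(1)]) (auto intro!: E.smult_closed r g)
    also have "\<dots> = part J (?h c)" unfolding part_def
      by (rule T.M.finsum_cong')
        (auto simp: r(2)[OF c] mod_hom_D(3)[OF t1 r(1) g] mod_hom_D(3)[OF bilinear_mapD(2)[OF t_bilinear g] r(1) c]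
          intro!: T.smult_closed t_closed C.smult_closed g r c)
    finally show ?thesis using J(3)[OF c] by simp
  qed
  have "h c = pure_tensor R P C (q ?z) c" if c: "c \<in> carrier C" for c
    using qs'[OF mod_hom_D(1)[OF h c]] unfolding hz[OF c] tensor_map_pure[OF E C PM q z c] by simp
  then show thesis using that mod_hom_D(1)[OF q z] by blast
qed

section \<open>Acyclicity of P \<otimes> C and of P for projective P\<close>

context finite_resolution
begin

text \<open>Here Ext commutes with direct sums because \<open>G (Suc n)\<close> is finitely
  generated: for a free module in place of \<open>P\<close>, a cocycle has finitely many nonzero
  coordinates, and each is solved in \<open>C\<close>. The general case follows by passing to a
  retract.\<close>

lemma ext_acyclic_projective_tensor:
  fixes P :: "('r, 'p) module"
  assumes ext: "ext_acyclic C" and P: "projective_module R P"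
  shows "ext_acyclic (tensor_module R P C)"
  unfolding ext_acyclic_def
proof
  fix n
  obtain X :: "'p set" and s q where PM: "Module.module R P" and s: "s \<in> mod_hom R P (free_module R X)"
    and q: "q \<in> mod_hom R (free_module R X) P" and qs: "\<And>x. x \<in> carrier P \<Longrightarrow> q (s x) = x"
    by (rule projective_moduleE[OF P], rule that) (assumption | simp)+
  interpret T: free_tensor R X C by (rule free_tensor.intro) (rule C)
  interpret TT: Module.module R T.T by (rule T.T)
  have PC: "Module.module R (tensor_module R P C)" by (rule tensor_module_module[OF PM C])
  let ?s = "tensor_map R T.E C s" and ?q = "tensor_map R P C q"
  have sh: "?s \<in> mod_hom R (tensor_module R P C) T.T" by (rule tensor_map_hom[OF PM C T.E s])
  have qh: "?q \<in> mod_hom R T.T (tensor_module R P C)" by (rule tensor_map_hom[OF T.E C PM q])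
  have qs': "?q (?s w) = w" if "w \<in> carrier (tensor_module R P C)" for w
    by (rule tensor_hom_eq[OF PM C PC mod_hom_comp[OF PC sh qh] mod_hom_id _ that])
      (simp add: tensor_map_pure[OF PM C T.E s] tensor_map_pure[OF T.E C PM q] mod_hom_D(1)[OF s] qs)
  show "hom_exact R (G (Suc (Suc n))) d (G (Suc n)) d (G n) (tensor_module R P C)"
  proof (rule hom_exact_retract[OF G_module G_module diff_hom diff_hom PC T.T sh qh qs'])
    show "hom_exact R (G (Suc (Suc n))) d (G (Suc n)) d (G n) T.T"
    proof (rule hom_exactI)
      fix f assume f: "f \<in> mod_hom R (G (Suc n)) T.T"
        and 0: "\<And>z. z \<in> carrier (G (Suc (Suc n))) \<Longrightarrow> f (d z) = \<zero>\<^bsub>T.T\<^esub>"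
      let ?S = "free_gen R ` Y (Suc n)"
      have S: "finite ?S" "?S \<subseteq> carrier (G (Suc n))" using finite_Y gen_closed by auto
      obtain J where J: "finite J" "J \<subseteq> X" "\<And>z. z \<in> carrier (G (Suc n)) \<Longrightarrow> T.part J (f z) = f z"
      proof (rule T.ex_part_hom[OF G_module S f])
        show "h x = g x" if "h \<in> mod_hom R (G (Suc n)) T.T" "g \<in> mod_hom R (G (Suc n)) T.T"
          "\<And>x. x \<in> ?S \<Longrightarrow> h x = g x" "x \<in> carrier (G (Suc n))" for h g x
          by (rule mod_hom_free_eq[OF T.T that(1,2) _ that(4)]) (simp add: that(3))
      qed blast
      have "\<exists>g\<in>mod_hom R (G n) C. \<forall>z\<in>carrier (G (Suc n)). T.coord j (f z) = g (d z)" for j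
        by (rule hom_exactD[where ?E2.0 = "G (Suc (Suc n))" and ?d2.0 = d, OF _ mod_hom_comp[OF G_module f T.coord_hom]])
          (use ext in \<open>simp_all add: ext_acyclic_def 0 mod_hom_0[OF T.T C T.coord_hom]\<close>)
      then obtain g where g: "\<And>j. g j \<in> mod_hom R (G n) C"
        "\<And>j z. z \<in> carrier (G (Suc n)) \<Longrightarrow> T.coord j (f z) = g j (d z)" by metis
      have e: "free_gen R j \<in> carrier T.E" if "j \<in> J" for j using that J by (intro free_gen_closed[OF R]) auto
      let ?g = "\<lambda>z. \<Oplus>\<^bsub>T.T\<^esub>j\<in>J. T.t (free_gen R j) (g j z)"
      have "?g \<in> mod_hom R (G n) T.T"
        by (intro mod_hom_finsum[OF G_module T.T J(1)] mod_hom_comp[OF G_module g(1)] bilinear_mapD(2)[OF T.t_bilinear e])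
      moreover have "f z = ?g (d z)" if z: "z \<in> carrier (G (Suc n))" for z
        using J(3)[OF z] unfolding T.part_def g(2)[OF z] by simp
      ultimately show "\<exists>g\<in>mod_hom R (G n) T.T. \<forall>z\<in>carrier (G (Suc n)). f z = g (d z)"
        by (intro bexI[of _ ?g] ballI)
    qed
  qed
qed

text \<open>Flatness of projective modules, by double duality: the rows of a homomorphism into a
  free module are elements of \<open>G (Suc n)\<close>, vanishing on the dual differential makes
  them cycles, and \<open>G\<close> is exact.\<close>

lemma tor_acyclic_projective:
  fixes P :: "('r, 'p) module"
  assumes P: "projective_module R P"
  shows "tor_acyclic P"
  unfolding tor_acyclic_def
proof (intro allI hom_exactI)
  interpret R: cring R by (rule R)
  obtain X :: "'p set" and s q where PM: "Module.module R P" and s: "s \<in> mod_hom R P (free_module R X)"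
    and q: "q \<in> mod_hom R (free_module R X) P" and qs: "\<And>x. x \<in> carrier P \<Longrightarrow> q (s x) = x"
    by (rule projective_moduleE[OF P], rule that) (assumption | simp)+
  interpret P: Module.module R P by (rule PM)
  let ?E = "free_module R X"
  have E: "Module.module R ?E" by (rule free_module_is_module[OF R])
  fix n f assume f: "f \<in> mod_hom R (G (Suc n)) P"
    and 0: "\<And>z. z \<in> carrier (G n) \<Longrightarrow> f (dual_diff n z) = \<zero>\<^bsub>P\<^esub>"
  let ?f = "\<lambda>z. s (f z)"
  have sf: "?f \<in> mod_hom R (G (Suc n)) ?E" by (rule mod_hom_comp[OF G_module f s])
  note fE = mod_hom_D(1)[OF sf]
  define J where "J = (\<Union>y\<in>Y (Suc n). {j. ?f (free_gen R y) j \<noteq> \<zero>\<^bsub>R\<^esub>})"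
  have J: "finite J" "J \<subseteq> X"
    using finite_Y fE[OF gen_closed] by (auto simp: J_def free_module_def)
  \<comment> \<open>Row \<open>j\<close> of the matrix of \<open>?f\<close>, read as an element of
    \<open>G (Suc n)\<close>.\<close>
  define u where "u j = (\<lambda>y. if y \<in> Y (Suc n) then ?f (free_gen R y) j else \<zero>\<^bsub>R\<^esub>)" for j
  have u: "u j \<in> carrier (G (Suc n))" for j
  proof -
    have "finite {y. u j y \<noteq> \<zero>\<^bsub>R\<^esub>}" by (rule finite_subset[OF _ finite_Y[of "Suc n"]]) (auto simp: u_def)
    then show ?thesis using free_module_mem[OF fE[OF gen_closed] R]
      by (simp add: free_module_def) (simp add: u_def)
  qed
  have fu: "?f z j = free_pairing R (u j) z" if z: "z \<in> carrier (G (Suc n))" for z j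
    by (rule mod_hom_free_eq[OF M1_module mod_hom_comp[OF G_module sf mod_hom_coord[OF R]] pairing_hom[OF u] _ z])
      (simp only: pairing_gen[OF u], simp add: u_def)
  \<comment> \<open>Paired with a basis element of \<open>G n\<close>, \<open>d (u j)\<close> gives
    coordinate \<open>j\<close> of \<open>?f\<close> on the dual differential of that element, which
    is zero.\<close>
  have "d (u j) = (\<lambda>_. \<zero>\<^bsub>R\<^esub>)" for j
  proof
    fix y
    note du = mod_hom_D(1)[OF diff_hom u[of j]]
    show "d (u j) y = \<zero>\<^bsub>R\<^esub>"
    proof (cases "y \<in> Y n")
      case True
      note g = gen_closed[OF True]
      have "d (u j) y = free_pairing R (free_gen R y) (d (u j))" by (rule pairing_gen'[OF du True, symmetric])
      also have "\<dots> = free_pairing R (dual_diff n (free_gen R y)) (u j)" by (rule dual_adjoint[OF g u])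
      also have "\<dots> = free_pairing R (u j) (dual_diff n (free_gen R y))"
        by (rule pairing_comm[OF mod_hom_D(1)[OF dual_diff_hom g] u])
      also have "\<dots> = ?f (dual_diff n (free_gen R y)) j" by (rule fu[OF mod_hom_D(1)[OF dual_diff_hom g], symmetric])
      also have "\<dots> = \<zero>\<^bsub>R\<^esub>" using mod_hom_0[OF PM E s] by (simp add: 0[OF g] free_module_simps)
      finally show ?thesis .
    qed (use du in \<open>simp add: free_module_def\<close>)
  qed
  then have "u j \<in> d ` carrier (G (Suc (Suc n)))" for j using u unfolding diff_ker[symmetric] by simp
  then have "\<exists>w\<in>carrier (G (Suc (Suc n))). u j = d w" for j
    by (rule_tac imageE[where A = "carrier (G (Suc (Suc n)))"], assumption) (rule bexI)
  then obtain w where w: "\<And>j. w j \<in> carrier (G (Suc (Suc n)))" "\<And>j. u j = d (w j)" by metis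
  \<comment> \<open>The rows \<open>w j\<close> with \<open>d (w j) = u j\<close> form the matrix of
    the solution; \<open>q\<close> brings its values back into \<open>P\<close>.\<close>
  let ?g = "\<lambda>z. \<Oplus>\<^bsub>P\<^esub>j\<in>J. free_pairing R (w j) z \<odot>\<^bsub>P\<^esub> q (free_gen R j)"
  have e: "free_gen R j \<in> carrier ?E" if "j \<in> J" for j using that J by (intro free_gen_closed[OF R]) auto
  have g: "?g \<in> mod_hom R (G (Suc (Suc n))) P"
    by (intro mod_hom_finsum[OF G_module PM J(1)] mod_hom_smult_const[OF PM pairing_hom[OF w(1)]] mod_hom_D(1)[OF q e])
  have "f z = ?g (dual_diff (Suc n) z)" if z: "z \<in> carrier (G (Suc n))" for z
  proof -
    note dz = mod_hom_D(1)[OF dual_diff_hom z]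
    have "u j = (\<lambda>_. \<zero>\<^bsub>R\<^esub>)" if "j \<notin> J" for j using that by (auto simp: J_def u_def)
    then have "?f z j = \<zero>\<^bsub>R\<^esub>" if "j \<notin> J" for j
      using mod_hom_0[OF G_module M1_module pairing_hom'[OF z]] that unfolding fu[OF z]
      by (simp add: free_module_simps ring_as_module_simps)
    then have sub: "{j. ?f z j \<noteq> \<zero>\<^bsub>R\<^esub>} \<subseteq> J" by blast
    interpret ft: free_tensor R X C by (rule free_tensor.intro) (rule C)
    have "f z = q (?f z)" by (rule qs[OF mod_hom_D(1)[OF f z], symmetric])
    also have "\<dots> = (\<Oplus>\<^bsub>P\<^esub>j\<in>J. ?f z j \<odot>\<^bsub>P\<^esub> q (free_gen R j))"
      by (rule ft.free_gen_subset_expand[OF fE[OF z] J sub PM q])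
    also have "\<dots> = ?g (dual_diff (Suc n) z)"
    proof (rule P.M.finsum_cong')
      fix j assume j: "j \<in> J"
      have "?f z j = free_pairing R z (d (w j))" unfolding fu[OF z] w(2) using pairing_comm[OF u z] w(2) by simp
      also have "\<dots> = free_pairing R (dual_diff (Suc n) z) (w j)" by (rule dual_adjoint[OF z w(1)])
      also have "\<dots> = free_pairing R (w j) (dual_diff (Suc n) z)" by (rule pairing_comm[OF dz w(1)])
      finally show "?f z j \<odot>\<^bsub>P\<^esub> q (free_gen R j) = free_pairing R (w j) (dual_diff (Suc n) z) \<odot>\<^bsub>P\<^esub> q (free_gen R j)"
        by simp
    qed (auto intro!: P.smult_closed pairing_closed[OF w(1) dz] mod_hom_D(1)[OF q e])
    finally show ?thesis .
  qed
  then show "\<exists>g\<in>mod_hom R (G (Suc (Suc n))) P. \<forall>z\<in>carrier (G (Suc n)). f z = g (dual_diff (Suc n) z)"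
    by (intro bexI[OF _ g] ballI)
qed

end

section \<open>Cycles and boundaries\<close>

definition cycles :: "('r, 'a) mod_complex \<Rightarrow> int \<Rightarrow> 'a set" where
  "cycles X i = {x \<in> carrier (cx_mod X i). cx_diff X i x = \<zero>\<^bsub>cx_mod X (i - 1)\<^esub>}"

definition boundaries :: "('r, 'a) mod_complex \<Rightarrow> int \<Rightarrow> 'a set" where
  "boundaries X i = cx_diff X (i + 1) ` carrier (cx_mod X (i + 1))"

abbreviation cycle_module :: "('r, 'a) mod_complex \<Rightarrow> int \<Rightarrow> ('r, 'a) module" where
  "cycle_module X i \<equiv> (cx_mod X i)\<lparr>carrier := cycles X i\<rparr>"

abbreviation boundary_module :: "('r, 'a) mod_complex \<Rightarrow> int \<Rightarrow> ('r, 'a) module" where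
  "boundary_module X i \<equiv> (cx_mod X i)\<lparr>carrier := boundaries X i\<rparr>"

abbreviation homology_class :: "('r, 'a) mod_complex \<Rightarrow> int \<Rightarrow> 'a \<Rightarrow> 'a set" where
  "homology_class X i x \<equiv> boundaries X i +>\<^bsub>cycle_module X i\<^esub> x"

lemma homology_quot: "homology X i = quot_module (cycle_module X i) (boundaries X i)"
  by (simp add: homology_def cycles_def boundaries_def)

locale complex =
  fixes R :: "('r, 'k) ring_scheme" and X :: "('r, 'a) mod_complex"
  assumes is_complex: "is_complex R X"
begin

lemma cx_module: "Module.module R (cx_mod X i)"
  using is_complex by (simp add: is_complex_def)

lemma cx_diff_hom: "cx_diff X i \<in> mod_hom R (cx_mod X i) (cx_mod X (i - 1))"
  using is_complex by (simp add: is_complex_def)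

lemma cx_diff_hom': "cx_diff X (i + 1) \<in> mod_hom R (cx_mod X (i + 1)) (cx_mod X i)"
  using cx_diff_hom[of "i + 1"] by simp

lemma cx_diff_diff: "x \<in> carrier (cx_mod X i) \<Longrightarrow> cx_diff X (i - 1) (cx_diff X i x) = \<zero>\<^bsub>cx_mod X (i - 2)\<^esub>"
  using is_complex by (simp add: is_complex_def)

lemma cx_diff_diff': "x \<in> carrier (cx_mod X (i + 1)) \<Longrightarrow> cx_diff X i (cx_diff X (i + 1) x) = \<zero>\<^bsub>cx_mod X (i - 1)\<^esub>"
  using cx_diff_diff[of x "i + 1"] by simp

lemma cycles_submodule: "submodule (cycles X i) R (cx_mod X i)"
  unfolding cycles_def by (rule submodule_ker[OF cx_module cx_module cx_diff_hom])

lemma boundaries_submodule: "submodule (boundaries X i) R (cx_mod X i)"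
  unfolding boundaries_def by (rule submodule_im[OF cx_module cx_module cx_diff_hom'])

lemma boundaries_subset_cycles: "boundaries X i \<subseteq> cycles X i"
  using mod_hom_D(1)[OF cx_diff_hom'] cx_diff_diff' by (auto simp: boundaries_def cycles_def)

lemma cycles_subset: "cycles X i \<subseteq> carrier (cx_mod X i)"
  by (auto simp: cycles_def)

lemma cycle_module: "Module.module R (cycle_module X i)"
  by (rule submodule_module[OF cx_module cycles_submodule])

lemma boundary_module: "Module.module R (boundary_module X i)"
  by (rule submodule_module[OF cx_module boundaries_submodule])

lemma boundaries_submodule_cycles: "submodule (boundaries X i) R (cycle_module X i)"
  by (rule submodule_sub[OF cx_module cycles_submodule boundaries_submodule boundaries_subset_cycles])

lemmas quot = cycle_module boundaries_submodule_cycles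

lemma homology_module: "Module.module R (homology X i)"
  unfolding homology_quot by (rule quot_module_module[OF quot])

lemma class_hom: "homology_class X i \<in> mod_hom R (cycle_module X i) (homology X i)"
  unfolding homology_quot by (rule quot_proj_hom[OF quot])

lemma class_surj: "homology_class X i ` cycles X i = carrier (homology X i)"
  unfolding homology_quot using quot_proj_surj[OF quot] by simp

lemma class_zero_iff: "x \<in> cycles X i \<Longrightarrow> homology_class X i x = \<zero>\<^bsub>homology X i\<^esub> \<longleftrightarrow> x \<in> boundaries X i"
  unfolding homology_quot using quot_proj_zero_iff[OF quot] by simp

text \<open>The target is cut down to the boundaries in degree \<open>i - 1\<close>, which makes the
  differential surjective.\<close>

lemma cycle_ses: "module_ses R (cx_mod X i) (boundary_module X (i - 1)) (cx_diff X i) (cycles X i)"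
proof (rule module_ses.intro)
  show "cx_diff X i \<in> mod_hom R (cx_mod X i) (boundary_module X (i - 1))"
    by (rule mod_hom_codomain_sub[OF cx_diff_hom]) (simp add: boundaries_def)
  show "cx_diff X i ` carrier (cx_mod X i) = carrier (boundary_module X (i - 1))"
    by (simp add: boundaries_def)
  show "cycles X i = {x \<in> carrier (cx_mod X i). cx_diff X i x = \<zero>\<^bsub>boundary_module X (i - 1)\<^esub>}"
    by (simp add: cycles_def)
qed (rule cx_module boundary_module)+

lemma homology_ses: "module_ses R (cycle_module X i) (homology X i) (homology_class X i) (boundaries X i)"
proof (rule module_ses.intro)
  show "homology_class X i ` carrier (cycle_module X i) = carrier (homology X i)"
    using class_surj by simp
  show "boundaries X i = {x \<in> carrier (cycle_module X i). homology_class X i x = \<zero>\<^bsub>homology X i\<^esub>}"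
    using class_zero_iff subsetD[OF boundaries_subset_cycles] by auto
qed (rule cycle_module homology_module class_hom)+

lemma zero_module_boundary:
  assumes "zero_module (cx_mod X (i + 1))"
  shows "zero_module (boundary_module X i)"
  unfolding zero_module_def boundaries_def using assms mod_hom_0[OF cx_module cx_module cx_diff_hom']
  by (simp add: zero_module_def)

lemma zero_module_sub:
  assumes "zero_module (cx_mod X i)" "Module.module R ((cx_mod X i)\<lparr>carrier := K\<rparr>)" "K \<subseteq> carrier (cx_mod X i)"
  shows "zero_module ((cx_mod X i)\<lparr>carrier := K\<rparr>)"
  unfolding zero_module_iff[OF assms(2)] using assms(1,3) by (auto simp: zero_module_def)

lemma zero_module_homology:
  assumes "zero_module (cx_mod X i)"
  shows "zero_module (homology X i)"
proof -
  have "homology_class X i x = \<zero>\<^bsub>homology X i\<^esub>" if "x \<in> cycles X i" for x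
  proof -
    have "x = \<zero>\<^bsub>cycle_module X i\<^esub>" using assms cycles_subset that by (auto simp: zero_module_def)
    then show ?thesis using mod_hom_0[OF cycle_module homology_module class_hom] by simp
  qed
  then show ?thesis unfolding zero_module_iff[OF homology_module] class_surj[symmetric] by blast
qed

end

section \<open>Tensor products of complexes with a module\<close>

lemma tensor_complex_simps:
  "cx_mod (tensor_complex R X B) i = tensor_module R (cx_mod X i) B"
  "cx_diff (tensor_complex R X B) i = tensor_map R (cx_mod X (i - 1)) B (cx_diff X i)"
  by (simp_all add: tensor_complex_def tensor_map_def)

lemma tensor_is_complex:
  assumes X: "is_complex R X" and B: "Module.module R B"
  shows "is_complex R (tensor_complex R X B)"
proof -
  interpret complex R X by (rule complex.intro) (rule X)
  have T: "Module.module R (tensor_module R (cx_mod X i) B)" for i by (rule tensor_module_module[OF cx_module B])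
  note h = tensor_map_hom[OF cx_module B cx_module cx_diff_hom]
  note p = tensor_map_pure[OF cx_module B cx_module cx_diff_hom]
  have e: "i - 1 - 1 = i - 2" for i :: int by simp
  have h2: "tensor_map R (cx_mod X (i - 2)) B (cx_diff X (i - 1)) \<in>
      mod_hom R (tensor_module R (cx_mod X (i - 1)) B) (tensor_module R (cx_mod X (i - 2)) B)" for i
    using h[of "i - 1"] unfolding e .
  have "tensor_map R (cx_mod X (i - 2)) B (cx_diff X (i - 1)) (tensor_map R (cx_mod X (i - 1)) B (cx_diff X i) x) =
    \<zero>\<^bsub>tensor_module R (cx_mod X (i - 2)) B\<^esub>" if "x \<in> carrier (tensor_module R (cx_mod X i) B)" for i x
  proof (rule tensor_hom_eq[OF cx_module B T mod_hom_comp[OF T h h2] mod_hom_zero_map[OF T T] _ that])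
    fix a b assume ab: "a \<in> carrier (cx_mod X i)" "b \<in> carrier B"
    note da = mod_hom_D(1)[OF cx_diff_hom ab(1)]
    show "tensor_map R (cx_mod X (i - 2)) B (cx_diff X (i - 1))
        (tensor_map R (cx_mod X (i - 1)) B (cx_diff X i) (pure_tensor R (cx_mod X i) B a b)) =
      \<zero>\<^bsub>tensor_module R (cx_mod X (i - 2)) B\<^esub>"
      unfolding p[OF ab] p[OF da ab(2), unfolded e] cx_diff_diff[OF ab(1)]
      by (rule mod_hom_0[OF cx_module T bilinear_mapD(1)[OF pure_tensor_bilinear[OF cx_module B] ab(2)]])
  qed
  then show ?thesis unfolding is_complex_def tensor_complex_simps e using T h by simp
qed

lemma zero_module_tensor:
  assumes A: "Module.module R A" and B: "Module.module R B" and z: "zero_module A"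
  shows "zero_module (tensor_module R A B)"
  unfolding zero_module_iff[OF tensor_module_module[OF A B]]
proof
  fix w assume w: "w \<in> carrier (tensor_module R A B)"
  note T = tensor_module_module[OF A B]
  show "w = \<zero>\<^bsub>tensor_module R A B\<^esub>"
    by (rule tensor_hom_eq[OF A B T mod_hom_id mod_hom_zero_map[OF T T] _ w])
      (use z in \<open>simp add: zero_module_def mod_hom_0[OF A T bilinear_mapD(1)[OF pure_tensor_bilinear[OF A B]]]\<close>)
qed

section \<open>Dimension shifting for cycles and boundaries\<close>

context finite_resolution
begin

lemma ext_acyclic_middle:
  assumes "module_ses R B D p K" "ext_acyclic (B\<lparr>carrier := K\<rparr>)" "ext_acyclic D"
  shows "ext_acyclic B"
  using assms(2,3) unfolding ext_acyclic_def
  by (intro allI module_ses.hom_exact_middle[OF assms(1) refl G_module G_module diff_hom diff_hom diff_diff]) auto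

lemma ext_acyclic_quotient:
  assumes "module_ses R B D p K" "ext_acyclic (B\<lparr>carrier := K\<rparr>)" "ext_acyclic B"
  shows "ext_acyclic D"
  using assms(2,3) unfolding ext_acyclic_def
  by (intro allI module_ses.hom_exact_quotient[OF assms(1) refl G_module G_module G_module diff_hom diff_hom diff_hom diff_diff]) auto

lemma ext_acyclic_lift:
  assumes ses: "module_ses R B D p K" and K: "ext_acyclic (B\<lparr>carrier := K\<rparr>)" and h: "h \<in> mod_hom R C D"
  obtains h' where "h' \<in> mod_hom R C B" "\<And>c. c \<in> carrier C \<Longrightarrow> p (h' c) = h c"
  by (rule module_ses.hom_lift_from_cokernel[OF ses refl G_module G_module diff_hom diff_hom diff_diff
      C aug_hom aug_surj aug_ker _ h]) (use K in \<open>simp_all add: ext_acyclic_def that\<close>)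

lemma tor_acyclic_kernel:
  assumes "module_ses R B D p K" "tor_acyclic D" "tor_acyclic B"
  shows "tor_acyclic (B\<lparr>carrier := K\<rparr>)"
  using assms(2,3) unfolding tor_acyclic_def
  by (intro allI module_ses.hom_exact_kernel[OF assms(1) refl G_module G_module dual_diff_hom dual_diff_hom dual_dual]) auto

text \<open>The vanishing of Tor_1(C, D) in concrete form. The composite of \<open>w\<close> with
  the dual differential has values in \<open>K\<close> and represents zero in B \<otimes> C;
  factoring it through a map into \<open>K\<close> shows that it represents zero in K \<otimes> C
  already.\<close>

lemma tor_acyclic_correct:
  assumes ses: "module_ses R B D p K" and D: "tor_acyclic D" and w: "w \<in> mod_hom R (G (Suc 0)) B"
    and 0: "\<And>z. z \<in> carrier (G 0) \<Longrightarrow> p (w (dual_diff 0 z)) = \<zero>\<^bsub>D\<^esub>"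
  obtains w' where "w' \<in> mod_hom R (G (Suc 0)) (B\<lparr>carrier := K\<rparr>)"
    "\<And>z. z \<in> carrier (G 0) \<Longrightarrow> w' (dual_diff 0 z) = w (dual_diff 0 z)"
  by (rule module_ses.hom_correct_into_K[OF ses refl G_module G_module dual_diff_hom dual_diff_hom dual_dual _ w 0])
    (use D in \<open>simp_all add: tor_acyclic_def that\<close>)

lemma ext_acyclic_zero_module: "Module.module R A \<Longrightarrow> zero_module A \<Longrightarrow> ext_acyclic A"
  unfolding ext_acyclic_def by (intro allI hom_exact_zero_module G_module diff_hom)

lemma tor_acyclic_zero_module: "Module.module R A \<Longrightarrow> zero_module A \<Longrightarrow> tor_acyclic A"
  unfolding tor_acyclic_def by (intro allI hom_exact_zero_module G_module dual_diff_hom)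

lemma ext_acyclic_isomorphic_power:
  assumes "Module.module R A" "Module.module R B" "mod_isomorphic R A (power_module B n)" "ext_acyclic B"
  shows "ext_acyclic A"
  using assms(4) unfolding ext_acyclic_def
  by (intro allI hom_exact_isomorphic[OF G_module G_module diff_hom diff_hom assms(1) power_module_module[OF assms(2)] assms(3)]
      hom_exact_power[OF G_module G_module diff_hom diff_hom assms(2)]) auto

lemma tor_acyclic_isomorphic_power:
  assumes "Module.module R A" "Module.module R B" "mod_isomorphic R A (power_module B n)" "tor_acyclic B"
  shows "tor_acyclic A"
  using assms(4) unfolding tor_acyclic_def
  by (intro allI hom_exact_isomorphic[OF G_module G_module dual_diff_hom dual_diff_hom assms(1) power_module_module[OF assms(2)] assms(3)]
      hom_exact_power[OF G_module G_module dual_diff_hom dual_diff_hom assms(2)]) auto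

text \<open>Ext-acyclicity passes to extensions and to quotients by acyclic submodules, which forces
  the induction to descend from the upper bound.\<close>

lemma ext_acyclic_cycles_boundaries:
  assumes X: "is_complex R X" and ext: "\<And>i. ext_acyclic (cx_mod X i)" "\<And>i. ext_acyclic (homology X i)"
    and bd: "\<And>i. n < i \<Longrightarrow> zero_module (cx_mod X i)"
  shows "ext_acyclic (boundary_module X i)" "ext_acyclic (cycle_module X i)"
proof -
  interpret complex R X by (rule complex.intro) (rule X)
  have Z: "ext_acyclic (cycle_module X i)" if "ext_acyclic (boundary_module X i)" for i
    by (rule ext_acyclic_middle[OF homology_ses _ ext(2)]) (use that in simp)
  \<comment> \<open>Degree \<open>n\<close> itself is included: its boundaries come from degree
    \<open>n + 1\<close>, where the complex is zero.\<close>
  have above: "ext_acyclic (boundary_module X i)" if "n \<le> i" for i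
    by (rule ext_acyclic_zero_module[OF boundary_module zero_module_boundary[OF bd]]) (use that in simp)
  have below: "ext_acyclic (boundary_module X i)" if "i \<le> n" for i
    using that
  proof (induction i rule: int_le_induct)
    case base
    show ?case by (rule above) simp
  next
    case (step i)
    show ?case by (rule ext_acyclic_quotient[OF cycle_ses Z[OF step.IH] ext(1)])
  qed
  show B: "ext_acyclic (boundary_module X i)" using above below by (cases "i \<le> n") auto
  show "ext_acyclic (cycle_module X i)" by (rule Z[OF B])
qed

text \<open>Tor-acyclicity passes to kernels of surjections between acyclic modules, which forces
  the induction to ascend from the lower bound.\<close>

lemma tor_acyclic_boundaries:
  assumes X: "is_complex R X" and tor: "\<And>i. tor_acyclic (cx_mod X i)" "\<And>i. tor_acyclic (homology X i)"
    and bd: "\<And>i. i < m \<Longrightarrow> zero_module (cx_mod X i)"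
  shows "tor_acyclic (boundary_module X i)"
proof -
  interpret complex R X by (rule complex.intro) (rule X)
  have below: "tor_acyclic (boundary_module X i)" if "i < m" for i
    by (rule tor_acyclic_zero_module[OF boundary_module zero_module_sub[OF bd[OF that] boundary_module]])
      (rule submodule_subset[OF boundaries_submodule])
  \<comment> \<open>The start is \<open>m - 1\<close>, where boundaries still vanish. From degree
    \<open>i\<close> the induction passes to the cycles in degree \<open>i + 1\<close> and then to
    the boundaries there.\<close>
  have above: "tor_acyclic (boundary_module X i)" if "m - 1 \<le> i" for i
    using that
  proof (induction i rule: int_ge_induct)
    case base
    show ?case by (rule below) simp
  next
    case (step i)
    have "tor_acyclic (cycle_module X (i + 1))"
      by (rule tor_acyclic_kernel[OF cycle_ses _ tor(1)]) (use step.IH in simp)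
    from tor_acyclic_kernel[OF homology_ses tor(2) this] show ?case by simp
  qed
  show ?thesis using above below by (cases "i < m") auto
qed

end

section \<open>Comparing the homology of a complex before and after tensoring\<close>

lemma bilinear_curry:
  assumes A: "Module.module R A" and B: "Module.module R B" and \<beta>: "bilinear_map R A B D \<beta>"
  shows "(\<lambda>a. restrict (\<beta> a) (carrier B)) \<in> mod_hom R A (hom_module R B D)"
proof (rule mod_homI)
  show "restrict (\<beta> a) (carrier B) \<in> carrier (hom_module R B D)" if "a \<in> carrier A" for a
    by (rule restrict_mod_hom[OF B bilinear_mapD(2)[OF \<beta> that]])
qed (auto simp: hom_module_simps mod_hom_D[OF bilinear_mapD(1)[OF \<beta>]] intro!: restrict_ext)

lemma bilinear_map_sub:
  assumes "bilinear_map R A B D \<beta>" "K \<subseteq> carrier A"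
  shows "bilinear_map R (A\<lparr>carrier := K\<rparr>) B D \<beta>"
  using assms(2) by (intro bilinear_mapI mod_hom_domain_sub[OF bilinear_mapD(1)[OF assms(1)]])
    (auto intro: bilinear_mapD(2)[OF assms(1)])

lemma bilinear_map_into_sub:
  assumes "bilinear_map R A B D \<beta>" "\<And>a b. a \<in> carrier A \<Longrightarrow> b \<in> carrier B \<Longrightarrow> \<beta> a b \<in> K"
  shows "bilinear_map R A B (D\<lparr>carrier := K\<rparr>) \<beta>"
  using assms by (intro bilinear_mapI mod_hom_codomain_sub bilinear_mapD[OF assms(1)]) auto

locale semidualizing_resolution = finite_resolution R C Y \<psi>
  for R :: "('r, 'k) ring_scheme" and C :: "('r, 'c) module" and Y and \<psi> +
  assumes fin: "fin_gen R C"
    and homothety: "homothety C \<in> mod_iso R (ring_as_module R) (hom_module R C C)"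
    and ext_C: "ext_acyclic C"
begin

text \<open>The cycles of \<open>P\<close> in degree \<open>i\<close> form the common cover: a cycle
  \<open>x\<close> goes to its homology class and to the homomorphisms that send \<open>c\<close> to
  the components of the class of x \<otimes> c. \<open>H\<close> in all degrees yields acyclicity of
  cycles and boundaries, while \<open>Hi\<close> fixes the exponent.\<close>

lemma homology_tensor_imp_homology:
  fixes P :: "('r, 'p) mod_complex" and M :: "('r, 'm) module"
  assumes P: "is_complex R P" "\<And>i. projective_module R (cx_mod P i)"
    and bd: "\<And>i. n < i \<Longrightarrow> zero_module (cx_mod P i)"
    and M: "Module.module R M" "ext_acyclic M"
    and H: "\<And>i. \<exists>a. mod_isomorphic R (homology (tensor_complex R P C) i) (power_module M a)"
    and Hi: "mod_isomorphic R (homology (tensor_complex R P C) i) (power_module M a)"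
  shows "mod_isomorphic R (homology P i) (power_module (hom_module R C M) a)"
proof -
  let ?X = "tensor_complex R P C"
  interpret P: complex R P by (rule complex.intro) (rule P(1))
  have Xc: "is_complex R ?X" by (rule tensor_is_complex[OF P(1) C])
  interpret X: complex R ?X by (rule complex.intro) (rule Xc)
  note X_simps = tensor_complex_simps[of R P C]
  interpret PM: Module.module R "cx_mod P j" for j by (rule P.cx_module)
  have extX: "ext_acyclic (cx_mod ?X i)" for i
    unfolding X_simps by (rule ext_acyclic_projective_tensor[OF ext_C P(2)])
  have extH: "ext_acyclic (homology ?X i)" for i
    using H[of i] ext_acyclic_isomorphic_power[OF X.homology_module M(1) _ M(2)] by blast
  have bdX: "zero_module (cx_mod ?X i)" if "n < i" for i
    unfolding X_simps by (rule zero_module_tensor[OF P.cx_module C bd[OF that]])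
  note ext_bc = ext_acyclic_cycles_boundaries[OF Xc extX extH bdX]
  have extB: "ext_acyclic (boundary_module ?X i)" and extZ: "ext_acyclic (cycle_module ?X i)" for i
    by (rule ext_bc(1), assumption) (rule ext_bc(2), assumption)
  let ?t = "\<lambda>i. pure_tensor R (cx_mod P i) C"
  have tb: "bilinear_map R (cx_mod P i) C (cx_mod ?X i) (?t i)" for i
    unfolding X_simps by (rule pure_tensor_bilinear[OF P.cx_module C])
  have tc: "?t i x c \<in> carrier (cx_mod ?X i)" if "x \<in> carrier (cx_mod P i)" "c \<in> carrier C" for i x c
    by (rule mod_hom_D(1)[OF bilinear_mapD(2)[OF tb that(1)] that(2)])
  have dt: "cx_diff ?X i (?t i x c) = ?t (i - 1) (cx_diff P i x) c"
    if "x \<in> carrier (cx_mod P i)" "c \<in> carrier C" for i x c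
    unfolding X_simps by (rule tensor_map_pure[OF P.cx_module C P.cx_module P.cx_diff_hom that])
  \<comment> \<open>Injectivity, and with \<open>surj\<close> below surjectivity, of the natural map
    from \<open>P\<close> to Hom(C, P \<otimes> C) in each degree.\<close>
  have inj: "x = y" if xy: "x \<in> carrier (cx_mod P i)" "y \<in> carrier (cx_mod P i)"
      and eq: "\<And>c. c \<in> carrier C \<Longrightarrow> ?t i x c = ?t i y c" for i x y
  proof -
    have "x \<ominus>\<^bsub>cx_mod P i\<^esub> y = \<zero>\<^bsub>cx_mod P i\<^esub>"
    proof (rule projective_tensor_inj[OF C homothety P(2)])
      fix c assume c: "c \<in> carrier C"
      have "?t i (x \<ominus>\<^bsub>cx_mod P i\<^esub> y) c = ?t i x c \<ominus>\<^bsub>cx_mod ?X i\<^esub> ?t i y c"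
        by (rule mod_hom_diff[OF P.cx_module X.cx_module bilinear_mapD(1)[OF tb c] xy])
      also have "\<dots> = \<zero>\<^bsub>cx_mod ?X i\<^esub>"
        unfolding eq[OF c] using tc[OF xy(2) c] by (simp add: module_diff_eq_zero_iff[OF X.cx_module])
      finally show "?t i (x \<ominus>\<^bsub>cx_mod P i\<^esub> y) c = \<zero>\<^bsub>tensor_module R (cx_mod P i) C\<^esub>" unfolding X_simps .
    qed (use xy in simp)
    then show ?thesis using xy by (simp add: module_diff_eq_zero_iff[OF P.cx_module])
  qed
  have surj: "\<exists>x\<in>carrier (cx_mod P i). \<forall>c\<in>carrier C. h c = ?t i x c"
    if "h \<in> mod_hom R C (cx_mod ?X i)" for i h
    using projective_tensor_surj[OF C fin homothety P(2) that[unfolded X_simps]] by metis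
  obtain \<phi> where \<phi>: "\<phi> \<in> mod_hom R (homology ?X i) (power_module M a)"
    "bij_betw \<phi> (carrier (homology ?X i)) (carrier (power_module M a))"
    using Hi by (rule mod_isomorphicE)
  have Ma: "Module.module R (power_module M a)" by (rule power_module_module[OF M(1)])
  have \<phi>0: "\<phi> y = \<zero>\<^bsub>power_module M a\<^esub> \<longleftrightarrow> y = \<zero>\<^bsub>homology ?X i\<^esub>" if "y \<in> carrier (homology ?X i)" for y
  proof -
    interpret XH: Module.module R "homology ?X i" by (rule X.homology_module)
    show ?thesis using mod_hom_0[OF X.homology_module Ma \<phi>(1)] bij_betw_imp_inj_on[OF \<phi>(2)] that
      by (metis XH.M.zero_closed inj_onD)
  qed
  let ?W = "cycle_module P i" and ?L = "hom_module R C M"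
  have t_cycle: "?t i x c \<in> cycles ?X i" if "x \<in> cycles P i" "c \<in> carrier C" for x c
  proof -
    have x: "x \<in> carrier (cx_mod P i)" "cx_diff P i x = \<zero>\<^bsub>cx_mod P (i - 1)\<^esub>" using that by (auto simp: cycles_def)
    show ?thesis using tc[OF x(1) that(2)] dt[OF x(1) that(2)] mod_hom_0[OF P.cx_module X.cx_module bilinear_mapD(1)[OF tb that(2)]]
      by (simp add: cycles_def x(2))
  qed
  let ?c = "\<lambda>x c. homology_class ?X i (?t i x c)"
  have tW: "bilinear_map R ?W C (cycle_module ?X i) (?t i)"
    by (rule bilinear_map_into_sub[OF bilinear_map_sub[OF tb P.cycles_subset]]) (simp add: t_cycle)
  have cb: "bilinear_map R ?W C (homology ?X i) ?c"
    by (rule bilinear_map_comp[OF P.cycle_module C tW X.class_hom])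
  have kb: "bilinear_map R ?W C M (\<lambda>x c. \<phi> (?c x c) k)" if "k < a" for k
    by (rule bilinear_map_comp[OF P.cycle_module C cb mod_hom_comp[OF X.homology_module \<phi>(1) power_module_proj[OF that]]])
  define g where "g x = (\<lambda>k\<in>{..<a}. \<lambda>c\<in>carrier C. \<phi> (?c x c) k)" for x
  have gh: "g \<in> mod_hom R ?W (power_module ?L a)"
    unfolding g_def[abs_def] by (rule mod_hom_into_power[OF P.cycle_module bilinear_curry[OF P.cycle_module C kb]])
  have L: "Module.module R ?L" by (rule hom_module_module[OF C M(1)])
  have La: "Module.module R (power_module ?L a)" by (rule power_module_module[OF L])
  have cc: "?c x c \<in> carrier (homology ?X i)" if "x \<in> cycles P i" "c \<in> carrier C" for x c
    using mod_hom_D(1)[OF bilinear_mapD(2)[OF cb] that(2)] that(1) by simp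
  have ker: "homology_class P i x = \<zero>\<^bsub>homology P i\<^esub> \<longleftrightarrow> g x = \<zero>\<^bsub>power_module ?L a\<^esub>" if x: "x \<in> cycles P i" for x
  proof -
    have xP: "x \<in> carrier (cx_mod P i)" using x by (simp add: cycles_def)
    have "g x = \<zero>\<^bsub>power_module ?L a\<^esub> \<longleftrightarrow> (\<forall>c\<in>carrier C. \<phi> (?c x c) = \<zero>\<^bsub>power_module M a\<^esub>)"
    proof
      assume g0: "g x = \<zero>\<^bsub>power_module ?L a\<^esub>"
      show "\<forall>c\<in>carrier C. \<phi> (?c x c) = \<zero>\<^bsub>power_module M a\<^esub>"
      proof
        fix c assume c: "c \<in> carrier C"
        interpret Ma: Module.module R "power_module M a" by (rule Ma)
        show "\<phi> (?c x c) = \<zero>\<^bsub>power_module M a\<^esub>"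
        proof (rule power_module_eqI[OF mod_hom_D(1)[OF \<phi>(1) cc[OF x c]] Ma.M.zero_closed])
          fix k assume k: "k < a"
          then have "g x k c = \<zero>\<^bsub>M\<^esub>" unfolding g0 using c by (simp add: power_module_simps hom_module_simps)
          then show "\<phi> (?c x c) k = \<zero>\<^bsub>power_module M a\<^esub> k" using k c by (simp add: g_def power_module_simps)
        qed
      qed
    next
      assume "\<forall>c\<in>carrier C. \<phi> (?c x c) = \<zero>\<^bsub>power_module M a\<^esub>"
      then show "g x = \<zero>\<^bsub>power_module ?L a\<^esub>"
        unfolding g_def power_module_simps hom_module_simps by (intro restrict_ext) simp
    qed
    also have "\<dots> \<longleftrightarrow> (\<forall>c\<in>carrier C. ?t i x c \<in> boundaries ?X i)"
      using \<phi>0[OF cc[OF x]] X.class_zero_iff[OF t_cycle[OF x]] by auto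
    also have "\<dots> \<longleftrightarrow> x \<in> boundaries P i"
    proof
      \<comment> \<open>Acyclicity of the cycles in degree \<open>i + 1\<close> lifts the
        homomorphism \<open>?t i x\<close> along the differential. The lift is given by tensoring
        with some \<open>y\<close>, and injectivity turns this into \<open>x = d y\<close>.\<close>
      assume b: "\<forall>c\<in>carrier C. ?t i x c \<in> boundaries ?X i"
      have "?t i x \<in> mod_hom R C (boundary_module ?X i)"
        by (rule mod_hom_codomain_sub[OF bilinear_mapD(2)[OF tb xP]]) (use b in simp)
      then have h: "?t i x \<in> mod_hom R C (boundary_module ?X (i + 1 - 1))" by simp
      obtain h' where h': "h' \<in> mod_hom R C (cx_mod ?X (i + 1))"
        "\<And>c. c \<in> carrier C \<Longrightarrow> cx_diff ?X (i + 1) (h' c) = ?t i x c"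
        using ext_acyclic_lift[OF X.cycle_ses extZ h] by blast
      obtain y where y: "y \<in> carrier (cx_mod P (i + 1))" "\<And>c. c \<in> carrier C \<Longrightarrow> h' c = ?t (i + 1) y c"
        using surj[OF h'(1)] by blast
      have "x = cx_diff P (i + 1) y"
      proof (rule inj[OF xP mod_hom_D(1)[OF P.cx_diff_hom' y(1)]])
        fix c assume c: "c \<in> carrier C"
        show "?t i x c = ?t i (cx_diff P (i + 1) y) c"
          using h'(2)[OF c] dt[OF y(1) c] unfolding y(2)[OF c] by simp
      qed
      then show "x \<in> boundaries P i" using y(1) by (simp add: boundaries_def)
    next
      assume "x \<in> boundaries P i"
      then obtain y where y: "y \<in> carrier (cx_mod P (i + 1))" "x = cx_diff P (i + 1) y"
        unfolding boundaries_def by (elim imageE)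
      show "\<forall>c\<in>carrier C. ?t i x c \<in> boundaries ?X i"
      proof
        fix c assume c: "c \<in> carrier C"
        have "?t i x c = cx_diff ?X (i + 1) (?t (i + 1) y c)" using dt[OF y(1) c] y(2) by simp
        then show "?t i x c \<in> boundaries ?X i" unfolding boundaries_def by (rule image_eqI) (rule tc[OF y(1) c])
      qed
    qed
    finally show ?thesis using P.class_zero_iff[OF x] by simp
  qed
  have "carrier (power_module ?L a) \<subseteq> g ` carrier ?W"
  proof
    fix h assume h: "h \<in> carrier (power_module ?L a)"
    have hk: "h k \<in> carrier ?L" if "k < a" for k using h that by (auto simp: power_module_simps)
    \<comment> \<open>The \<open>a\<close> given homomorphisms are assembled into one from
      \<open>C\<close> to the homology; acyclicity of the boundaries then lifts it to the
      cycles.\<close>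
    define h0 where "h0 c = inv_into (carrier (homology ?X i)) \<phi> (\<lambda>k\<in>{..<a}. h k c)" for c
    have e: "(\<lambda>c. \<lambda>k\<in>{..<a}. h k c) \<in> mod_hom R C (power_module M a)"
      by (rule mod_hom_into_power[OF C hom_module_mod_hom[OF hk]])
    have h0: "h0 \<in> mod_hom R C (homology ?X i)" unfolding h0_def[abs_def]
      by (rule mod_hom_comp[OF C e mod_hom_inv_into[OF X.homology_module Ma \<phi>]])
    have \<phi>h0: "\<phi> (h0 c) = (\<lambda>k\<in>{..<a}. h k c)" if "c \<in> carrier C" for c
      unfolding h0_def by (rule bij_betw_inv_into_right[OF \<phi>(2) mod_hom_D(1)[OF e that]])
    obtain h' where h': "h' \<in> mod_hom R C (cycle_module ?X i)"
      "\<And>c. c \<in> carrier C \<Longrightarrow> homology_class ?X i (h' c) = h0 c"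
      using ext_acyclic_lift[OF X.homology_ses _ h0] extB by auto
    note h'X = mod_hom_sub_D[OF h'(1) X.cycles_subset]
    obtain x where x: "x \<in> carrier (cx_mod P i)" "\<And>c. c \<in> carrier C \<Longrightarrow> h' c = ?t i x c"
      using surj[OF h'X(1)] by blast
    \<comment> \<open>The values of \<open>h'\<close> are cycles, so d x \<otimes> c vanishes for
      every \<open>c\<close>, which forces \<open>d x = 0\<close>.\<close>
    have "cx_diff P i x = \<zero>\<^bsub>cx_mod P (i - 1)\<^esub>"
    proof (rule inj[OF mod_hom_D(1)[OF P.cx_diff_hom x(1)] PM.M.zero_closed])
      fix c assume c: "c \<in> carrier C"
      have "?t (i - 1) (cx_diff P i x) c = cx_diff ?X i (h' c)" unfolding x(2)[OF c] dt[OF x(1) c] ..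
      also have "\<dots> = \<zero>\<^bsub>cx_mod ?X (i - 1)\<^esub>" using h'X(2)[OF c] by (simp add: cycles_def)
      also have "\<dots> = ?t (i - 1) \<zero>\<^bsub>cx_mod P (i - 1)\<^esub> c"
        by (rule mod_hom_0[OF P.cx_module X.cx_module bilinear_mapD(1)[OF tb c], symmetric])
      finally show "?t (i - 1) (cx_diff P i x) c = ?t (i - 1) \<zero>\<^bsub>cx_mod P (i - 1)\<^esub> c" .
    qed
    then have xW: "x \<in> carrier ?W" using x(1) by (simp add: cycles_def)
    have "g x = h"
    proof (rule power_module_eqI[OF mod_hom_D(1)[OF gh xW] h])
      fix k assume k: "k < a"
      show "g x k = h k"
      proof (rule hom_module_eqI[OF _ hk[OF k]])
        show "g x k \<in> carrier ?L" using mod_hom_D(1)[OF gh xW] k by (auto simp: power_module_simps)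
        fix c assume c: "c \<in> carrier C"
        have "g x k c = \<phi> (homology_class ?X i (h' c)) k" using k c by (simp add: g_def x(2))
        also have "\<dots> = h k c" unfolding h'(2)[OF c] \<phi>h0[OF c] using k by simp
        finally show "g x k c = h k c" .
      qed
    qed
    then show "h \<in> g ` carrier ?W" using xW by blast
  qed
  moreover have "g ` carrier ?W \<subseteq> carrier (power_module ?L a)" using mod_hom_D(1)[OF gh] by blast
  ultimately have g_surj: "g ` carrier ?W = carrier (power_module ?L a)" by simp
  show ?thesis
    by (rule mod_isomorphic_common_cover[OF P.cycle_module P.homology_module La P.class_hom _ gh g_surj])
      (simp_all add: P.class_surj ker)
qed

end

context finite_resolution
begin

text \<open>Since tensors are represented by homomorphisms from \<open>G 0\<close>, the common cover
  \<open>?W\<close> consists of homomorphisms from \<open>G 0\<close> into the cycles of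
  \<open>P\<close>. \<open>\<mu>\<close> takes the homology class of the tensor,
  \<open>\<nu>\<close> evaluates the images in powers of \<open>L\<close>. Acyclicity enters in
  \<open>\<mu>_surj\<close> and \<open>\<mu>_imp_\<nu>\<close>.\<close>

lemma homology_imp_homology_tensor:
  fixes P :: "('r, 'p) mod_complex" and M :: "('r, 'm) module"
  defines "L \<equiv> hom_module R C M"
  assumes P: "is_complex R P" "\<And>i. projective_module R (cx_mod P i)"
    and bd: "\<And>i. i < m \<Longrightarrow> zero_module (cx_mod P i)"
    and M: "Module.module R M" and tor: "tor_acyclic L"
    and ev: "tensor_lift R M (\<lambda>c f. f c) \<in> mod_iso R (tensor_module R C L) M"
    and H: "\<And>i. \<exists>a. mod_isomorphic R (homology P i) (power_module L a)"
    and Hi: "mod_isomorphic R (homology P i) (power_module L a)"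
  shows "mod_isomorphic R (homology (tensor_complex R P C) i) (power_module M a)"
proof -
  let ?X = "tensor_complex R P C"
  interpret P: complex R P by (rule complex.intro) (rule P(1))
  have Xc: "is_complex R ?X" by (rule tensor_is_complex[OF P(1) C])
  interpret X: complex R ?X by (rule complex.intro) (rule Xc)
  note X_simps = tensor_complex_simps[of R P C]
  have L: "Module.module R L" unfolding L_def by (rule hom_module_module[OF C M])
  have torP: "tor_acyclic (cx_mod P j)" for j by (rule tor_acyclic_projective[OF P(2)])
  have torH: "tor_acyclic (homology P j)" for j
    using H[of j] tor_acyclic_isomorphic_power[OF P.homology_module L _ tor] by blast
  note torB = tor_acyclic_boundaries[OF P(1) torP torH bd]
  let ?t = "\<lambda>j. pure_tensor R (cx_mod P j) C"
  let ?s = "\<lambda>j. tensor_sum (cx_mod ?X j) (?t j)"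
  have tb: "bilinear_map R (cx_mod P j) C (cx_mod ?X j) (?t j)" for j
    unfolding X_simps by (rule pure_tensor_bilinear[OF P.cx_module C])
  note s_closed = tensor_sum_closed[OF P.cx_module X.cx_module tb]
  note s_cong = tensor_sum_cong[OF P.cx_module X.cx_module tb]
  note s_add = tensor_sum_add[OF P.cx_module X.cx_module tb]
  note s_dual = tensor_sum_dual[OF P.cx_module X.cx_module tb]
  have s_surj: thesis if "x \<in> carrier (cx_mod ?X j)"
    "\<And>v. v \<in> mod_hom R (G 0) (cx_mod P j) \<Longrightarrow> x = ?s j v \<Longrightarrow> thesis" for x j thesis
  proof (rule tensor_sum_surj[OF P.cx_module X.cx_module tb])
    show "x \<in> K" if "submodule K R (cx_mod ?X j)"
      "\<And>a c. a \<in> carrier (cx_mod P j) \<Longrightarrow> c \<in> carrier C \<Longrightarrow> ?t j a c \<in> K" for K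
      by (rule tensor_induct_submodule[OF P.cx_module C that(1)[unfolded X_simps] that(2)])
        (use \<open>x \<in> _\<close> in \<open>simp_all add: X_simps\<close>)
  qed (rule that(2))
  have s_zero: thesis if v: "v \<in> mod_hom R (G 0) (cx_mod P j)" and 0: "?s j v = \<zero>\<^bsub>cx_mod ?X j\<^esub>"
    and w: "\<And>w. w \<in> mod_hom R (G (Suc 0)) (cx_mod P j) \<Longrightarrow>
      (\<And>z. z \<in> carrier (G 0) \<Longrightarrow> v z = w (dual_diff 0 z)) \<Longrightarrow> thesis" for v j thesis
  proof (rule tensor_sum_zeroD[OF P.cx_module X.cx_module tb _ v 0])
    show "\<exists>f\<in>mod_hom R (cx_mod ?X j) D. \<forall>a\<in>carrier (cx_mod P j). \<forall>c\<in>carrier C. f (?t j a c) = \<beta> a c"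
      if "Module.module R D" "bilinear_map R (cx_mod P j) C D \<beta>"
      for D :: "('r, (((('r, 'c) res_gen \<Rightarrow> 'r) \<Rightarrow> 'p) set)) module" and \<beta>
      unfolding X_simps
      using tensor_lift_hom[OF P.cx_module C that] tensor_lift_pure[OF P.cx_module C that] by blast
  qed (rule w)
  have s_diff: "cx_diff ?X j (?s j v) = ?s (j - 1) (\<lambda>z. cx_diff P j (v z))"
    if "v \<in> mod_hom R (G 0) (cx_mod P j)" for v j
    by (rule tensor_sum_comp[OF X.cx_module X.cx_module tb that X.cx_diff_hom])
      (use tensor_map_pure[OF P.cx_module C P.cx_module P.cx_diff_hom] in \<open>simp add: X_simps\<close>)
  obtain \<phi> where \<phi>: "\<phi> \<in> mod_hom R (homology P i) (power_module L a)"
    "bij_betw \<phi> (carrier (homology P i)) (carrier (power_module L a))"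
    using Hi by (rule mod_isomorphicE)
  have La: "Module.module R (power_module L a)" by (rule power_module_module[OF L])
  have Ma: "Module.module R (power_module M a)" by (rule power_module_module[OF M])
  let ?\<phi>' = "inv_into (carrier (homology P i)) \<phi>"
  have \<phi>': "?\<phi>' \<in> mod_hom R (power_module L a) (homology P i)"
    by (rule mod_hom_inv_into[OF P.homology_module La \<phi>])
  have \<phi>\<phi>': "\<phi> (?\<phi>' y) = y" if "y \<in> carrier (power_module L a)" for y
    by (rule bij_betw_inv_into_right[OF \<phi>(2) that])
  let ?Z = "cycle_module P i" and ?B = "boundary_module P i"
  let ?h = "homology_class P i"
  define f where "f k x = \<phi> (?h x) k" for k x
  have f: "f k \<in> mod_hom R ?Z L" if "k < a" for k
    unfolding f_def[abs_def]
    by (rule mod_hom_comp[OF P.cycle_module P.class_hom mod_hom_comp[OF P.homology_module \<phi>(1) power_module_proj[OF that]]])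
  have eb: "bilinear_map R L C M (\<lambda>l c. l c)"
    unfolding L_def by (rule bilinear_mapI[OF mod_hom_eval hom_module_mod_hom])
  \<comment> \<open>The evaluation map lives on C \<otimes> L, whereas the complex carries
    \<open>C\<close> on the right; \<open>?u\<close> and the flipped bilinear maps absorb the
    exchange.\<close>
  let ?T = "tensor_module R C L" and ?ev = "tensor_lift R M (\<lambda>c l. l c)"
  let ?u = "\<lambda>l c. pure_tensor R C L c l"
  have T: "Module.module R ?T" by (rule tensor_module_module[OF C L])
  have ub: "bilinear_map R L C ?T ?u" by (rule bilinear_map_flip[OF pure_tensor_bilinear[OF C L]])
  have ev_hom: "?ev \<in> mod_hom R ?T M" and ev_bij: "bij_betw ?ev (carrier ?T) (carrier M)"
    using ev by (simp_all add: mod_iso_def)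
  have ev_sum: "?ev (tensor_sum ?T ?u v) = tensor_sum M (\<lambda>l c. l c) v" if "v \<in> mod_hom R (G 0) L" for v
    by (rule tensor_sum_comp[OF T M ub that ev_hom, of "\<lambda>l c. l c" "\<lambda>l. l"])
      (rule tensor_lift_pure[OF C L M bilinear_map_flip[OF eb]])
  let ?W = "hom_module R (G 0) ?Z"
  have W: "Module.module R ?W" by (rule hom_module_module[OF G_module P.cycle_module])
  have incl: "(\<lambda>x. x) \<in> mod_hom R ?Z (cx_mod P i)"
    by (rule mod_hom_domain_sub[OF mod_hom_id P.cycles_subset])
  have WP: "v \<in> mod_hom R (G 0) (cx_mod P i)" "\<And>z. z \<in> carrier (G 0) \<Longrightarrow> v z \<in> cycles P i"
    if "v \<in> mod_hom R (G 0) ?Z" for v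
    using mod_hom_sub_D[OF that P.cycles_subset] by auto
  \<comment> \<open>Restriction to the carrier of \<open>G 0\<close> puts the arguments into the
    extensional form of \<open>hom_module\<close>; the facts \<open>\<mu>\<close> and
    \<open>\<nu>_k\<close> below remove it again.\<close>
  define \<mu> where "\<mu> v = homology_class ?X i (?s i (\<lambda>z\<in>carrier (G 0). v z))" for v
  define \<nu> where "\<nu> v = (\<lambda>k\<in>{..<a}. tensor_sum M (\<lambda>l c. l c) (\<lambda>z\<in>carrier (G 0). f k (v z)))" for v
  have s_cycle: "?s i v \<in> cycles ?X i" if v: "v \<in> mod_hom R (G 0) ?Z" for v
  proof -
    have "cx_diff ?X i (?s i v) = ?s (i - 1) (\<lambda>z. cx_diff P i (v z))" by (rule s_diff[OF WP(1)[OF v]])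
    \<comment> \<open>The zero map is written as a composite with the dual differential so that
      \<open>s_dual\<close> applies.\<close>
    also have "\<dots> = ?s (i - 1) (\<lambda>z. (\<lambda>_. \<zero>\<^bsub>cx_mod P (i - 1)\<^esub>) (dual_diff 0 z))"
      by (rule s_cong[OF mod_hom_zero_map[OF G_module P.cx_module]]) (use WP(2)[OF v] in \<open>simp add: cycles_def\<close>)
    also have "\<dots> = \<zero>\<^bsub>cx_mod ?X (i - 1)\<^esub>" by (rule s_dual[OF mod_hom_zero_map[OF G_module P.cx_module]])
    finally show ?thesis using s_closed[OF WP(1)[OF v]] by (simp add: cycles_def)
  qed
  have \<mu>: "\<mu> v = homology_class ?X i (?s i v)" if "v \<in> mod_hom R (G 0) ?Z" for v
    unfolding \<mu>_def by (subst s_cong[OF WP(1)[OF that]]) simp_all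
  have \<mu>_hom: "\<mu> \<in> mod_hom R ?W (homology ?X i)"
  proof -
    have "(\<lambda>v. ?s i (\<lambda>z\<in>carrier (G 0). v z)) \<in> mod_hom R ?W (cx_mod ?X i)"
      by (rule mod_hom_comp[OF W mod_hom_postcompose[OF G_module incl] tensor_sum_hom[OF P.cx_module X.cx_module tb]])
    then have "(\<lambda>v. ?s i (\<lambda>z\<in>carrier (G 0). v z)) \<in> mod_hom R ?W (cycle_module ?X i)"
    proof (rule mod_hom_codomain_sub)
      fix v assume v: "v \<in> carrier ?W"
      note v' = hom_module_mod_hom[OF v]
      show "?s i (\<lambda>z\<in>carrier (G 0). v z) \<in> cycles ?X i"
        using s_cycle[OF v'] s_cong[OF WP(1)[OF v'], of "\<lambda>z\<in>carrier (G 0). v z"] by simp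
    qed
    then show ?thesis unfolding \<mu>_def[abs_def] by (rule mod_hom_comp[OF W _ X.class_hom])
  qed
  have \<nu>_hom: "\<nu> \<in> mod_hom R ?W (power_module M a)"
    unfolding \<nu>_def[abs_def]
    by (rule mod_hom_into_power[OF W])
      (rule mod_hom_comp[OF W mod_hom_postcompose[OF G_module f] tensor_sum_hom[OF L M eb]])
  have fv: "(\<lambda>z. f k (v z)) \<in> mod_hom R (G 0) L" if "v \<in> mod_hom R (G 0) ?Z" "k < a" for v k
    by (rule mod_hom_comp[OF G_module that(1) f[OF that(2)]])
  have \<nu>_k: "\<nu> v k = tensor_sum M (\<lambda>l c. l c) (\<lambda>z. f k (v z))" if "v \<in> mod_hom R (G 0) ?Z" "k < a" for v k
    unfolding \<nu>_def using that(2) tensor_sum_cong[OF L M eb fv[OF that], of "\<lambda>z\<in>carrier (G 0). f k (v z)"] by simp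
  note ses1 = P.cycle_ses and ses2 = P.homology_ses
  interpret PM: Module.module R "cx_mod P j" for j by (rule P.cx_module)
  interpret MM: Module.module R "power_module M a" by (rule Ma)
  have \<mu>_surj: "\<mu> ` carrier ?W = carrier (homology ?X i)"
  proof
    show "\<mu> ` carrier ?W \<subseteq> carrier (homology ?X i)" using mod_hom_D(1)[OF \<mu>_hom] by blast
    show "carrier (homology ?X i) \<subseteq> \<mu> ` carrier ?W"
    proof
      fix y assume "y \<in> carrier (homology ?X i)"
      then have "y \<in> homology_class ?X i ` cycles ?X i" unfolding X.class_surj .
      then obtain x where x: "x \<in> cycles ?X i" "y = homology_class ?X i x" by (elim imageE)
      \<comment> \<open>The values of \<open>v\<close> need not be cycles; only the tensor that
        \<open>d v\<close> represents is zero, so \<open>d v\<close> factors through the dual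
        differential by some \<open>w\<close>. This \<open>w\<close> is moved into the cycles, then
        into the boundaries, and lifted to \<open>w3\<close>. Subtracting \<open>w3\<close> composed
        with the dual differential makes \<open>v\<close> cycle-valued and leaves the tensor
        unchanged.\<close>
      obtain v where v: "v \<in> mod_hom R (G 0) (cx_mod P i)" "x = ?s i v"
        by (rule s_surj[OF subsetD[OF X.cycles_subset x(1)]]) (rule that)
      note dv = mod_hom_comp[OF G_module v(1) P.cx_diff_hom]
      have "?s (i - 1) (\<lambda>z. cx_diff P i (v z)) = \<zero>\<^bsub>cx_mod ?X (i - 1)\<^esub>"
        using x(1) unfolding s_diff[OF v(1), symmetric] v(2) by (simp add: cycles_def)
      then obtain w where w: "w \<in> mod_hom R (G (Suc 0)) (cx_mod P (i - 1))"
        "\<And>z. z \<in> carrier (G 0) \<Longrightarrow> cx_diff P i (v z) = w (dual_diff 0 z)"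
        by (rule s_zero[OF dv]) (rule that)
      have "cx_diff P (i - 1) (w (dual_diff 0 z)) = \<zero>\<^bsub>boundary_module P (i - 1 - 1)\<^esub>" if "z \<in> carrier (G 0)" for z
        using P.cx_diff_diff[OF mod_hom_D(1)[OF v(1) that]] unfolding w(2)[OF that] by simp
      \<comment> \<open>Acyclicity of the boundaries in degree \<open>i - 2\<close> is used here,
        that of the homology in degree \<open>i - 1\<close> in the next correction.\<close>
      from tor_acyclic_correct[OF ses1 torB w(1) this]
      obtain w1 where w1: "w1 \<in> mod_hom R (G (Suc 0)) (cycle_module P (i - 1))"
        "\<And>z. z \<in> carrier (G 0) \<Longrightarrow> w1 (dual_diff 0 z) = w (dual_diff 0 z)" by blast
      have "homology_class P (i - 1) (w1 (dual_diff 0 z)) = \<zero>\<^bsub>homology P (i - 1)\<^esub>" if z: "z \<in> carrier (G 0)" for z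
      proof -
        have "cx_diff P i (v z) \<in> boundaries P (i - 1)"
          using mod_hom_D(1)[OF v(1) z] by (simp add: boundaries_def)
        then show ?thesis unfolding w1(2)[OF z] w(2)[OF z, symmetric]
          using P.class_zero_iff subsetD[OF P.boundaries_subset_cycles] by blast
      qed
      from tor_acyclic_correct[OF ses2 torH w1(1) this]
      obtain w2 where w2: "w2 \<in> mod_hom R (G (Suc 0)) ((cycle_module P (i - 1))\<lparr>carrier := boundaries P (i - 1)\<rparr>)"
        "\<And>z. z \<in> carrier (G 0) \<Longrightarrow> w2 (dual_diff 0 z) = w1 (dual_diff 0 z)" by blast
      have "w2 \<in> mod_hom R (G (Suc 0)) (boundary_module P (i - 1))" using w2(1) by simp
      from module_ses.free_lifting[OF ses1 this]
      obtain w3 where w3: "w3 \<in> mod_hom R (G (Suc 0)) (cx_mod P i)"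
        "\<And>z. z \<in> carrier (G (Suc 0)) \<Longrightarrow> cx_diff P i (w3 z) = w2 z" by blast
      note w3d = mod_hom_comp[OF G_module dual_diff_hom w3(1)]
      let ?v = "\<lambda>z. v z \<ominus>\<^bsub>cx_mod P i\<^esub> w3 (dual_diff 0 z)"
      have v': "?v \<in> mod_hom R (G 0) (cx_mod P i)"
        by (rule mod_hom_minus[OF G_module P.cx_module v(1) w3d])
      have "cx_diff P i (?v z) = \<zero>\<^bsub>cx_mod P (i - 1)\<^esub>" if z: "z \<in> carrier (G 0)" for z
      proof -
        have "cx_diff P i (?v z) = cx_diff P i (v z) \<ominus>\<^bsub>cx_mod P (i - 1)\<^esub> cx_diff P i (w3 (dual_diff 0 z))"
          by (rule mod_hom_diff[OF P.cx_module P.cx_module P.cx_diff_hom mod_hom_D(1)[OF v(1) z] mod_hom_D(1)[OF w3d z]])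
        also have "cx_diff P i (w3 (dual_diff 0 z)) = cx_diff P i (v z)"
          using w3(2)[OF mod_hom_D(1)[OF dual_diff_hom z]] w2(2)[OF z] w1(2)[OF z] w(2)[OF z] by simp
        finally show ?thesis using mod_hom_D(1)[OF dv z] by (simp add: module_diff_eq_zero_iff[OF P.cx_module])
      qed
      then have vZ: "?v \<in> mod_hom R (G 0) ?Z"
        using mod_hom_D(1)[OF v'] by (intro mod_hom_codomain_sub[OF v']) (simp add: cycles_def)
      have "x = ?s i (\<lambda>z. ?v z \<oplus>\<^bsub>cx_mod P i\<^esub> w3 (dual_diff 0 z))"
        unfolding v(2)
        by (rule s_cong[OF mod_hom_add[OF G_module P.cx_module v' w3d]])
          (simp add: PM.M.minus_eq PM.M.a_assoc PM.M.l_neg mod_hom_D(1)[OF v(1)] mod_hom_D(1)[OF w3d])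
      also have "\<dots> = ?s i ?v" unfolding s_add[OF v' w3d] s_dual[OF w3(1)]
        using s_closed[OF v'] X.cx_module[of i, THEN Module.module.axioms(2)]
        by (simp add: abelian_group_def abelian_monoid.r_zero)
      finally have eq: "y = \<mu> (restrict ?v (carrier (G 0)))"
        using s_cong[OF v', of "restrict ?v (carrier (G 0))"]
        unfolding x(2) \<mu>[OF hom_module_mod_hom[OF restrict_mod_hom[OF G_module vZ]]] by simp
      show "y \<in> \<mu> ` carrier ?W" by (rule image_eqI, rule eq, rule restrict_mod_hom[OF G_module vZ])
    qed
  qed
  have \<nu>_surj: "\<nu> ` carrier ?W = carrier (power_module M a)"
  proof
    show "\<nu> ` carrier ?W \<subseteq> carrier (power_module M a)" using mod_hom_D(1)[OF \<nu>_hom] by blast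
    show "carrier (power_module M a) \<subseteq> \<nu> ` carrier ?W"
    proof
      fix y assume y: "y \<in> carrier (power_module M a)"
      have "\<exists>v\<in>mod_hom R (G 0) L. y k = tensor_sum M (\<lambda>l c. l c) v" if k: "k < a" for k
      proof -
        have "y k \<in> ?ev ` carrier ?T" using y k bij_betw_imp_surj_on[OF ev_bij] by (auto simp: power_module_simps)
        then obtain x where x: "x \<in> carrier ?T" "y k = ?ev x" by (elim imageE)
        obtain v where v: "v \<in> mod_hom R (G 0) L" "x = tensor_sum ?T ?u v"
        proof (rule tensor_sum_surj[OF L T ub])
          show "x \<in> K" if "submodule K R ?T" "\<And>l c. l \<in> carrier L \<Longrightarrow> c \<in> carrier C \<Longrightarrow> ?u l c \<in> K" for K
            by (rule tensor_induct_submodule[OF C L that(1) that(2) x(1)])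
        qed (rule that)
        show ?thesis using v(1) unfolding x(2) v(2) ev_sum[OF v(1)] by blast
      qed
      then obtain v where v: "\<And>k. k < a \<Longrightarrow> v k \<in> mod_hom R (G 0) L"
        "\<And>k. k < a \<Longrightarrow> y k = tensor_sum M (\<lambda>l c. l c) (v k)" by metis
      let ?v = "\<lambda>z. \<lambda>k\<in>{..<a}. v k z"
      have vh: "?v \<in> mod_hom R (G 0) (power_module L a)" by (rule mod_hom_into_power[OF G_module v(1)])
      \<comment> \<open>\<open>?\<phi>'\<close> transports the family to the homology of
        \<open>P\<close>, and freeness of \<open>G 0\<close> lifts it to cycles.\<close>
      from module_ses.free_lifting[OF ses2 mod_hom_comp[OF G_module vh \<phi>']]
      obtain w where w: "w \<in> mod_hom R (G 0) ?Z" "\<And>z. z \<in> carrier (G 0) \<Longrightarrow> ?h (w z) = ?\<phi>' (?v z)" by blast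
      have "\<nu> (restrict w (carrier (G 0))) = y"
      proof (rule power_module_eqI[OF mod_hom_D(1)[OF \<nu>_hom restrict_mod_hom[OF G_module w(1)]] y])
        fix k assume k: "k < a"
        have "f k (w z) = v k z" if "z \<in> carrier (G 0)" for z
          unfolding f_def w(2)[OF that] \<phi>\<phi>'[OF mod_hom_D(1)[OF vh that]] using k by simp
        then show "\<nu> (restrict w (carrier (G 0))) k = y k"
          unfolding \<nu>_def v(2)[OF k] using k by (simp, intro tensor_sum_cong[OF L M eb v(1)[OF k]]) simp
      qed
      then show "y \<in> \<nu> ` carrier ?W" using restrict_mod_hom[OF G_module w(1)] by blast
    qed
  qed
  have f_boundary: "f k x = \<zero>\<^bsub>L\<^esub>" if "x \<in> boundaries P i" "k < a" for k x
  proof -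
    have "?h x = \<zero>\<^bsub>homology P i\<^esub>" using P.class_zero_iff subsetD[OF P.boundaries_subset_cycles] that(1) by blast
    then show ?thesis unfolding f_def using mod_hom_0[OF P.homology_module La \<phi>(1)] that(2)
      by (simp add: power_module_simps)
  qed
  have \<nu>_imp_\<mu>: "\<mu> v = \<zero>\<^bsub>homology ?X i\<^esub>" if v: "v \<in> mod_hom R (G 0) ?Z" and \<nu>0: "\<nu> v = \<zero>\<^bsub>power_module M a\<^esub>" for v
  proof -
    \<comment> \<open>Evaluation is injective, so each component represents zero in C \<otimes> L
      and factors through the dual differential.\<close>
    have "\<exists>w\<in>mod_hom R (G (Suc 0)) L. \<forall>z\<in>carrier (G 0). f k (v z) = w (dual_diff 0 z)" if k: "k < a" for k
    proof -
      have "?ev (tensor_sum ?T ?u (\<lambda>z. f k (v z))) = \<zero>\<^bsub>M\<^esub>"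
        unfolding ev_sum[OF fv[OF v k]] \<nu>_k[OF v k, symmetric] \<nu>0 using k by (simp add: power_module_simps)
      then have 0: "tensor_sum ?T ?u (\<lambda>z. f k (v z)) = \<zero>\<^bsub>?T\<^esub>"
        using mod_isomorphism_zero_iff[OF T M ev_hom bij_betw_imp_inj_on[OF ev_bij] tensor_sum_closed[OF L T ub fv[OF v k]]] by simp
      obtain w where "w \<in> mod_hom R (G (Suc 0)) L" "\<And>z. z \<in> carrier (G 0) \<Longrightarrow> f k (v z) = w (dual_diff 0 z)"
      proof (rule tensor_sum_zeroD[OF L T ub _ fv[OF v k] 0])
        show "\<exists>f\<in>mod_hom R ?T D. \<forall>l\<in>carrier L. \<forall>c\<in>carrier C. f (?u l c) = \<beta> l c"
          if "Module.module R D" "bilinear_map R L C D \<beta>"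
          for D :: "('r, (((('r, 'c) res_gen \<Rightarrow> 'r) \<Rightarrow> 'c \<Rightarrow> 'm) set)) module" and \<beta>
          using tensor_lift_hom[OF C L that(1) bilinear_map_flip[OF that(2)]]
            tensor_lift_pure[OF C L that(1) bilinear_map_flip[OF that(2)]] by blast
      qed (rule that)
      then show ?thesis by blast
    qed
    then obtain w where w: "\<And>k. k < a \<Longrightarrow> w k \<in> mod_hom R (G (Suc 0)) L"
      "\<And>k z. k < a \<Longrightarrow> z \<in> carrier (G 0) \<Longrightarrow> f k (v z) = w k (dual_diff 0 z)" by metis
    let ?w = "\<lambda>z. \<lambda>k\<in>{..<a}. w k z"
    have wh: "?w \<in> mod_hom R (G (Suc 0)) (power_module L a)" by (rule mod_hom_into_power[OF G_module w(1)])
    from module_ses.free_lifting[OF ses2 mod_hom_comp[OF G_module wh \<phi>']]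
    obtain w' where w': "w' \<in> mod_hom R (G (Suc 0)) ?Z"
      "\<And>z. z \<in> carrier (G (Suc 0)) \<Longrightarrow> ?h (w' z) = ?\<phi>' (?w z)" by blast
    note w'P = mod_hom_sub_D[OF w'(1) P.cycles_subset]
    note w'd = mod_hom_comp[OF G_module dual_diff_hom w'(1)] and w'dP = mod_hom_comp[OF G_module dual_diff_hom w'P(1)]
    have eq: "?h (v z) = ?h (w' (dual_diff 0 z))" if z: "z \<in> carrier (G 0)" for z
    proof -
      have hv: "?h (v z) \<in> carrier (homology P i)" by (rule mod_hom_D(1)[OF P.class_hom mod_hom_D(1)[OF v z]])
      note dz = mod_hom_D(1)[OF dual_diff_hom z]
      have "\<phi> (?h (v z)) = ?w (dual_diff 0 z)"
        by (rule power_module_eqI[OF mod_hom_D(1)[OF \<phi>(1) hv] mod_hom_D(1)[OF wh dz]])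
          (simp add: w(2)[OF _ z, symmetric] f_def)
      then show ?thesis unfolding w'(2)[OF dz] using bij_betw_inv_into_left[OF \<phi>(2) hv] by simp
    qed
    \<comment> \<open>After the subtraction all values are boundaries and lift to \<open>u\<close>
      in degree \<open>i + 1\<close>; the subtracted term contributes nothing to the tensor
      sum.\<close>
    let ?v = "\<lambda>z. v z \<ominus>\<^bsub>?Z\<^esub> w' (dual_diff 0 z)"
    have vZ: "?v \<in> mod_hom R (G 0) ?Z" by (rule mod_hom_minus[OF G_module P.cycle_module v w'd])
    have "?h (?v z) = \<zero>\<^bsub>homology P i\<^esub>" if z: "z \<in> carrier (G 0)" for z
      unfolding mod_hom_diff[OF P.cycle_module P.homology_module P.class_hom mod_hom_D(1)[OF v z] mod_hom_D(1)[OF w'd z]]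
        module_diff_eq_zero_iff[OF P.homology_module mod_hom_D(1)[OF P.class_hom mod_hom_D(1)[OF v z]]
          mod_hom_D(1)[OF P.class_hom mod_hom_D(1)[OF w'd z]]]
      by (rule eq[OF z])
    from module_ses.into_K[OF ses2 vZ this]
    have vB: "?v \<in> mod_hom R (G 0) (boundary_module P (i + 1 - 1))" by simp
    from module_ses.free_lifting[OF ses1 vB]
    obtain u where u: "u \<in> mod_hom R (G 0) (cx_mod P (i + 1))"
      "\<And>z. z \<in> carrier (G 0) \<Longrightarrow> cx_diff P (i + 1) (u z) = ?v z" by blast
    note du = mod_hom_comp[OF G_module u(1) P.cx_diff_hom']
    interpret ZM: Module.module R ?Z by (rule P.cycle_module)
    have "?s i v = ?s i (\<lambda>z. cx_diff P (i + 1) (u z) \<oplus>\<^bsub>cx_mod P i\<^esub> w' (dual_diff 0 z))"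
    proof (rule s_cong[OF mod_hom_add[OF G_module P.cx_module du w'dP]])
      fix z assume z: "z \<in> carrier (G 0)"
      have "v z = ?v z \<oplus>\<^bsub>?Z\<^esub> w' (dual_diff 0 z)"
        using mod_hom_D(1)[OF v z] mod_hom_D(1)[OF w'd z]
        by (simp only: ZM.M.minus_eq ZM.M.a_assoc ZM.M.l_neg ZM.M.a_inv_closed ZM.M.r_zero)
      then show "v z = cx_diff P (i + 1) (u z) \<oplus>\<^bsub>cx_mod P i\<^esub> w' (dual_diff 0 z)" unfolding u(2)[OF z] by simp
    qed
    also have "\<dots> = ?s i (\<lambda>z. cx_diff P (i + 1) (u z))"
      unfolding s_add[OF du w'dP] s_dual[OF w'P(1)]
      using s_closed[OF du] X.cx_module[of i, THEN Module.module.axioms(2)]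
      by (simp add: abelian_group_def abelian_monoid.r_zero)
    also have "\<dots> = cx_diff ?X (i + 1) (?s (i + 1) u)" using s_diff[OF u(1)] by simp
    finally have "?s i v \<in> boundaries ?X i" unfolding boundaries_def
      by (rule image_eqI) (rule s_closed[OF u(1)])
    then show ?thesis unfolding \<mu>[OF v] X.class_zero_iff[OF s_cycle[OF v]] .
  qed
  have \<mu>_imp_\<nu>: "\<nu> v = \<zero>\<^bsub>power_module M a\<^esub>" if v: "v \<in> mod_hom R (G 0) ?Z" and \<mu>0: "\<mu> v = \<zero>\<^bsub>homology ?X i\<^esub>" for v
  proof -
    have "?s i v \<in> boundaries ?X i" using \<mu>0 unfolding \<mu>[OF v] X.class_zero_iff[OF s_cycle[OF v]] .
    then obtain x where x: "x \<in> carrier (cx_mod ?X (i + 1))" "?s i v = cx_diff ?X (i + 1) x"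
      unfolding boundaries_def by (elim imageE)
    obtain u where u: "u \<in> mod_hom R (G 0) (cx_mod P (i + 1))" "x = ?s (i + 1) u"
      by (rule s_surj[OF x(1)]) (rule that)
    note du = mod_hom_comp[OF G_module u(1) P.cx_diff_hom']
    \<comment> \<open>\<open>?v\<close> represents zero and so factors through the dual
      differential. Acyclicity of the boundaries in degree \<open>i - 1\<close> makes the factor
      cycle-valued, so that \<open>f k\<close> may be applied to it; on the subtracted boundaries
      \<open>f k\<close> vanishes.\<close>
    let ?v = "\<lambda>z. v z \<ominus>\<^bsub>cx_mod P i\<^esub> cx_diff P (i + 1) (u z)"
    note vP = WP(1)[OF v]
    have v': "?v \<in> mod_hom R (G 0) (cx_mod P i)" by (rule mod_hom_minus[OF G_module P.cx_module vP du])
    interpret XM: Module.module R "cx_mod ?X i" by (rule X.cx_module)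
    have "?s i v = ?s i (\<lambda>z. ?v z \<oplus>\<^bsub>cx_mod P i\<^esub> cx_diff P (i + 1) (u z))"
      by (rule s_cong[OF mod_hom_add[OF G_module P.cx_module v' du]])
        (simp add: PM.M.minus_eq PM.M.a_assoc PM.M.l_neg mod_hom_D(1)[OF vP] mod_hom_D(1)[OF du])
    also have "\<dots> = ?s i ?v \<oplus>\<^bsub>cx_mod ?X i\<^esub> ?s i v"
      unfolding s_add[OF v' du] x(2) u(2) using s_diff[OF u(1)] by simp
    finally have "?s i ?v = \<zero>\<^bsub>cx_mod ?X i\<^esub>"
      by (rule module_eq_add_self[OF X.cx_module s_closed[OF v'] s_closed[OF vP]])
    then obtain w where w: "w \<in> mod_hom R (G (Suc 0)) (cx_mod P i)"
      "\<And>z. z \<in> carrier (G 0) \<Longrightarrow> ?v z = w (dual_diff 0 z)"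
      by (rule s_zero[OF v']) (rule that)
    have "cx_diff P i (w (dual_diff 0 z)) = \<zero>\<^bsub>boundary_module P (i - 1)\<^esub>" if z: "z \<in> carrier (G 0)" for z
    proof -
      have "cx_diff P i (?v z) = cx_diff P i (v z) \<ominus>\<^bsub>cx_mod P (i - 1)\<^esub> cx_diff P i (cx_diff P (i + 1) (u z))"
        by (rule mod_hom_diff[OF P.cx_module P.cx_module P.cx_diff_hom mod_hom_D(1)[OF vP z] mod_hom_D(1)[OF du z]])
      also have "\<dots> = \<zero>\<^bsub>cx_mod P (i - 1)\<^esub>"
        using WP(2)[OF v z] by (simp add: P.cx_diff_diff'[OF mod_hom_D(1)[OF u(1) z]]
          module_diff_eq_zero_iff[OF P.cx_module] cycles_def)
      finally show ?thesis unfolding w(2)[OF z] by simp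
    qed
    from tor_acyclic_correct[OF ses1 torB w(1) this]
    obtain w1 where w1: "w1 \<in> mod_hom R (G (Suc 0)) ?Z"
      "\<And>z. z \<in> carrier (G 0) \<Longrightarrow> w1 (dual_diff 0 z) = w (dual_diff 0 z)" by blast
    note w1d = mod_hom_comp[OF G_module dual_diff_hom w1(1)]
    show ?thesis
    proof (rule power_module_eqI[of _ M a])
      fix k assume k: "k < a"
      have "f k (v z) = f k (w1 (dual_diff 0 z))" if z: "z \<in> carrier (G 0)" for z
      proof -
        have b: "cx_diff P (i + 1) (u z) \<in> boundaries P i"
          using mod_hom_D(1)[OF u(1) z] by (simp add: boundaries_def)
        have c: "cx_diff P (i + 1) (u z) \<in> carrier ?Z" using subsetD[OF P.boundaries_subset_cycles b] by simp
        have w1c: "w1 (dual_diff 0 z) \<in> carrier ?Z" by (rule mod_hom_D(1)[OF w1d z])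
        have "v z = w1 (dual_diff 0 z) \<oplus>\<^bsub>?Z\<^esub> cx_diff P (i + 1) (u z)"
          using mod_hom_D(1)[OF vP z] mod_hom_D(1)[OF du z]
          by (simp add: w1(2)[OF z] w(2)[OF z, symmetric] PM.M.minus_eq PM.M.a_assoc PM.M.l_neg)
        then have "f k (v z) = f k (w1 (dual_diff 0 z)) \<oplus>\<^bsub>L\<^esub> f k (cx_diff P (i + 1) (u z))"
          using mod_hom_D(2)[OF f[OF k] w1c c] by simp
        then show ?thesis unfolding f_boundary[OF b k]
          using mod_hom_D(1)[OF f[OF k] w1c] L[THEN Module.module.axioms(2)]
          by (simp add: abelian_group_def abelian_monoid.r_zero)
      qed
      then have "tensor_sum M (\<lambda>l c. l c) (\<lambda>z. f k (v z)) = tensor_sum M (\<lambda>l c. l c) (\<lambda>z. f k (w1 (dual_diff 0 z)))"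
        by (intro tensor_sum_cong[OF L M eb mod_hom_comp[OF G_module w1d f[OF k]]])
      also have "\<dots> = \<zero>\<^bsub>M\<^esub>" by (rule tensor_sum_dual[OF L M eb mod_hom_comp[OF G_module w1(1) f[OF k]]])
      finally show "\<nu> v k = \<zero>\<^bsub>power_module M a\<^esub> k" using k by (simp add: \<nu>_k[OF v k] power_module_simps)
    next
      have "\<nu> v = \<nu> (restrict v (carrier (G 0)))"
        unfolding \<nu>_def by (intro restrict_ext arg_cong[where f = "tensor_sum M (\<lambda>l c. l c)"]) simp
      then show "\<nu> v \<in> carrier (power_module M a)"
        using mod_hom_D(1)[OF \<nu>_hom restrict_mod_hom[OF G_module v]] by simp
    qed simp
  qed
  show ?thesis
    by (rule mod_isomorphic_common_cover[OF W X.homology_module Ma \<mu>_hom \<mu>_surj \<nu>_hom \<nu>_surj])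
      (use \<mu>_imp_\<nu> \<nu>_imp_\<mu> hom_module_mod_hom in blast)
qed

end

section \<open>Quasi-projective resolutions\<close>

lemma zero_module_tensor_right:
  assumes A: "Module.module R A" and B: "Module.module R B" and z: "zero_module B"
  shows "zero_module (tensor_module R A B)"
  unfolding zero_module_iff[OF tensor_module_module[OF A B]]
proof
  fix w assume w: "w \<in> carrier (tensor_module R A B)"
  note T = tensor_module_module[OF A B]
  show "w = \<zero>\<^bsub>tensor_module R A B\<^esub>"
    by (rule tensor_hom_eq[OF A B T mod_hom_id mod_hom_zero_map[OF T T] _ w])
      (use z in \<open>simp add: zero_module_def mod_hom_0[OF B T bilinear_mapD(2)[OF pure_tensor_bilinear[OF A B]]]\<close>)
qed

lemma zero_module_hom:
  assumes A: "Module.module R A" and B: "Module.module R B" and z: "zero_module B"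
  shows "zero_module (hom_module R A B)"
proof -
  interpret H: Module.module R "hom_module R A B" by (rule hom_module_module[OF A B])
  show ?thesis
    unfolding zero_module_iff[OF H.module_axioms]
  proof
    fix f assume f: "f \<in> carrier (hom_module R A B)"
    show "f = \<zero>\<^bsub>hom_module R A B\<^esub>"
      by (rule hom_module_eqI[OF f H.M.zero_closed])
        (use mod_hom_D(1)[OF hom_module_mod_hom[OF f]] z in \<open>simp add: zero_module_def hom_module_simps\<close>)
  qed
qed

lemma semidualizing_ex_resolution:
  assumes "cring R" "noetherian_ring R" "semidualizing R C"
  obtains Y \<psi> where "semidualizing_resolution R C Y \<psi>"
proof -
  have C: "Module.module R C" "fin_gen R C"
    "homothety C \<in> mod_iso R (ring_as_module R) (hom_module R C C)"
    "\<And>i. i > 0 \<Longrightarrow> zero_module (Ext R C C i)"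
    using assms(3) by (auto simp: semidualizing_def)
  obtain Y \<psi> where Y: "finite_resolution R C Y \<psi>"
    using ex_finite_resolution[OF assms(1,2) C(1,2)] by blast
  have "semidualizing_resolution R C Y \<psi>"
    by (rule semidualizing_resolution.intro[OF Y])
      (use C(2,3) finite_resolution.ext_acyclicI[OF Y C(1) C(4)] in \<open>simp add: semidualizing_resolution_axioms_def\<close>)
  then show thesis by (rule that)
qed

text \<open>Evaluation identifies \<open>M\<close> with C \<otimes> Hom(C, M), so either module
  vanishes with the other.\<close>

lemma bass_class_zero_iff:
  assumes C: "Module.module R C" and M: "bass_class R C M"
  shows "zero_module M \<longleftrightarrow> zero_module (hom_module R C M)"
proof -
  have MM: "Module.module R M" and
    ev: "tensor_lift R M (\<lambda>c f. f c) \<in> mod_iso R (tensor_module R C (hom_module R C M)) M"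
    using M by (auto simp: bass_class_def)
  have L: "Module.module R (hom_module R C M)" by (rule hom_module_module[OF C MM])
  have "mod_isomorphic R (tensor_module R C (hom_module R C M)) M"
    using ev by (auto simp: mod_isomorphic_def)
  from mod_isomorphic_zero_module[OF tensor_module_module[OF C L] MM this]
  show ?thesis using zero_module_tensor_right[OF C L] zero_module_hom[OF C MM] by blast
qed

text \<open>The multiplicities \<open>a i\<close> are the same on both sides. All degrees are
  treated together because the acyclicity arguments involve every homology module, and each
  direction uses one of the two bounds on \<open>P\<close>.\<close>

lemma (in semidualizing_resolution) homology_tensor_iff:
  fixes P :: "('r, 'p) mod_complex"
  assumes M: "bass_class R C M" and P: "is_complex R P" "bounded_complex P"
      "\<And>i. projective_module R (cx_mod P i)"
  shows "(\<forall>i. mod_isomorphic R (homology (tensor_complex R P C) i) (power_module M (a i))) \<longleftrightarrow>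
    (\<forall>i. mod_isomorphic R (homology P i) (power_module (hom_module R C M) (a i)))"
proof -
  have MM: "Module.module R M" and
    ev: "tensor_lift R M (\<lambda>c f. f c) \<in> mod_iso R (tensor_module R C (hom_module R C M)) M" and
    van: "\<And>i. i > 0 \<Longrightarrow> zero_module (Ext R C M i)"
      "\<And>i. i > 0 \<Longrightarrow> zero_module (Tor R C (hom_module R C M) i)"
    using M by (auto simp: bass_class_def)
  have ext: "ext_acyclic M" by (rule ext_acyclicI[OF MM van(1)])
  have tor: "tor_acyclic (hom_module R C M)"
    by (rule tor_acyclicI[OF hom_module_module[OF C MM] van(2)])
  obtain m n where "\<And>i. i < m \<or> n < i \<Longrightarrow> zero_module (cx_mod P i)"
    using P(2) by (auto simp: bounded_complex_def)
  then have bd: "\<And>i. n < i \<Longrightarrow> zero_module (cx_mod P i)" "\<And>i. i < m \<Longrightarrow> zero_module (cx_mod P i)"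
    by auto
  show ?thesis
    using homology_tensor_imp_homology[OF P(1,3) bd(1) MM ext]
      homology_imp_homology_tensor[OF P(1,3) bd(2) MM tor ev] by blast
qed

text \<open>Ensures that tensoring with \<open>C\<close> preserves the supremum of a complex of
  projective modules.\<close>

lemma (in semidualizing_resolution) zero_module_projective_tensor_iff:
  fixes P :: "('r, 'p) module"
  assumes P: "projective_module R P"
  shows "zero_module (tensor_module R P C) \<longleftrightarrow> zero_module P"
proof
  have PM: "Module.module R P" using P by (simp add: projective_module_def)
  show "zero_module (tensor_module R P C)" if "zero_module P"
    by (rule zero_module_tensor[OF PM C that])
  assume z: "zero_module (tensor_module R P C)"
  show "zero_module P" unfolding zero_module_iff[OF PM]
  proof
    fix x assume x: "x \<in> carrier P"
    show "x = \<zero>\<^bsub>P\<^esub>"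
      by (rule projective_tensor_inj[OF C homothety P x])
        (use z mod_hom_D(1)[OF bilinear_mapD(2)[OF pure_tensor_bilinear[OF PM C] x]] in \<open>simp add: zero_module_def\<close>)
  qed
qed

section \<open>Resolutions described by multiplicities\<close>

lemma (in complex) zero_homology_isomorphic_power:
  assumes "zero_module (homology X i)" "Module.module R L"
  shows "mod_isomorphic R (homology X i) (power_module L 0)"
  using zero_module_mod_isomorphic[OF homology_module power_module_module[OF assms(2)] assms(1)]
    zero_module_power[OF assms(2)] by blast

lemma (in complex) homology_power_zero_iff:
  assumes "mod_isomorphic R (homology X i) (power_module L n)" "Module.module R L" "\<not> zero_module L"
  shows "zero_module (homology X i) \<longleftrightarrow> n = 0"
  using mod_isomorphic_zero_module[OF homology_module power_module_module[OF assms(2)] assms(1)]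
    zero_module_power[OF assms(2)] assms(3) by blast

lemma cx_inf_le: "\<not> zero_module (cx_mod P i) \<Longrightarrow> cx_inf P \<le> ereal (real_of_int i)"
  unfolding cx_inf_def by (rule INF_lower) simp

text \<open>
  Below \<^const>\<open>cx_inf\<close> the homology vanishes, hence is a \<open>0\<close>-th power; so the multiplicities in a
  resolution may be taken to be defined in all degrees.
\<close>

lemma qp_resolution_alt:
  assumes L: "Module.module R L" "\<not> zero_module L"
  shows "bounded_complex P \<and> qp_resolution R L P \<longleftrightarrow>
    is_complex R P \<and> bounded_complex P \<and> (\<forall>i. projective_module R (cx_mod P i)) \<and>
    (\<exists>a. (\<forall>i. mod_isomorphic R (homology P i) (power_module L (a i))) \<and> (\<exists>i. a i \<noteq> 0))"
    (is "?l \<longleftrightarrow> ?r")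
proof
  assume l: ?l
  then have P: "is_complex R P" by (simp add: qp_resolution_def)
  then interpret complex R P by (rule complex.intro)
  obtain a where a: "\<And>i. cx_inf P \<le> ereal (real_of_int i) \<Longrightarrow> mod_isomorphic R (homology P i) (power_module L (a i))"
    "\<exists>i. cx_inf P \<le> ereal (real_of_int i) \<and> a i \<noteq> 0"
    using l unfolding qp_resolution_def by blast
  define b where "b i = (if cx_inf P \<le> ereal (real_of_int i) then a i else 0)" for i
  have "mod_isomorphic R (homology P i) (power_module L (b i))" for i
  proof (cases "cx_inf P \<le> ereal (real_of_int i)")
    case False
    then have "zero_module (homology P i)" using zero_module_homology cx_inf_le by blast
    from zero_homology_isomorphic_power[OF this L(1)] show ?thesis using False by (simp add: b_def)
  qed (simp add: b_def a(1))
  moreover have "\<exists>i. b i \<noteq> 0" using a(2) by (auto simp: b_def)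
  ultimately show ?r using l unfolding qp_resolution_def by blast
next
  assume r: ?r
  then interpret complex R P by (intro complex.intro) simp
  obtain a i where a: "\<And>i. mod_isomorphic R (homology P i) (power_module L (a i))" "a i \<noteq> 0"
    using r by blast
  \<comment> \<open>As \<open>L\<close> is nonzero, a nonzero multiplicity means nonzero homology,
    which places the degree at or above the infimum.\<close>
  have "\<not> zero_module (homology P i)" using homology_power_zero_iff[OF a(1) L] a(2) by simp
  then have "\<not> zero_module (cx_mod P i)" by (rule contrapos_nn) (rule zero_module_homology)
  then have "cx_inf P \<le> ereal (real_of_int i)" by (rule cx_inf_le)
  moreover have "bounded_below_complex P"
    using r unfolding bounded_complex_def bounded_below_complex_def by blast
  ultimately show ?l unfolding qp_resolution_def using r a by (intro conjI exI[of _ a] exI[of _ i]) auto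
qed

text \<open>A zero module is a zeroth power, so the two alternatives of the definition merge and
  choice collects the exponents. For nonzero \<open>M\<close> only the zeroth power vanishes, which
  translates the failure of acyclicity.\<close>

lemma C_qp_resolution_alt:
  assumes C: "Module.module R C" and M: "Module.module R M" "\<not> zero_module M"
  shows "C_qp_resolution R C M P \<longleftrightarrow>
    is_complex R P \<and> bounded_complex P \<and> (\<forall>i. projective_module R (cx_mod P i)) \<and>
    (\<exists>a. (\<forall>i. mod_isomorphic R (homology (tensor_complex R P C) i) (power_module M (a i))) \<and> (\<exists>i. a i \<noteq> 0))"
proof (cases "is_complex R P")
  case True
  interpret X: complex R "tensor_complex R P C" by (rule complex.intro[OF tensor_is_complex[OF True C]])
  have "(\<forall>i. zero_module (homology (tensor_complex R P C) i) \<or>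
      (\<exists>n. mod_isomorphic R (homology (tensor_complex R P C) i) (power_module M n))) \<longleftrightarrow>
    (\<exists>a. \<forall>i. mod_isomorphic R (homology (tensor_complex R P C) i) (power_module M (a i)))"
    unfolding choice_iff[of "\<lambda>i n. mod_isomorphic R (homology (tensor_complex R P C) i) (power_module M n)", symmetric]
    by (intro all_cong1) (use X.zero_homology_isomorphic_power[OF _ M(1)] in auto)
  moreover have "\<not> acyclic_complex (tensor_complex R P C) \<longleftrightarrow> (\<exists>i. a i \<noteq> 0)"
    if "\<forall>i. mod_isomorphic R (homology (tensor_complex R P C) i) (power_module M (a i))" for a
    unfolding acyclic_complex_def using X.homology_power_zero_iff[OF spec[OF that] M] by simp
  ultimately show ?thesis unfolding C_qp_resolution_def by (metis (no_types, lifting))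
qed (simp add: C_qp_resolution_def)

text \<open>The type \<open>'p\<close> is the same on both sides because the very same complexes are
  resolutions in both senses. The third clause excludes \<open>M = 0\<close>: there all homology of
  P \<otimes> C would have to vanish, so no \<open>C\<close>-quasi-projective resolution exists,
  while a bounded exact complex of projectives with a nonzero term is a quasi-projective resolution
  of the zero module, all of whose powers are zero.\<close>

theorem theorem4p8:
  fixes R :: "('r, 'k) ring_scheme" and C :: "('r, 'c) module" and M :: "('r, 'm) module"
  assumes "cring R" and "noetherian_ring R"
    and "semidualizing R C"
    and "bass_class R C M"
  shows "(C_qpd TYPE('p) R C M < \<infinity> \<longleftrightarrow> qpd TYPE('p) R (hom_module R C M) < \<infinity>) \<and>
    C_qpd TYPE('p) R C M = qpd TYPE('p) R (hom_module R C M) \<and>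
    (\<not> zero_module M \<longrightarrow>
      (\<forall>P :: ('r, 'p) mod_complex. C_qp_resolution R C M P \<longleftrightarrow>
         bounded_complex P \<and> qp_resolution R (hom_module R C M) P))"
proof -
  let ?L = "hom_module R C M"
  obtain Y \<psi> where "semidualizing_resolution R C Y \<psi>"
    using semidualizing_ex_resolution[OF assms(1-3)] by blast
  then interpret semidualizing_resolution R C Y \<psi> .
  have M: "Module.module R M" using assms(4) by (simp add: bass_class_def)
  have L: "Module.module R ?L" by (rule hom_module_module[OF C M])
  note zero = bass_class_zero_iff[OF C assms(4)]
  have res: "C_qp_resolution R C M P \<longleftrightarrow> bounded_complex P \<and> qp_resolution R ?L P"
    if nz: "\<not> zero_module M" for P :: "('r, 'p) mod_complex"
    unfolding qp_resolution_alt[OF L nz[unfolded zero]] C_qp_resolution_alt[OF C M nz]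
    using homology_tensor_iff[OF assms(4), of P] by blast
  \<comment> \<open>Tensoring changes neither the degrees with nonzero module nor those with nonzero
    homology, and the two suprema depend on nothing else.\<close>
  have dim: "cx_sup (tensor_complex R P C) - cx_hsup (tensor_complex R P C) = cx_sup P - cx_hsup P"
    if nz: "\<not> zero_module M" and P: "C_qp_resolution R C M P" for P :: "('r, 'p) mod_complex"
  proof -
    from P obtain a where P: "is_complex R P" "bounded_complex P" "\<And>i. projective_module R (cx_mod P i)"
      and a: "\<And>i. mod_isomorphic R (homology (tensor_complex R P C) i) (power_module M (a i))"
      unfolding C_qp_resolution_alt[OF C M nz] by blast
    have a': "mod_isomorphic R (homology P i) (power_module ?L (a i))" for i
      using homology_tensor_iff[OF assms(4) P, of a] a by blast
    interpret P: complex R P by (rule complex.intro[OF P(1)])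
    interpret X: complex R "tensor_complex R P C" by (rule complex.intro[OF tensor_is_complex[OF P(1) C]])
    have "zero_module (cx_mod (tensor_complex R P C) i) \<longleftrightarrow> zero_module (cx_mod P i)" for i
      unfolding tensor_complex_simps by (rule zero_module_projective_tensor_iff[OF P(3)])
    moreover have "zero_module (homology (tensor_complex R P C) i) \<longleftrightarrow> zero_module (homology P i)" for i
      using X.homology_power_zero_iff[OF a M nz] P.homology_power_zero_iff[OF a' L nz[unfolded zero]] by simp
    ultimately show ?thesis unfolding cx_sup_def cx_hsup_def by simp
  qed
  \<comment> \<open>For \<open>M = 0\<close> also Hom(C, M) is zero, and both dimensions are
    \<open>-\<infinity>\<close> by definition.\<close>
  have "C_qpd TYPE('p) R C M = qpd TYPE('p) R ?L"
  proof (cases "zero_module M")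
    case False
    have "{P :: ('r, 'p) mod_complex. C_qp_resolution R C M P} =
        {P. bounded_complex P \<and> qp_resolution R ?L P}"
      using res[OF False] by (rule Collect_cong)
    then show ?thesis
      unfolding C_qpd_def qpd_def zero[symmetric] using False dim[OF False]
      by (auto intro!: INF_cong)
  qed (simp add: C_qpd_def qpd_def zero[symmetric])
  then show ?thesis using res by simp
qed

end
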